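(* Let $\Theta\subset\mathbb{R}$ be compact and let $\Phi:\mathbb{R}\to\mathbb{R}$ be a $C^2$ function for which there exist constants $C_1>0$ and $C_2>0$ such that $$|\xi||\Phi''(\xi)|\ge C_1\quad\text{and}\quad |\xi||\Phi''(\xi)|\ge C_2|\Phi'(\xi)|\qquad\text{for all } |\xi|\ge 1.$$ Then for any $q\in[1,4]$ and any $s>\frac{\beta(\Theta)+1}{4}$, there exists a constant $C_{q,s}$ (which may depend on $\Theta$ and $\Phi$ but not on $f$) such that for all $f\in H^s(\mathbb{R})$, $$\left\|\sup_{(t,\theta)\in[-1,1]\times\Theta}|S_tf(\cdot+t\theta)|\right\|_{L^q(-1,1)}\le C_{q,s}\|f\|_{H^s(\mathbb{R})}.$$
   Context: The Fourier transform is $\widehat f(\xi)=\int_{\mathbb{R}}e^{-ix\xi}f(x)\,dx$ (extended to $L^2(\mathbb{R})$ as usual). $H^s(\mathbb{R})$ is the Sobolev space with norm $\|f\|_{H^s(\mathbb{R})}=\|(1-\Delta)^{s/2}f\|_{L^2(\mathbb{R})}$. The evolution operator is $$S_tf(x)=\frac{1}{2\pi}\int_{\mathbb{R}}e^{i(x\xi+t\Phi(\xi))}\widehat f(\xi)\,d\xi .$$ The integral converges absolutely when $\widehat f\in L^1(\mathbb{R})$. For general $f\in H^s(\mathbb{R})$, $s\ge 0$, the pointwise value $S_tf(x)$ is understood as $\lim_{N\to\infty}\frac{1}{2\pi}\int_{|\xi|\le 2^N}e^{i(x\xi+t\Phi(\xi))}\widehat f(\xi)\,d\xi$ (with $N\in\mathbb{N}$)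 where this limit exists, and as $0$ otherwise. $\beta(\Theta)$ is the upper Minkowski dimension of $\Theta$: $\beta(\Theta)=\inf\{r>0:\limsup_{\delta\to0}N(\Theta,\delta)\delta^r=0\}$, where $N(\Theta,\delta)$ is the smallest number of intervals of length $\delta$ which cover $\Theta$. *)

theory Defs
  imports "HOL-Analysis.Analysis"
begin

text \<open>
  Functions in \<open>L\<^sup>p\<close> are represented by Lebesgue measurable functions (not by classes); every notion
  below is invariant under changing such a function on a null set.
\<close>

text \<open>Real powers on \<^typ>\<open>ennreal\<close>; only used for exponents \<open>p > 0\<close>, so that \<open>top\<close> is mapped to \<open>top\<close>.\<close>

definition ennreal_powr :: "ennreal \<Rightarrow> real \<Rightarrow> ennreal" where
  "ennreal_powr a p = (if a = top then top else ennreal (enn2real a powr p))"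

definition Lp_norm :: "'a measure \<Rightarrow> real \<Rightarrow> ('a \<Rightarrow> ennreal) \<Rightarrow> ennreal" where
  "Lp_norm M p g = ennreal_powr (\<integral>\<^sup>+x. ennreal_powr (g x) p \<partial>M) (1 / p)"

definition L2_norm :: "(real \<Rightarrow> complex) \<Rightarrow> ennreal" where
  "L2_norm f = Lp_norm lebesgue 2 (\<lambda>x. ennreal (norm (f x)))"

definition in_L2 :: "(real \<Rightarrow> complex) \<Rightarrow> bool" where
  "in_L2 f \<longleftrightarrow> f \<in> borel_measurable lebesgue \<and> L2_norm f < top"

definition fourier_L1 :: "(real \<Rightarrow> complex) \<Rightarrow> real \<Rightarrow> complex" where
  "fourier_L1 f \<xi> = (LINT x|lebesgue. exp (- \<i> * of_real (x * \<xi>)) * f x)"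

text \<open>
  The extension to \<open>L\<^sup>2\<close> by density of \<open>L\<^sup>1 \<inter> L\<^sup>2\<close>: by Plancherel's theorem, the transforms of any
  approximating sequence converge in \<open>L\<^sup>2\<close>, and the limit is unique almost everywhere.
\<close>

definition is_fourier_L2 :: "(real \<Rightarrow> complex) \<Rightarrow> (real \<Rightarrow> complex) \<Rightarrow> bool" where
  "is_fourier_L2 f g \<longleftrightarrow> in_L2 f \<and> in_L2 g \<and>
     (\<exists>F :: nat \<Rightarrow> real \<Rightarrow> complex.
        (\<forall>n. integrable lebesgue (F n) \<and> in_L2 (F n)) \<and>
        (\<lambda>n. L2_norm (\<lambda>x. F n x - f x)) \<longlonglongrightarrow> 0 \<and>
        (\<lambda>n. L2_norm (\<lambda>\<xi>. fourier_L1 (F n) \<xi> - g \<xi>)) \<longlonglongrightarrow> 0)"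

definition fourier :: "(real \<Rightarrow> complex) \<Rightarrow> real \<Rightarrow> complex" where
  "fourier f = (SOME g. is_fourier_L2 f g)"

definition inv_fourier :: "(real \<Rightarrow> complex) \<Rightarrow> real \<Rightarrow> complex" where
  "inv_fourier g x = fourier g (- x) / of_real (2 * pi)"

text \<open>The symbol of \<open>(1 - \<Delta>)\<^bsup>s/2\<^esup> f\<close>, and the operator itself as a Fourier multiplier.\<close>

definition bessel_symbol :: "real \<Rightarrow> (real \<Rightarrow> complex) \<Rightarrow> real \<Rightarrow> complex" where
  "bessel_symbol s f \<xi> = of_real ((1 + \<xi>\<^sup>2) powr (s / 2)) * fourier f \<xi>"

definition bessel :: "real \<Rightarrow> (real \<Rightarrow> complex) \<Rightarrow> real \<Rightarrow> complex" where
  "bessel s f = inv_fourier (bessel_symbol s f)"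

text \<open>For \<open>s \<ge> 0\<close>, where \<open>H\<^sup>s\<close> is a subspace of \<open>L\<^sup>2\<close>.\<close>

definition in_sobolev :: "real \<Rightarrow> (real \<Rightarrow> complex) \<Rightarrow> bool" where
  "in_sobolev s f \<longleftrightarrow> in_L2 f \<and> in_L2 (bessel_symbol s f)"

definition sobolev_norm :: "real \<Rightarrow> (real \<Rightarrow> complex) \<Rightarrow> ennreal" where
  "sobolev_norm s f = L2_norm (bessel s f)"

text \<open>
  If \<^term>\<open>fourier f\<close> is integrable, the limit below is, by dominated convergence, the absolutely
  convergent integral over the whole line.
\<close>

definition evol_partial ::
    "(real \<Rightarrow> real) \<Rightarrow> real \<Rightarrow> (real \<Rightarrow> complex) \<Rightarrow> real \<Rightarrow> nat \<Rightarrow> complex" where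
  "evol_partial \<Phi> t f x N =
     (LINT \<xi>:{\<xi>. \<bar>\<xi>\<bar> \<le> 2 ^ N}|lebesgue. exp (\<i> * of_real (x * \<xi> + t * \<Phi> \<xi>)) * fourier f \<xi>)
       / of_real (2 * pi)"

definition evol :: "(real \<Rightarrow> real) \<Rightarrow> real \<Rightarrow> (real \<Rightarrow> complex) \<Rightarrow> real \<Rightarrow> complex" where
  "evol \<Phi> t f x =
     (if convergent (evol_partial \<Phi> t f x) then lim (evol_partial \<Phi> t f x) else 0)"

definition maximal_evol ::
    "(real \<Rightarrow> real) \<Rightarrow> real set \<Rightarrow> (real \<Rightarrow> complex) \<Rightarrow> real \<Rightarrow> ennreal" where
  "maximal_evol \<Phi> \<Theta> f x =
     (SUP (t, \<theta>) \<in> {-1..1} \<times> \<Theta>. ennreal (norm (evol \<Phi> t f (x + t * \<theta>))))"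

text \<open>
  Intervals of length \<open>\<delta>\<close> are taken closed and given by their left endpoints; this does not change
  the smallest number. It exists whenever \<open>\<Theta>\<close> is bounded and \<open>\<delta> > 0\<close>.
\<close>

definition covering_number :: "real set \<Rightarrow> real \<Rightarrow> nat" where
  "covering_number \<Theta> \<delta> =
     (LEAST n. \<exists>A. finite A \<and> card A = n \<and> \<Theta> \<subseteq> (\<Union>a\<in>A. {a..a + \<delta>}))"

definition upper_minkowski_dim :: "real set \<Rightarrow> real" where
  "upper_minkowski_dim \<Theta> =
     Inf {r. 0 < r \<and>
       Limsup (at_right 0) (\<lambda>\<delta>. ereal (real (covering_number \<Theta> \<delta>) * \<delta> powr r)) = 0}"

end

theory Submission
  imports Defs "HOL-Probability.Characteristic_Functions"
begin

text \<open>
Fix a dyadic frequency \<open>R = 2^k\<close> and let \<open>h\<close> be the part of the Fourier transform of \<open>f\<close> that lives on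
\<open>R/2 < |\<xi>| \<le> R\<close>.  Choosing at each \<open>x\<close> a time \<open>t(x)\<close> and a direction \<open>\<theta>(x)\<close> at which the
supremum, first over finitely many parameters, is attained turns the maximal function into a linear operator \<open>T\<close> applied to \<open>h\<close>, and \<open>T : L\<^sup>2 \<rightarrow> L\<^sup>4(-1,1)\<close> is bounded as soon
as \<open>T T\<^sup>*\<close> is bounded from \<open>L\<^bsup>4/3\<^esup>\<close> to \<open>L\<^sup>4\<close>.  The kernel of \<open>T T\<^sup>*\<close> is the integral of
\<open>exp (i (u \<xi> + \<tau> \<Phi>(\<xi>)))\<close> over the frequency band, where \<open>\<tau> = t(x) - t(y)\<close> and
\<open>u = x - y + t(x) \<theta>(x) - t(y) \<theta>(y)\<close>.  Suppose that all directions are within \<open>1/R\<close> of a fixed \<open>\<theta>0\<close>.  Then, after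
\<open>\<theta>0 \<xi>\<close> has been absorbed into \<open>\<Phi>\<close>, the number \<open>u\<close> is \<open>x - y\<close> up to an error \<open>2/R\<close>, which is invisible at
frequency \<open>R\<close>.  The two hypotheses on \<open>\<Phi>\<close> together give \<open>c |\<Phi>' + \<theta>0| \<le> |\<xi>| |\<Phi>''|\<close> with \<open>c\<close> independent of \<open>\<theta>0\<close>
in a bounded set.  Hence, where the derivative \<open>u + \<tau> (\<Phi>' + \<theta>0)\<close> of the phase is smaller than \<open>|u|/2\<close>, its
own derivative is at least \<open>c |u| / (2 R)\<close>, and the kernel is bounded by a multiple of \<open>(R / |u|)^{1/2}\<close>
whatever \<open>\<tau>\<close> is (lemmas \<open>oscillatory_integral_bound\<close> and \<open>phase_kernel_bound\<close>).  The square of this majorant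
has integral \<open>O(R log R)\<close> over \<open>[-2,2]\<close>, and the Cauchy-Schwarz inequality gives \<open>\<parallel>T h\<parallel>\<^sub>4\<^sup>4 \<le> C R log R \<parallel>h\<parallel>\<^sub>2\<^sup>4\<close>
(lemma \<open>TT_star_L4\<close>).

A general \<open>\<Theta>\<close> is covered by \<open>N(\<Theta>, 1/R)\<close> intervals of length \<open>1/R\<close>, and the fourth powers are added up
(lemma \<open>maximal_L4_directions\<close>).  For an exponent \<open>r\<close> slightly above the Minkowski dimension this costs
a factor \<open>O(2^{k r})\<close>, so the \<open>k\<close>-th piece of the maximal function has fourth power of its \<open>L\<^sup>4\<close> norm at most
\<open>C (k + 1) 2^{k (r + 1 - 4 s)} \<parallel>f\<parallel>\<^sup>4\<close> in terms of the \<open>H\<^sup>s\<close> norm, which decays geometrically because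
\<open>s > (r + 1)/4\<close>.  Weighting the pieces by a smaller geometric factor gives one integrable function \<open>S\<close> with
\<open>|piece k| \<le> S(x)^{1/4} \<tau>^k\<close> for all \<open>(t, \<theta>)\<close> (lemma \<open>dyadic_majorant\<close>).  At almost every \<open>x\<close> the dyadic partial
sums therefore converge uniformly in \<open>(t, \<theta>)\<close>.  This bounds the supremum, and, since the limit is continuous in
\<open>(t, \<theta>)\<close>, the supremum may be taken over a countable dense set and is measurable (lemma
\<open>evol_at_good_point\<close>).  The exponents \<open>q \<le> 4\<close> follow because \<open>(-1,1)\<close> has finite measure.

The \<open>H\<^sup>s\<close> norm is the \<open>L\<^sup>2\<close> norm of an inverse Fourier transform, whereas the argument above needs the weighted
\<open>L\<^sup>2\<close> norm of the transform.  The comparison is Plancherel's theorem, up to a constant: inserting a Gaussian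
weight gives the upper bound for all functions in \<open>L\<^sup>1 \<inter> L\<^sup>2\<close> and the lower bound for a dense class, from which
the \<open>L\<^sup>2\<close> transform exists (lemma \<open>is_fourier_L2_exists\<close>) and is bounded below (lemma \<open>is_fourier_L2_lower\<close>).
\<close>

section \<open>Oscillatory integrals\<close>

text \<open>
This is van der Corput's lemma in a form that needs no subdivision of the interval.  One would like to
integrate by parts with \<open>exp (i \<phi>) = (exp (i \<phi>))' / (i \<mu>)\<close>, but \<open>\<mu> = \<phi>'\<close> may vanish.  Replacing \<open>1/\<mu>\<close> by the
bounded function \<open>\<mu> / (\<mu>\<^sup>2 + \<delta>\<^sup>2)\<close> leaves the error \<open>\<delta>\<^sup>2 / (\<mu>\<^sup>2 + \<delta>\<^sup>2)\<close>.  This is at most \<open>\<delta>\<^sup>2 / D\<^sup>2\<close> where \<open>|\<mu>| \<ge> D\<close>, and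
where \<open>|\<mu>'| \<ge> l\<close> it is dominated by a multiple of the derivative of the monotone function \<open>arctan (\<mu> / \<delta>)\<close>,
whose total variation is at most \<open>\<pi>\<close>.
\<close>

lemma oscillatory_integral_bound:
  fixes \<phi> \<mu> \<mu>' :: "real \<Rightarrow> real" and a b \<sigma> \<delta> D l :: real
  assumes ab: "a \<le> b"
    and d1: "\<And>\<xi>. \<xi> \<in> {a..b} \<Longrightarrow> (\<phi> has_real_derivative \<mu> \<xi>) (at \<xi> within {a..b})"
    and d2: "\<And>\<xi>. \<xi> \<in> {a..b} \<Longrightarrow> (\<mu> has_real_derivative \<mu>' \<xi>) (at \<xi> within {a..b})"
    and sg: "\<bar>\<sigma>\<bar> = 1" "\<And>\<xi>. \<xi> \<in> {a..b} \<Longrightarrow> 0 \<le> \<sigma> * \<mu>' \<xi>"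
    and pos: "\<delta> > 0" "D > 0" "l > 0"
    and alt: "\<And>\<xi>. \<xi> \<in> {a..b} \<Longrightarrow> D \<le> \<bar>\<mu> \<xi>\<bar> \<or> l \<le> \<bar>\<mu>' \<xi>\<bar>"
  shows "norm (integral {a..b} (\<lambda>\<xi>. cis (\<phi> \<xi>))) \<le> (1 + pi) / \<delta> + \<delta>\<^sup>2 / D\<^sup>2 * (b - a) + pi * \<delta> / l"
proof -
  define m where "m \<xi> = (\<mu> \<xi>)\<^sup>2 + \<delta>\<^sup>2" for \<xi>
  have m0: "m \<xi> > 0" for \<xi> using pos by (simp add: m_def add_nonneg_pos)
  define G where "G \<xi> = cis (\<phi> \<xi>) * of_real (\<mu> \<xi> / m \<xi>)" for \<xi>
  define G' where "G' \<xi> = \<i> * of_real (\<mu> \<xi>) * cis (\<phi> \<xi>) * of_real (\<mu> \<xi> / m \<xi>)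
      + cis (\<phi> \<xi>) * of_real (\<mu>' \<xi> * (\<delta>\<^sup>2 - (\<mu> \<xi>)\<^sup>2) / (m \<xi>)\<^sup>2)" for \<xi>
  define W where "W \<xi> = arctan (\<mu> \<xi> / \<delta>)" for \<xi>
  define W' where "W' \<xi> = \<delta> * \<mu>' \<xi> / m \<xi>" for \<xi>
  have dc: "((\<lambda>\<xi>. cis (\<phi> \<xi>)) has_vector_derivative \<i> * of_real (\<mu> \<xi>) * cis (\<phi> \<xi>)) (at \<xi> within {a..b})"
    if "\<xi> \<in> {a..b}" for \<xi>
    using has_derivative_cis[OF d1[OF that, unfolded has_field_derivative_def]]
    unfolding has_vector_derivative_def by (simp add: scaleR_conv_of_real mult_ac)
  have dq: "((\<lambda>\<xi>. \<mu> \<xi> / m \<xi>) has_real_derivative \<mu>' \<xi> * (\<delta>\<^sup>2 - (\<mu> \<xi>)\<^sup>2) / (m \<xi>)\<^sup>2) (at \<xi> within {a..b})"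
    if "\<xi> \<in> {a..b}" for \<xi>
    using m0[of \<xi>] unfolding m_def
    by (auto intro!: derivative_eq_intros d2[OF that] simp: power2_eq_square algebra_simps)
  have dG: "(G has_vector_derivative G' \<xi>) (at \<xi> within {a..b})" if "\<xi> \<in> {a..b}" for \<xi>
    unfolding G_def G'_def
    by (rule derivative_eq_intros dc[OF that]
        has_vector_derivative_of_real[OF dq[OF that]] refl
        | simp add: algebra_simps)+
  have dW: "(W has_vector_derivative W' \<xi>) (at \<xi> within {a..b})" if "\<xi> \<in> {a..b}" for \<xi>
    unfolding W_def W'_def has_real_derivative_iff_has_vector_derivative[symmetric]
    using pos m0[of \<xi>] unfolding m_def
    by (auto intro!: derivative_eq_intros d2[OF that] simp: divide_simps power2_eq_square algebra_simps)
  have IG: "(G' has_integral G b - G a) {a..b}"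
    by (rule fundamental_theorem_of_calculus[OF ab dG])
  have IW: "(W' has_integral W b - W a) {a..b}"
    by (rule fundamental_theorem_of_calculus[OF ab dW])
  define k where "k = 1 / \<delta> + \<delta> / l"
  have Ic: "(\<lambda>\<xi>. cis (\<phi> \<xi>)) integrable_on {a..b}"
    by (intro integrable_continuous_real continuous_on_cis
        DERIV_continuous_on[OF d1])
  have pt: "norm (cis (\<phi> \<xi>) + \<i> * G' \<xi>) \<le> \<delta>\<^sup>2 / D\<^sup>2 + k * (\<sigma> * W' \<xi>)" if x: "\<xi> \<in> {a..b}" for \<xi>
  proof -
    have abs: "\<sigma> * \<mu>' \<xi> = \<bar>\<mu>' \<xi>\<bar>"
      using sg(1) sg(2)[OF x] by (metis abs_mult abs_of_nonneg mult_1)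
    \<comment> \<open>\<open>-i G'\<close> is the part of the integrand that is an exact derivative; two error terms remain.\<close>
    have e: "cis (\<phi> \<xi>) + \<i> * G' \<xi>
        = cis (\<phi> \<xi>) * of_real (\<delta>\<^sup>2 / m \<xi>) + \<i> * cis (\<phi> \<xi>) * of_real (\<mu>' \<xi> * (\<delta>\<^sup>2 - (\<mu> \<xi>)\<^sup>2) / (m \<xi>)\<^sup>2)"
    proof -
      have "\<mu> \<xi> * (\<mu> \<xi> / m \<xi>) = 1 - \<delta>\<^sup>2 / m \<xi>"
      proof -
        have "\<mu> \<xi> * (\<mu> \<xi> / m \<xi>) = (m \<xi> - \<delta>\<^sup>2) / m \<xi>" by (simp add: m_def power2_eq_square)
        then show ?thesis using m0[of \<xi>] by (simp add: diff_divide_distrib)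
      qed
      then have "of_real (\<mu> \<xi>) * of_real (\<mu> \<xi> / m \<xi>) = (1 - of_real (\<delta>\<^sup>2 / m \<xi>) :: complex)"
        by (metis of_real_1 of_real_diff of_real_mult)
      then have "\<i> * (\<i> * of_real (\<mu> \<xi>) * cis (\<phi> \<xi>) * of_real (\<mu> \<xi> / m \<xi>))
          = - cis (\<phi> \<xi>) * (1 - of_real (\<delta>\<^sup>2 / m \<xi>) :: complex)"
        by (metis (no_types, lifting) i_squared mult.assoc mult.left_commute mult_minus1 mult_minus_left)
      then show ?thesis
        unfolding G'_def by (simp add: algebra_simps)
    qed
    have b1: "\<bar>\<mu>' \<xi> * (\<delta>\<^sup>2 - (\<mu> \<xi>)\<^sup>2) / (m \<xi>)\<^sup>2\<bar> \<le> \<bar>\<mu>' \<xi>\<bar> / m \<xi>"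
    proof -
      have "\<bar>\<delta>\<^sup>2 - (\<mu> \<xi>)\<^sup>2\<bar> \<le> m \<xi>" unfolding m_def by (auto simp: abs_le_iff)
      then have "\<bar>\<mu>' \<xi>\<bar> * \<bar>\<delta>\<^sup>2 - (\<mu> \<xi>)\<^sup>2\<bar> / (m \<xi>)\<^sup>2 \<le> \<bar>\<mu>' \<xi>\<bar> * m \<xi> / (m \<xi>)\<^sup>2"
        by (intro divide_right_mono mult_left_mono) auto
      then show ?thesis using m0[of \<xi>] by (simp add: abs_mult power2_eq_square)
    qed
    have b2: "\<delta>\<^sup>2 / m \<xi> \<le> \<delta>\<^sup>2 / D\<^sup>2 + \<delta>\<^sup>2 / l * (\<bar>\<mu>' \<xi>\<bar> / m \<xi>)"
      using alt[OF x]
    proof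
      assume "D \<le> \<bar>\<mu> \<xi>\<bar>"
      then have "D\<^sup>2 \<le> (\<mu> \<xi>)\<^sup>2" using pos by (metis abs_le_square_iff abs_of_pos)
      then have "D\<^sup>2 \<le> m \<xi>" by (simp add: m_def add_increasing2)
      then have "\<delta>\<^sup>2 / m \<xi> \<le> \<delta>\<^sup>2 / D\<^sup>2" using pos by (intro divide_left_mono) (auto simp: m0)
      moreover have "0 \<le> \<delta>\<^sup>2 / l * (\<bar>\<mu>' \<xi>\<bar> / m \<xi>)" using pos m0[of \<xi>] by auto
      ultimately show ?thesis by linarith
    next
      assume "l \<le> \<bar>\<mu>' \<xi>\<bar>"
      then have "1 \<le> \<bar>\<mu>' \<xi>\<bar> / l" using pos by simp
      then have "\<delta>\<^sup>2 / m \<xi> * 1 \<le> \<delta>\<^sup>2 / m \<xi> * (\<bar>\<mu>' \<xi>\<bar> / l)"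
        using m0[of \<xi>] by (intro mult_left_mono) auto
      moreover have "\<delta>\<^sup>2 / m \<xi> * (\<bar>\<mu>' \<xi>\<bar> / l) = \<delta>\<^sup>2 / l * (\<bar>\<mu>' \<xi>\<bar> / m \<xi>)" by simp
      moreover have "0 \<le> \<delta>\<^sup>2 / D\<^sup>2" by simp
      ultimately show ?thesis by linarith
    qed
    have "norm (cis (\<phi> \<xi>) + \<i> * G' \<xi>) \<le> \<bar>\<delta>\<^sup>2 / m \<xi>\<bar> + \<bar>\<mu>' \<xi> * (\<delta>\<^sup>2 - (\<mu> \<xi>)\<^sup>2) / (m \<xi>)\<^sup>2\<bar>"
      unfolding e by (rule order_trans[OF norm_triangle_ineq]) (simp add: norm_mult del: of_real_divide of_real_power of_real_mult)
    also have "\<dots> \<le> \<delta>\<^sup>2 / D\<^sup>2 + \<delta>\<^sup>2 / l * (\<bar>\<mu>' \<xi>\<bar> / m \<xi>) + \<bar>\<mu>' \<xi>\<bar> / m \<xi>"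
      using b1 b2 m0[of \<xi>] by simp
    also have "\<dots> = \<delta>\<^sup>2 / D\<^sup>2 + k * (\<sigma> * W' \<xi>)"
    proof -
      have "\<sigma> * W' \<xi> = \<delta> * (\<bar>\<mu>' \<xi>\<bar> / m \<xi>)" unfolding W'_def abs[symmetric] by simp
      then have "k * (\<sigma> * W' \<xi>) = (k * \<delta>) * (\<bar>\<mu>' \<xi>\<bar> / m \<xi>)" by simp
      moreover have "k * \<delta> = 1 + \<delta>\<^sup>2 / l"
        using pos unfolding k_def by (simp add: field_simps power2_eq_square)
      ultimately show ?thesis by (simp add: distrib_right add_divide_distrib)
    qed
    finally show ?thesis .
  qed
  have I1: "((\<lambda>\<xi>. cis (\<phi> \<xi>) + \<i> * G' \<xi>) has_integral integral {a..b} (\<lambda>\<xi>. cis (\<phi> \<xi>)) + \<i> * (G b - G a)) {a..b}"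
    by (intro has_integral_add integrable_integral Ic has_integral_mult_right IG)
  have I2: "((\<lambda>\<xi>. \<delta>\<^sup>2 / D\<^sup>2 + k * (\<sigma> * W' \<xi>)) has_integral (b - a) * (\<delta>\<^sup>2 / D\<^sup>2) + k * (\<sigma> * (W b - W a))) {a..b}"
    using has_integral_add[OF has_integral_const_real[of "\<delta>\<^sup>2 / D\<^sup>2" a b]
      has_integral_mult_right[OF has_integral_mult_right[OF IW, of \<sigma>], of k]] ab by simp
  have "norm (integral {a..b} (\<lambda>\<xi>. cis (\<phi> \<xi>)) + \<i> * (G b - G a)) \<le> (b - a) * (\<delta>\<^sup>2 / D\<^sup>2) + k * (\<sigma> * (W b - W a))"
    using integral_norm_bound_integral[of "\<lambda>\<xi>. cis (\<phi> \<xi>) + \<i> * G' \<xi>" "{a..b}" "\<lambda>\<xi>. \<delta>\<^sup>2 / D\<^sup>2 + k * (\<sigma> * W' \<xi>)"]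
      I1 I2 pt by (auto simp: has_integral_iff)
  moreover have "\<sigma> * (W b - W a) \<le> pi"
  proof -
    have "\<sigma> = 1 \<or> \<sigma> = -1" using sg(1) by linarith
    moreover have "\<bar>W b - W a\<bar> \<le> pi"
      using arctan_bounded[of "\<mu> a / \<delta>"] arctan_bounded[of "\<mu> b / \<delta>"] unfolding W_def by linarith
    ultimately show ?thesis by auto
  qed
  then have kW: "k * (\<sigma> * (W b - W a)) \<le> k * pi" using pos by (intro mult_left_mono) (auto simp: k_def)
  have nG: "norm (G \<xi>) \<le> 1 / (2 * \<delta>)" for \<xi>
  proof -
    have "2 * \<delta> * \<bar>\<mu> \<xi>\<bar> \<le> m \<xi>"
      using sum_squares_bound[of "\<bar>\<mu> \<xi>\<bar>" \<delta>] unfolding m_def by (simp add: algebra_simps)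
    then have "\<bar>\<mu> \<xi>\<bar> / m \<xi> \<le> 1 / (2 * \<delta>)" using pos m0[of \<xi>] by (simp add: field_simps)
    then show ?thesis unfolding G_def using m0[of \<xi>] by (simp add: norm_mult norm_divide)
  qed
  moreover have "norm (\<i> * (G b - G a)) \<le> 1 / \<delta>"
    using norm_triangle_ineq4[of "G b" "G a"] nG[of a] nG[of b]
    by (simp add: norm_mult)
  moreover have "norm (integral {a..b} (\<lambda>\<xi>. cis (\<phi> \<xi>)))
      \<le> norm (integral {a..b} (\<lambda>\<xi>. cis (\<phi> \<xi>)) + \<i> * (G b - G a)) + norm (\<i> * (G b - G a))"
    by (metis add_diff_cancel_right' norm_triangle_ineq4)
  ultimately have "norm (integral {a..b} (\<lambda>\<xi>. cis (\<phi> \<xi>))) \<le> (b - a) * (\<delta>\<^sup>2 / D\<^sup>2) + k * pi + 1 / \<delta>"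
    using kW by linarith
  also have "\<dots> = (1 + pi) / \<delta> + \<delta>\<^sup>2 / D\<^sup>2 * (b - a) + pi * \<delta> / l"
    unfolding k_def using pos by (simp add: field_simps)
  finally show ?thesis .
qed

text \<open>
The bound is uniform in \<open>t\<close>: where the term \<open>t \<Psi>'\<close> is large enough to cancel \<open>u\<close>, the condition
\<open>c |\<Psi>'| \<le> R |\<Psi>''|\<close> forces the second derivative of the phase to be at least \<open>c |u| / (2 R)\<close>.  The choice
\<open>\<delta> = (|u|/R)^{1/2}\<close> balances the first and the last term of the preceding lemma; the middle one is at most
\<open>4 / |u|\<close>, which is no larger than \<open>4 (R/|u|)^{1/2}\<close> because \<open>|u| \<ge> 1/R\<close>.  The constants \<open>9\<close> and \<open>7\<close> round up
\<open>5 + \<pi>\<close> and \<open>2 \<pi>\<close>.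
\<close>

lemma phase_integral_decay:
  fixes \<Psi> \<Psi>' \<Psi>'' :: "real \<Rightarrow> real" and a b \<sigma> c R t u :: real
  assumes ab: "a \<le> b" "b - a \<le> R" and R: "R > 0" and c: "c > 0"
    and d1: "\<And>\<xi>. \<xi> \<in> {a..b} \<Longrightarrow> (\<Psi> has_real_derivative \<Psi>' \<xi>) (at \<xi> within {a..b})"
    and d2: "\<And>\<xi>. \<xi> \<in> {a..b} \<Longrightarrow> (\<Psi>' has_real_derivative \<Psi>'' \<xi>) (at \<xi> within {a..b})"
    and sg: "\<bar>\<sigma>\<bar> = 1" "\<And>\<xi>. \<xi> \<in> {a..b} \<Longrightarrow> 0 \<le> \<sigma> * \<Psi>'' \<xi>"
    and cv: "\<And>\<xi>. \<xi> \<in> {a..b} \<Longrightarrow> c * \<bar>\<Psi>' \<xi>\<bar> \<le> R * \<bar>\<Psi>'' \<xi>\<bar>"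
    and u: "1 / R \<le> \<bar>u\<bar>"
  shows "norm (integral {a..b} (\<lambda>\<xi>. cis (u * \<xi> + t * \<Psi> \<xi>))) \<le> (9 + 7 / c) * sqrt (R / \<bar>u\<bar>)"
proof -
  have u0: "\<bar>u\<bar> > 0" using u R by (metis divide_pos_pos less_le_trans zero_less_one)
  define \<delta> where "\<delta> = sqrt (\<bar>u\<bar> / R)"
  define s where "s = sqrt (R / \<bar>u\<bar>)"
  have s: "s > 0" "s\<^sup>2 = R / \<bar>u\<bar>" "\<delta> = 1 / s" using R u0 by (simp_all add: s_def \<delta>_def flip: real_sqrt_divide)
    (simp add: real_sqrt_divide)
  define \<tau> where "\<tau> = (if t \<ge> 0 then \<sigma> else - \<sigma>)"
  have B: "norm (integral {a..b} (\<lambda>\<xi>. cis (u * \<xi> + t * \<Psi> \<xi>)))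
     \<le> (1 + pi) / \<delta> + \<delta>\<^sup>2 / (\<bar>u\<bar> / 2)\<^sup>2 * (b - a) + pi * \<delta> / (c * \<bar>u\<bar> / (2 * R))"
  proof (rule oscillatory_integral_bound[where \<mu> = "\<lambda>\<xi>. u + t * \<Psi>' \<xi>" and \<mu>' = "\<lambda>\<xi>. t * \<Psi>'' \<xi>" and \<sigma> = \<tau>])
    fix \<xi> assume x: "\<xi> \<in> {a..b}"
    show "((\<lambda>\<xi>. u * \<xi> + t * \<Psi> \<xi>) has_real_derivative u + t * \<Psi>' \<xi>) (at \<xi> within {a..b})"
      by (auto intro!: derivative_eq_intros d1 x)
    show "((\<lambda>\<xi>. u + t * \<Psi>' \<xi>) has_real_derivative t * \<Psi>'' \<xi>) (at \<xi> within {a..b})"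
      by (auto intro!: derivative_eq_intros d2 x)
    show "0 \<le> \<tau> * (t * \<Psi>'' \<xi>)"
    proof -
      have "\<tau> * (t * \<Psi>'' \<xi>) = \<bar>t\<bar> * (\<sigma> * \<Psi>'' \<xi>)" by (auto simp: \<tau>_def)
      also have "\<dots> \<ge> 0" using sg(2)[OF x] mult_nonneg_nonneg[of "\<bar>t\<bar>"] by simp
      finally show ?thesis .
    qed
    show "\<bar>u\<bar> / 2 \<le> \<bar>u + t * \<Psi>' \<xi>\<bar> \<or> c * \<bar>u\<bar> / (2 * R) \<le> \<bar>t * \<Psi>'' \<xi>\<bar>"
    proof (cases "\<bar>u\<bar> / 2 \<le> \<bar>u + t * \<Psi>' \<xi>\<bar>")
      case False
      then have "\<bar>u\<bar> / 2 \<le> \<bar>t\<bar> * \<bar>\<Psi>' \<xi>\<bar>" unfolding abs_mult[symmetric] by linarith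
      then have "c * (\<bar>u\<bar> / 2) \<le> \<bar>t\<bar> * (c * \<bar>\<Psi>' \<xi>\<bar>)"
        using mult_left_mono[of "\<bar>u\<bar> / 2" _ c] c by (simp add: mult_ac)
      also have "\<dots> \<le> \<bar>t\<bar> * (R * \<bar>\<Psi>'' \<xi>\<bar>)" by (intro mult_left_mono cv x) auto
      finally have "c * \<bar>u\<bar> / (2 * R) \<le> \<bar>t\<bar> * \<bar>\<Psi>'' \<xi>\<bar>" using R by (simp add: field_simps)
      then show ?thesis by (simp add: abs_mult)
    qed simp
  qed (use ab c R u0 sg s in \<open>auto simp: \<tau>_def\<close>)
  have "1 / \<bar>u\<bar> \<le> s"
  proof -
    have "1 / \<bar>u\<bar> \<le> R" using u u0 R by (simp add: field_simps)
    then have "1 / \<bar>u\<bar> / \<bar>u\<bar> \<le> R / \<bar>u\<bar>" using u0 by (intro divide_right_mono) auto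
    then have "(1 / \<bar>u\<bar>)\<^sup>2 \<le> s\<^sup>2" unfolding s(2) by (simp add: power2_eq_square)
    then show ?thesis using s(1) by (metis less_imp_le power2_le_imp_le)
  qed
  then have "4 * (1 / \<bar>u\<bar>) \<le> 4 * s" by linarith
  moreover have "\<delta>\<^sup>2 / (\<bar>u\<bar> / 2)\<^sup>2 * (b - a) \<le> \<delta>\<^sup>2 / (\<bar>u\<bar> / 2)\<^sup>2 * R"
    by (intro mult_left_mono ab) auto
  moreover have "\<delta>\<^sup>2 / (\<bar>u\<bar> / 2)\<^sup>2 * R = 4 * (1 / \<bar>u\<bar>)"
    using R u0 by (simp add: \<delta>_def field_simps power2_eq_square)
  moreover have "pi * \<delta> / (c * \<bar>u\<bar> / (2 * R)) = 2 * pi / c * s"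
  proof -
    have "pi * \<delta> / (c * \<bar>u\<bar> / (2 * R)) = 2 * pi / c * ((R / \<bar>u\<bar>) * \<delta>)" using R c u0 by (simp add: field_simps)
    also have "(R / \<bar>u\<bar>) * \<delta> = s" unfolding s(2)[symmetric] using s(1,3) by (simp add: power2_eq_square)
    finally show ?thesis .
  qed
  moreover have "2 * pi / c * s \<le> 7 / c * s"
    using c s pi_less_4 pi_approx by (intro mult_right_mono divide_right_mono) auto
  moreover have "(1 + pi) / \<delta> \<le> 5 * s" using s pi_less_4 by (simp add: mult_right_mono)
  ultimately show ?thesis using B unfolding s_def[symmetric] by (simp add: algebra_simps)
qed

text \<open>
A smooth substitute, up to constants, for \<open>R min(R, 1/|z|)\<close>; its primitive is explicit.
\<close>

definition kernel_majorant :: "real \<Rightarrow> real \<Rightarrow> real" where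
  "kernel_majorant R z = R / sqrt (1 / R\<^sup>2 + z\<^sup>2)"

text \<open>
At distances below \<open>1/R\<close> the oscillation is not felt and the trivial bound by the length of the interval is
used, so a perturbation of \<open>z\<close> by \<open>2/R\<close> costs only a constant.
\<close>

lemma phase_kernel_bound:
  fixes \<Psi> \<Psi>' \<Psi>'' :: "real \<Rightarrow> real" and a b \<sigma> c R t u z :: real
  assumes ab: "a \<le> b" "b - a \<le> R" and R: "R > 0" and c: "c > 0"
    and d1: "\<And>\<xi>. \<xi> \<in> {a..b} \<Longrightarrow> (\<Psi> has_real_derivative \<Psi>' \<xi>) (at \<xi> within {a..b})"
    and d2: "\<And>\<xi>. \<xi> \<in> {a..b} \<Longrightarrow> (\<Psi>' has_real_derivative \<Psi>'' \<xi>) (at \<xi> within {a..b})"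
    and sg: "\<bar>\<sigma>\<bar> = 1" "\<And>\<xi>. \<xi> \<in> {a..b} \<Longrightarrow> 0 \<le> \<sigma> * \<Psi>'' \<xi>"
    and cv: "\<And>\<xi>. \<xi> \<in> {a..b} \<Longrightarrow> c * \<bar>\<Psi>' \<xi>\<bar> \<le> R * \<bar>\<Psi>'' \<xi>\<bar>"
    and u: "\<bar>u - z\<bar> \<le> 2 / R"
  shows "(norm (integral {a..b} (\<lambda>\<xi>. cis (u * \<xi> + t * \<Psi> \<xi>))))\<^sup>2 \<le> 4 * (9 + 7 / c)\<^sup>2 * kernel_majorant R z"
    (is "?n\<^sup>2 \<le> 4 * ?K\<^sup>2 * _")
proof -
  have K: "?K \<ge> 1" using c by (simp add: add_increasing2)
  then have K2: "?K\<^sup>2 \<ge> 1" by (rule one_le_power)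
  have q0: "sqrt (1 / R\<^sup>2 + z\<^sup>2) > 0" using R by (simp add: add_pos_nonneg)
  show ?thesis
  proof (cases "\<bar>z\<bar> \<le> 3 / R")
    case True
    have "?n \<le> integral {a..b} (\<lambda>_. 1)"
      by (intro integral_norm_bound_integral integrable_continuous_real continuous_on_cis continuous_intros
          DERIV_continuous_on[OF d1]) auto
    then have n: "?n \<le> R" using ab by simp
    have "z\<^sup>2 \<le> (3 / R)\<^sup>2" using True R abs_le_square_iff[of z "3 / R"] by simp
    then have "1 / R\<^sup>2 + z\<^sup>2 \<le> 1 / R\<^sup>2 + 9 / R\<^sup>2" by (simp add: power_divide)
    also have "\<dots> \<le> (4 / R)\<^sup>2" using R by (simp add: field_simps)
    finally have "1 / R\<^sup>2 + z\<^sup>2 \<le> (4 / R)\<^sup>2" .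
    then have "sqrt (1 / R\<^sup>2 + z\<^sup>2) \<le> 4 / R" using R by (intro real_le_lsqrt) auto
    then have "R / (4 / R) \<le> kernel_majorant R z" unfolding kernel_majorant_def using R q0
      by (intro divide_left_mono) auto
    then have "R\<^sup>2 \<le> 4 * kernel_majorant R z" using R by (simp add: power2_eq_square)
    also have "\<dots> \<le> 4 * ?K\<^sup>2 * kernel_majorant R z"
      using K2 R q0 unfolding kernel_majorant_def by (simp add: mult_le_cancel_right1 divide_right_mono)
    finally show ?thesis using n power_mono[of ?n R 2] by simp
  next
    case False
    then have z: "\<bar>z\<bar> > 3 / R" by simp
    have zp: "\<bar>z\<bar> > 0" using z R divide_pos_pos[of 3 R] by linarith
    have e: "2 / R = 2 / 3 * (3 / R)" "1 / R = 1 / 3 * (3 / R)" by auto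
    have uz: "\<bar>z\<bar> / 3 \<le> \<bar>u\<bar>" "1 / R \<le> \<bar>u\<bar>" using u z unfolding e by linarith+
    have "?n \<le> ?K * sqrt (R / \<bar>u\<bar>)"
      by (rule phase_integral_decay[OF ab R c d1 d2 sg cv uz(2)])
    then have "?n\<^sup>2 \<le> (?K * sqrt (R / \<bar>u\<bar>))\<^sup>2" by (intro power_mono) auto
    also have "\<dots> = ?K\<^sup>2 * (R / \<bar>u\<bar>)" using R by (simp add: power_mult_distrib)
    also have "\<dots> \<le> ?K\<^sup>2 * (R / (\<bar>z\<bar> / 3))"
      using R uz zp by (intro mult_left_mono divide_left_mono) auto
    also have "\<dots> \<le> ?K\<^sup>2 * (4 * kernel_majorant R z)"
    proof (intro mult_left_mono)
      have "(1 / R)\<^sup>2 \<le> (\<bar>z\<bar> / 3)\<^sup>2" using z R by (intro power_mono) (auto simp: field_simps)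
      then have "1 / R\<^sup>2 \<le> z\<^sup>2 / 9" by (simp add: power_divide)
      then have "1 / R\<^sup>2 + z\<^sup>2 \<le> z\<^sup>2 / 9 + z\<^sup>2" by (rule add_right_mono)
      also have "\<dots> \<le> (4 / 3 * \<bar>z\<bar>)\<^sup>2" by (simp add: power_mult_distrib power_divide)
      finally have "1 / R\<^sup>2 + z\<^sup>2 \<le> (4 / 3 * \<bar>z\<bar>)\<^sup>2" .
      then have "sqrt (1 / R\<^sup>2 + z\<^sup>2) \<le> 4 / 3 * \<bar>z\<bar>" by (intro real_le_lsqrt) auto
      then have le: "R / (4 / 3 * \<bar>z\<bar>) \<le> kernel_majorant R z" unfolding kernel_majorant_def using R q0 zp
        by (intro divide_left_mono) auto
      have eq: "R / (\<bar>z\<bar> / 3) = 4 * (R / (4 / 3 * \<bar>z\<bar>))" by simp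
      show "R / (\<bar>z\<bar> / 3) \<le> 4 * kernel_majorant R z"
        unfolding eq by (rule mult_left_mono[OF le]) simp
    qed auto
    finally show ?thesis by simp
  qed
qed

lemma kernel_majorant_integral:
  assumes R: "R > 0" and x: "x \<in> {-1..1}"
  shows "(\<integral>\<^sup>+y. ennreal (kernel_majorant R (x - y)) * indicator {-1..1} y \<partial>lborel) \<le> ennreal (2 * R * arsinh (2 * R))"
proof -
  have p: "1 / R\<^sup>2 + z\<^sup>2 > 0" for z using R by (simp add: add_pos_nonneg)
  have e: "sqrt ((R * z)\<^sup>2 + 1) = R * sqrt (1 / R\<^sup>2 + z\<^sup>2)" for z
  proof -
    have "(R * z)\<^sup>2 + 1 = R\<^sup>2 * (1 / R\<^sup>2 + z\<^sup>2)" using R by (simp add: field_simps power_mult_distrib)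
    then show ?thesis using R by (simp add: real_sqrt_mult)
  qed
  have "(\<integral>\<^sup>+y. ennreal (kernel_majorant R (x - y)) * indicator {-1..1} y \<partial>lborel)
      = ennreal (- (R * arsinh (R * (x - 1))) - - (R * arsinh (R * (x - (-1)))))"
  proof (rule nn_integral_FTC_Icc)
    show "kernel_majorant R (x - y) \<ge> 0" for y unfolding kernel_majorant_def using R by simp
    show "((\<lambda>y. - (R * arsinh (R * (x - y)))) has_real_derivative kernel_majorant R (x - y)) (at y)" for y
      unfolding kernel_majorant_def
      using p[of "x - y"] R
      by (auto intro!: derivative_eq_intros DERIV_chain2[OF arsinh_real_has_field_derivative] simp: e)
  qed (auto simp: kernel_majorant_def)
  also have "\<dots> \<le> ennreal (2 * R * arsinh (2 * R))"
  proof (rule ennreal_leI)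
    have m: "arsinh (R * (x + 1)) \<le> arsinh (2 * R)" "arsinh (R * (1 - x)) \<le> arsinh (2 * R)"
      using R x unfolding not_less[symmetric] arsinh_less_iff_real
      by (simp_all add: not_less mult.commute[of 2] mult_left_mono)
    have "arsinh (R * (x - 1)) = - arsinh (R * (1 - x))"
      by (metis arsinh_minus_real minus_diff_eq mult_minus_right)
    then have "- (R * arsinh (R * (x - 1))) - - (R * arsinh (R * (x - (-1)))) = R * (arsinh (R * (1 - x)) + arsinh (R * (x + 1)))"
      by (simp add: algebra_simps)
    also have "\<dots> \<le> R * (arsinh (2 * R) + arsinh (2 * R))" using m R by (intro mult_left_mono) auto
    finally show "- (R * arsinh (R * (x - 1))) - - (R * arsinh (R * (x - (-1)))) \<le> 2 * R * arsinh (2 * R)" by simp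
  qed
  finally show ?thesis .
qed

section \<open>Duality and the fourth-power estimate\<close>

text \<open>
Every integrand to which Fubini's theorem is applied in the sequel is dominated by such a product.
\<close>

lemma Fubini_dominated:
  fixes F :: "real \<Rightarrow> real \<Rightarrow> complex"
  assumes [measurable]: "(\<lambda>(x, y). F x y) \<in> borel_measurable (lborel \<Otimes>\<^sub>M lborel)"
    and a: "integrable lborel \<alpha>" and b: "integrable lborel \<beta>"
    and bd: "\<And>x y. norm (F x y) \<le> \<alpha> x * \<beta> y"
  shows "(LINT x|lborel. LINT y|lborel. F x y) = (LINT y|lborel. LINT x|lborel. F x y)"
proof -
  have "integrable (lborel \<Otimes>\<^sub>M lborel) (\<lambda>(x, y). \<alpha> x * \<beta> y)"
    by (rule lborel_pair.integrable_product_swap_iff[THEN iffD1])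
       (use lborel_pair.Fubini_integrable[of "\<lambda>(x, y). \<alpha> y * \<beta> x"] a b in
         \<open>auto simp: abs_mult integrable_abs\<close>)
  then have I: "integrable (lborel \<Otimes>\<^sub>M lborel) (\<lambda>(x, y). F x y)"
    by (rule Bochner_Integration.integrable_bound)
       (auto intro!: AE_I2 order_trans[OF bd] split: prod.split)
  show "(LINT x|lborel. LINT y|lborel. F x y) = (LINT y|lborel. LINT x|lborel. F x y)"
    using lborel_pair.Fubini_integral[OF I] by simp
qed

lemma borel_measurable_cis [measurable]: "cis \<in> borel_measurable borel"
  by (intro borel_measurable_continuous_onI continuous_on_cis continuous_intros)

lemma borel_measurable_cnj [measurable]: "cnj \<in> borel_measurable borel"
  by (intro borel_measurable_continuous_onI continuous_intros)

text \<open>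
The \<open>T T\<^sup>*\<close> identity: a weighted \<open>L\<^sup>2\<close> norm of \<open>W(\<xi>) = \<integral> w(x) e(x,\<xi>) dx\<close> is a quadratic form in \<open>w\<close> whose kernel
is the weighted correlation of \<open>e(x, \<cdot>)\<close> and \<open>e(y, \<cdot>)\<close>.  It is used twice: with the indicator of a frequency
band as weight for the maximal estimate, and with a Gaussian weight for Plancherel's theorem.
\<close>

lemma
  fixes w :: "real \<Rightarrow> complex" and e :: "real \<Rightarrow> real \<Rightarrow> complex" and \<rho> :: "real \<Rightarrow> real"
  assumes em[measurable]: "(\<lambda>(x, \<xi>). e x \<xi>) \<in> borel_measurable (lborel \<Otimes>\<^sub>M lborel)"
    and ne: "\<And>x \<xi>. norm (e x \<xi>) = 1"
    and iw: "integrable lborel w" and ir: "integrable lborel \<rho>"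
  shows weighted_energy_integrable: "integrable lborel (\<lambda>\<xi>. \<rho> \<xi> * (norm (LINT x|lborel. w x * e x \<xi>))\<^sup>2)"
    and weighted_energy_identity: "complex_of_real (LINT \<xi>|lborel. \<rho> \<xi> * (norm (LINT x|lborel. w x * e x \<xi>))\<^sup>2)
      = (LINT x|lborel. w x * (LINT y|lborel. cnj (w y) * (LINT \<xi>|lborel. \<rho> \<xi> *\<^sub>R (e x \<xi> * cnj (e y \<xi>)))))"
proof -
  have [measurable]: "w \<in> borel_measurable borel" "\<rho> \<in> borel_measurable borel" using iw ir by auto
  define W where "W \<xi> = (LINT x|lborel. w x * e x \<xi>)" for \<xi>
  define MW where "MW = (LINT x|lborel. norm (w x))"
  have [measurable]: "W \<in> borel_measurable borel" unfolding W_def by simp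
  have WM: "norm (W \<xi>) \<le> MW" for \<xi>
    unfolding W_def MW_def
    by (rule integral_norm_bound[THEN order_trans]) (simp add: norm_mult ne)
  define k where "k x y = (LINT \<xi>|lborel. \<rho> \<xi> *\<^sub>R (e x \<xi> * cnj (e y \<xi>)))" for x y
  have "integrable lborel (\<lambda>\<xi>. \<rho> \<xi> * (norm (W \<xi>))\<^sup>2)"
  proof (rule Bochner_Integration.integrable_bound[OF integrable_mult_left[OF integrable_norm[OF ir], of "MW\<^sup>2"]])
    show "AE \<xi> in lborel. norm (\<rho> \<xi> * (norm (W \<xi>))\<^sup>2) \<le> norm (norm (\<rho> \<xi>) * MW\<^sup>2)"
      by (intro AE_I2) (auto simp: abs_mult intro!: mult_left_mono power_mono WM)
  qed simp
  then show "integrable lborel (\<lambda>\<xi>. \<rho> \<xi> * (norm (LINT x|lborel. w x * e x \<xi>))\<^sup>2)"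
    unfolding W_def .
  have inner: "(LINT \<xi>|lborel. \<rho> \<xi> * e x \<xi> * cnj (W \<xi>)) = (LINT y|lborel. cnj (w y) * k x y)" for x
  proof -
    have "(LINT \<xi>|lborel. \<rho> \<xi> * e x \<xi> * cnj (W \<xi>))
      = (LINT \<xi>|lborel. LINT y|lborel. cnj (w y) * (\<rho> \<xi> *\<^sub>R (e x \<xi> * cnj (e y \<xi>))))"
    proof (rule Bochner_Integration.integral_cong[OF refl])
      fix \<xi>
      have "(LINT y|lborel. cnj (w y) * (\<rho> \<xi> *\<^sub>R (e x \<xi> * cnj (e y \<xi>))))
        = (LINT y|lborel. (\<rho> \<xi> * e x \<xi>) * cnj (w y * e y \<xi>))"
        by (intro Bochner_Integration.integral_cong refl) (simp add: scaleR_conv_of_real)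
      also have "\<dots> = \<rho> \<xi> * e x \<xi> * cnj (W \<xi>)"
        unfolding W_def by (simp only: integral_mult_right_zero Bochner_Integration.integral_cnj)
      finally show "\<rho> \<xi> * e x \<xi> * cnj (W \<xi>)
        = (LINT y|lborel. cnj (w y) * (\<rho> \<xi> *\<^sub>R (e x \<xi> * cnj (e y \<xi>))))" by simp
    qed
    also have "\<dots> = (LINT y|lborel. LINT \<xi>|lborel. cnj (w y) * (\<rho> \<xi> *\<^sub>R (e x \<xi> * cnj (e y \<xi>))))"
      by (rule Fubini_dominated[OF _ integrable_norm[OF iw] integrable_norm[OF ir], symmetric])
         (auto simp: norm_mult ne)
    also have "\<dots> = (LINT y|lborel. cnj (w y) * k x y)"
      by (simp only: k_def integral_mult_right_zero)
    finally show ?thesis .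
  qed
  have "complex_of_real (LINT \<xi>|lborel. \<rho> \<xi> * (norm (W \<xi>))\<^sup>2)
      = (LINT \<xi>|lborel. LINT x|lborel. w x * (\<rho> \<xi> * e x \<xi> * cnj (W \<xi>)))"
    unfolding integral_complex_of_real[symmetric]
  proof (rule Bochner_Integration.integral_cong[OF refl])
    fix \<xi>
    have "(LINT x|lborel. w x * (\<rho> \<xi> * e x \<xi> * cnj (W \<xi>)))
        = (LINT x|lborel. (w x * e x \<xi>) * (\<rho> \<xi> * cnj (W \<xi>)))"
      by (simp add: mult_ac)
    also have "\<dots> = W \<xi> * (\<rho> \<xi> * cnj (W \<xi>))"
      unfolding W_def by (rule integral_mult_left_zero)
    also have "\<dots> = complex_of_real (\<rho> \<xi> * (norm (W \<xi>))\<^sup>2)"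
      using complex_norm_square[of "W \<xi>"] by simp
    finally show "complex_of_real (\<rho> \<xi> * (norm (W \<xi>))\<^sup>2)
       = (LINT x|lborel. w x * (\<rho> \<xi> * e x \<xi> * cnj (W \<xi>)))" by simp
  qed
  also have "\<dots> = (LINT x|lborel. LINT \<xi>|lborel. w x * (\<rho> \<xi> * e x \<xi> * cnj (W \<xi>)))"
  proof (rule Fubini_dominated[OF _ integrable_norm[OF iw] integrable_mult_left[OF integrable_norm[OF ir], of MW], symmetric])
    fix x \<xi>
    have "norm (w x) * (norm (\<rho> \<xi>) * norm (W \<xi>)) \<le> norm (w x) * (norm (\<rho> \<xi>) * MW)"
      by (intro mult_left_mono WM) auto
    then show "norm (w x * (\<rho> \<xi> * e x \<xi> * cnj (W \<xi>))) \<le> norm (w x) * (norm (\<rho> \<xi>) * MW)"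
      by (simp add: norm_mult ne)
  qed measurable
  also have "\<dots> = (LINT x|lborel. w x * (LINT y|lborel. cnj (w y) * k x y))"
    by (simp only: integral_mult_right_zero inner)
  finally show "complex_of_real (LINT \<xi>|lborel. \<rho> \<xi> * (norm (LINT x|lborel. w x * e x \<xi>))\<^sup>2)
      = (LINT x|lborel. w x * (LINT y|lborel. cnj (w y) * (LINT \<xi>|lborel. \<rho> \<xi> *\<^sub>R (e x \<xi> * cnj (e y \<xi>)))))"
    unfolding W_def k_def .
qed

lemma norm_integral_le_nn_integral:
  fixes f :: "'a \<Rightarrow> 'b::{banach, second_countable_topology}"
  shows "ennreal (norm (integral\<^sup>L M f)) \<le> (\<integral>\<^sup>+x. ennreal (norm (f x)) \<partial>M)"
  by (cases "integrable M f") (simp_all add: integral_norm_bound_ennreal not_integrable_integral_eq)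

text \<open>
A substitute for Young's convolution inequality.  Writing the integrand as \<open>(g(x) g(y))\<^sup>2\<close> times
\<open>g(x) g(y) \<kappa>\<^bsup>1/2\<^esup>\<close> and applying the Cauchy-Schwarz inequality leaves \<open>\<integral>\<integral> g(x)\<^sup>2 g(y)\<^sup>2 \<kappa>(x - y)\<close>, where
\<open>2 g(x)\<^sup>2 g(y)\<^sup>2 \<le> g(x)\<^sup>4 + g(y)\<^sup>4\<close> separates the variables.
\<close>

lemma bilinear_L4_bound:
  fixes g \<kappa> :: "real \<Rightarrow> real"
  assumes [measurable]: "g \<in> borel_measurable borel" "\<kappa> \<in> borel_measurable borel"
    and g: "\<And>x. 0 \<le> g x" "\<And>x. x \<notin> I \<Longrightarrow> g x = 0" and I[measurable]: "I \<in> sets borel"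
    and k: "\<And>z. 0 \<le> \<kappa> z" "\<And>z. \<kappa> (- z) = \<kappa> z"
    and L: "\<And>x. x \<in> I \<Longrightarrow> (\<integral>\<^sup>+y. ennreal (\<kappa> (x - y)) * indicator I y \<partial>lborel) \<le> ennreal L"
  shows "(\<integral>\<^sup>+x. \<integral>\<^sup>+y. ennreal (g x ^ 3 * g y ^ 3 * sqrt (\<kappa> (x - y))) \<partial>lborel \<partial>lborel)\<^sup>2
    \<le> ennreal L * (\<integral>\<^sup>+x. ennreal (g x ^ 4) \<partial>lborel) ^ 3"
proof -
  define Q where "Q = (\<integral>\<^sup>+x. ennreal (g x ^ 4) \<partial>lborel)"
  let ?P = "lborel \<Otimes>\<^sub>M lborel :: (real \<times> real) measure"
  have half: "(\<integral>\<^sup>+x. \<integral>\<^sup>+y. ennreal (g x ^ 4 * \<kappa> (x - y)) * indicator I y \<partial>lborel \<partial>lborel) \<le> ennreal L * Q"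
  proof -
    have "(\<integral>\<^sup>+y. ennreal (g x ^ 4 * \<kappa> (x - y)) * indicator I y \<partial>lborel) \<le> ennreal L * ennreal (g x ^ 4)" for x
    proof (cases "x \<in> I")
      case True
      have "(\<integral>\<^sup>+y. ennreal (g x ^ 4 * \<kappa> (x - y)) * indicator I y \<partial>lborel)
          = ennreal (g x ^ 4) * (\<integral>\<^sup>+y. ennreal (\<kappa> (x - y)) * indicator I y \<partial>lborel)"
        by (subst nn_integral_cmult[symmetric]) (auto simp: ennreal_mult' g k mult.assoc)
      then show ?thesis using mult_left_mono[OF L[OF True], of "ennreal (g x ^ 4)"] by (simp add: mult.commute)
    qed (simp add: g)
    then have "(\<integral>\<^sup>+x. \<integral>\<^sup>+y. ennreal (g x ^ 4 * \<kappa> (x - y)) * indicator I y \<partial>lborel \<partial>lborel)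
        \<le> (\<integral>\<^sup>+x. ennreal L * ennreal (g x ^ 4) \<partial>lborel)"
      by (intro nn_integral_mono)
    then show ?thesis unfolding Q_def by (simp add: nn_integral_cmult)
  qed
  have swap: "(\<integral>\<^sup>+x. \<integral>\<^sup>+y. ennreal (g y ^ 4 * \<kappa> (x - y)) * indicator I x \<partial>lborel \<partial>lborel)
      = (\<integral>\<^sup>+x. \<integral>\<^sup>+y. ennreal (g x ^ 4 * \<kappa> (x - y)) * indicator I y \<partial>lborel \<partial>lborel)"
    by (subst lborel_pair.Fubini') (auto simp: k(2)[of "_ - _", simplified])
  have 2: "(\<integral>\<^sup>+p. (ennreal (g (fst p) * g (snd p) * sqrt (\<kappa> (fst p - snd p))))\<^sup>2 \<partial>?P) \<le> ennreal L * Q"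
  proof -
    have "(\<integral>\<^sup>+p. (ennreal (g (fst p) * g (snd p) * sqrt (\<kappa> (fst p - snd p))))\<^sup>2 \<partial>?P)
        \<le> (\<integral>\<^sup>+p. ennreal (1/2) * (ennreal (g (fst p) ^ 4 * \<kappa> (fst p - snd p)) * indicator I (snd p))
          + ennreal (1/2) * (ennreal (g (snd p) ^ 4 * \<kappa> (fst p - snd p)) * indicator I (fst p)) \<partial>?P)"
    proof (rule nn_integral_mono)
      fix p :: "real \<times> real"
      obtain x y where p: "p = (x, y)" by force
      show "(ennreal (g (fst p) * g (snd p) * sqrt (\<kappa> (fst p - snd p))))\<^sup>2
        \<le> ennreal (1/2) * (ennreal (g (fst p) ^ 4 * \<kappa> (fst p - snd p)) * indicator I (snd p))
          + ennreal (1/2) * (ennreal (g (snd p) ^ 4 * \<kappa> (fst p - snd p)) * indicator I (fst p))"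
      proof (cases "x \<in> I \<and> y \<in> I")
        case True
        have "2 * (g x)\<^sup>2 * (g y)\<^sup>2 \<le> g x ^ 4 + g y ^ 4"
          using sum_squares_bound[of "(g x)\<^sup>2" "(g y)\<^sup>2"] by simp
        then have "(g x)\<^sup>2 * (g y)\<^sup>2 * \<kappa> (x - y) \<le> (1/2 * g x ^ 4 + 1/2 * g y ^ 4) * \<kappa> (x - y)"
          by (intro mult_right_mono) (auto simp: k)
        then have "ennreal ((g x)\<^sup>2 * (g y)\<^sup>2 * \<kappa> (x - y))
            \<le> ennreal (1/2 * (g x ^ 4 * \<kappa> (x - y)) + 1/2 * (g y ^ 4 * \<kappa> (x - y)))"
          by (intro ennreal_leI) (simp add: algebra_simps)
        also have "\<dots> = ennreal (1/2) * ennreal (g x ^ 4 * \<kappa> (x - y)) + ennreal (1/2) * ennreal (g y ^ 4 * \<kappa> (x - y))"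
        proof -
          have "ennreal (1/2 * p + 1/2 * q) = ennreal (1/2) * ennreal p + ennreal (1/2) * ennreal q"
            if "p \<ge> 0" "q \<ge> 0" for p q :: real
            unfolding ennreal_mult''[OF that(1), symmetric] ennreal_mult''[OF that(2), symmetric]
            by (rule ennreal_plus) (use that in auto)
          then show ?thesis by (auto simp: k)
        qed
        finally show ?thesis using True
          by (simp add: p g k ennreal_power power_mult_distrib)
      qed (auto simp: p g)
    qed
    also have "\<dots> = ennreal (1/2) * (\<integral>\<^sup>+x. \<integral>\<^sup>+y. ennreal (g x ^ 4 * \<kappa> (x - y)) * indicator I y \<partial>lborel \<partial>lborel)
       + ennreal (1/2) * (\<integral>\<^sup>+x. \<integral>\<^sup>+y. ennreal (g y ^ 4 * \<kappa> (x - y)) * indicator I x \<partial>lborel \<partial>lborel)"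
      by (simp add: nn_integral_add nn_integral_cmult flip: lborel.nn_integral_fst)
    also have "\<dots> \<le> ennreal (1/2) * (ennreal L * Q) + ennreal (1/2) * (ennreal L * Q)"
      unfolding swap by (intro add_mono mult_left_mono half) auto
    also have "\<dots> = (ennreal (1/2) + ennreal (1/2)) * (ennreal L * Q)" by (rule distrib_right[symmetric])
    also have "ennreal (1/2) + ennreal (1/2) = 1" by (subst ennreal_plus[symmetric]) auto
    finally show ?thesis by simp
  qed
  have 1: "(\<integral>\<^sup>+p. (ennreal ((g (fst p))\<^sup>2 * (g (snd p))\<^sup>2))\<^sup>2 \<partial>?P) = Q * Q"
  proof -
    have "(\<integral>\<^sup>+p. (ennreal ((g (fst p))\<^sup>2 * (g (snd p))\<^sup>2))\<^sup>2 \<partial>?P)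
        = (\<integral>\<^sup>+x. \<integral>\<^sup>+y. ennreal (g x ^ 4) * ennreal (g y ^ 4) \<partial>lborel \<partial>lborel)"
      by (simp add: ennreal_power power_mult_distrib ennreal_mult' flip: lborel.nn_integral_fst)
    then show ?thesis unfolding Q_def by (simp add: nn_integral_cmult nn_integral_multc)
  qed
  have "(\<integral>\<^sup>+x. \<integral>\<^sup>+y. ennreal (g x ^ 3 * g y ^ 3 * sqrt (\<kappa> (x - y))) \<partial>lborel \<partial>lborel)
     = (\<integral>\<^sup>+p. ennreal ((g (fst p))\<^sup>2 * (g (snd p))\<^sup>2) * ennreal (g (fst p) * g (snd p) * sqrt (\<kappa> (fst p - snd p))) \<partial>?P)"
    by (subst lborel.nn_integral_fst[symmetric])
       (auto simp: g k eval_nat_numeral mult_ac simp flip: ennreal_mult' intro!: nn_integral_cong)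
  then have "(\<integral>\<^sup>+x. \<integral>\<^sup>+y. ennreal (g x ^ 3 * g y ^ 3 * sqrt (\<kappa> (x - y))) \<partial>lborel \<partial>lborel)\<^sup>2
     \<le> (Q * Q) * (\<integral>\<^sup>+p. (ennreal (g (fst p) * g (snd p) * sqrt (\<kappa> (fst p - snd p))))\<^sup>2 \<partial>?P)"
    unfolding 1[symmetric] by (simp only:) (rule Cauchy_Schwarz_nn_integral; measurable)
  also have "\<dots> \<le> (Q * Q) * (ennreal L * Q)" by (intro mult_left_mono 2) auto
  finally show ?thesis unfolding Q_def[symmetric] by (simp add: eval_nat_numeral mult_ac)
qed

text \<open>
With \<open>G = T h\<close>, the fourth power of the norm is \<open>Q = \<integral> w G\<close> for \<open>w = |G|\<^sup>2 cnj G\<close>, that is, \<open>h\<close> paired with the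
adjoint \<open>W = T\<^sup>* w\<close>.  Hence \<open>Q\<^sup>2 \<le> \<parallel>h\<parallel>\<^sup>2 \<parallel>W\<parallel>\<^sup>2\<close>, while the kernel bound and the preceding lemma give
\<open>\<parallel>W\<parallel>\<^sup>4 \<le> L Q\<^sup>3\<close>; since \<open>Q\<close> is finite, it can be cancelled.
\<close>

lemma TT_star_L4:
  fixes h :: "real \<Rightarrow> complex" and \<Phi> X T \<kappa> :: "real \<Rightarrow> real"
  assumes [measurable]: "h \<in> borel_measurable borel" "\<Phi> \<in> borel_measurable borel"
      "X \<in> borel_measurable borel" "T \<in> borel_measurable borel" "\<kappa> \<in> borel_measurable borel"
    and h: "integrable lborel h" "integrable lborel (\<lambda>\<xi>. (norm (h \<xi>))\<^sup>2)" "\<And>\<xi>. \<xi> \<notin> J \<Longrightarrow> h \<xi> = 0"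
    and J[measurable]: "J \<in> sets borel" and J': "emeasure lborel J < top"
    and I[measurable]: "I \<in> sets borel" and I': "emeasure lborel I < top"
    and k: "\<And>z. 0 \<le> \<kappa> z" "\<And>z. \<kappa> (- z) = \<kappa> z"
    and K: "\<And>x y. x \<in> I \<Longrightarrow> y \<in> I \<Longrightarrow>
        (norm (LINT \<xi>|lborel. indicator J \<xi> *\<^sub>R cis ((X x - X y) * \<xi> + (T x - T y) * \<Phi> \<xi>)))\<^sup>2 \<le> \<kappa> (x - y)"
    and L: "L \<ge> 0" "\<And>x. x \<in> I \<Longrightarrow> (\<integral>\<^sup>+y. ennreal (\<kappa> (x - y)) * indicator I y \<partial>lborel) \<le> ennreal L"
  shows "(\<integral>\<^sup>+x. ennreal (norm (LINT \<xi>|lborel. cis (X x * \<xi> + T x * \<Phi> \<xi>) * h \<xi>) ^ 4) * indicator I x \<partial>lborel)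
     \<le> ennreal (L * (LINT \<xi>|lborel. (norm (h \<xi>))\<^sup>2)\<^sup>2)"
proof -
  define e where "e x \<xi> = cis (X x * \<xi> + T x * \<Phi> \<xi>)" for x \<xi>
  have em[measurable]: "(\<lambda>(x, \<xi>). e x \<xi>) \<in> borel_measurable (lborel \<Otimes>\<^sub>M lborel)"
    unfolding e_def by measurable
  have ne: "norm (e x \<xi>) = 1" for x \<xi> by (simp add: e_def)
  define G where "G x = (LINT \<xi>|lborel. e x \<xi> * h \<xi>)" for x
  define g where "g x = indicator I x * norm (G x)" for x
  have Gm[measurable]: "G \<in> borel_measurable borel"
    unfolding G_def by simp
  then have gm[measurable]: "g \<in> borel_measurable borel" unfolding g_def by simp
  define M where "M = (LINT \<xi>|lborel. norm (h \<xi>))"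
  have GM: "norm (G x) \<le> M" for x
    unfolding G_def M_def
    by (rule integral_norm_bound[THEN order_trans]) (simp add: norm_mult ne)
  have M0: "M \<ge> 0" unfolding M_def by simp
  have g0: "g x \<ge> 0" "g x \<le> M" for x unfolding g_def using GM M0 by (auto simp: indicator_def)
  define w where "w x = indicator I x * of_real ((norm (G x))\<^sup>2) * cnj (G x)" for x
  have wm[measurable]: "w \<in> borel_measurable borel" unfolding w_def by measurable
  have nw: "norm (w x) = g x ^ 3" for x
    by (auto simp: w_def g_def indicator_def norm_mult norm_power power2_eq_square power3_eq_cube)
  have wM: "norm (w x) \<le> M ^ 3 * indicator I x" for x
    unfolding nw using power_mono[OF g0(2)[of x] g0(1), of 3] by (cases "x \<in> I") (auto simp: g_def)
  have iI: "integrable lborel (\<lambda>x. c * indicator I x :: real)"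
    and iJ: "integrable lborel (\<lambda>x. c * indicator J x :: real)" for c
    using I' J' by auto
  have ig: "integrable lborel (\<lambda>x. g x ^ 4)"
  proof (rule Bochner_Integration.integrable_bound[OF iI[of "M ^ 4"]])
    show "AE x in lborel. norm (g x ^ 4) \<le> norm (M ^ 4 * indicator I x)"
      using GM M0 by (intro AE_I2) (auto simp: g_def indicator_def intro!: power_mono)
  qed simp
  define Q where "Q = (LINT x|lborel. g x ^ 4)"
  define W where "W \<xi> = (LINT x|lborel. w x * e x \<xi>)" for \<xi>
  have Wm[measurable]: "W \<in> borel_measurable borel" unfolding W_def by simp
  define N where "N = (LINT \<xi>|lborel. indicator J \<xi> * (norm (W \<xi>))\<^sup>2)"
  have iw: "integrable lborel w"
    by (rule Bochner_Integration.integrable_bound[OF iI[of "M ^ 3"]])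
       (use wM in \<open>auto intro!: AE_I2 intro: order_trans[OF _ abs_ge_self]\<close>)
  have iJ1: "integrable lborel (indicator J :: real \<Rightarrow> real)" using iJ[of 1] by simp
  have iN: "integrable lborel (\<lambda>\<xi>. indicator J \<xi> * (norm (W \<xi>))\<^sup>2)"
    unfolding W_def by (rule weighted_energy_integrable[OF em ne iw iJ1])
  have step1: "complex_of_real Q = (LINT \<xi>|lborel. h \<xi> * W \<xi>)"
  proof -
    have "complex_of_real Q = (LINT x|lborel. w x * G x)"
      unfolding Q_def integral_complex_of_real[symmetric]
    proof (rule Bochner_Integration.integral_cong[OF refl])
      fix x show "complex_of_real (g x ^ 4) = w x * G x"
        using complex_norm_square[of "G x"]
        by (auto simp: w_def g_def indicator_def power4_eq_xxxx power2_eq_square mult_ac)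
    qed
    also have "\<dots> = (LINT x|lborel. LINT \<xi>|lborel. w x * e x \<xi> * h \<xi>)"
      unfolding G_def by (simp add: mult.assoc flip: integral_mult_right_zero)
    also have "\<dots> = (LINT \<xi>|lborel. LINT x|lborel. w x * e x \<xi> * h \<xi>)"
      by (rule Fubini_dominated[OF _ iI[of "M^3"] integrable_norm[OF h(1)]])
         (auto simp: norm_mult ne intro!: mult_right_mono wM)
    also have "\<dots> = (LINT \<xi>|lborel. h \<xi> * W \<xi>)"
      unfolding W_def by (simp add: mult.commute[of "h _"])
    finally show ?thesis .
  qed
  define H where "H = (LINT \<xi>|lborel. (norm (h \<xi>))\<^sup>2)"
  have Q0: "Q \<ge> 0" "N \<ge> 0" "H \<ge> 0" unfolding Q_def N_def H_def using g0 by auto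
  have step2: "Q\<^sup>2 \<le> H * N"
  proof -
    have "ennreal Q = ennreal (norm (complex_of_real Q))" using Q0 by simp
    also have "\<dots> \<le> (\<integral>\<^sup>+\<xi>. ennreal (norm (h \<xi> * W \<xi>)) \<partial>lborel)"
      unfolding step1 by (rule norm_integral_le_nn_integral)
    also have "\<dots> = (\<integral>\<^sup>+\<xi>. ennreal (norm (h \<xi>)) * ennreal (indicator J \<xi> * norm (W \<xi>)) \<partial>lborel)"
      by (intro nn_integral_cong) (auto simp: norm_mult ennreal_mult' indicator_def h(3))
    finally have "(ennreal Q)\<^sup>2 \<le> (\<dots>)\<^sup>2" by (rule power_mono) simp
    also have "\<dots> \<le> (\<integral>\<^sup>+\<xi>. (ennreal (norm (h \<xi>)))\<^sup>2 \<partial>lborel) * (\<integral>\<^sup>+\<xi>. (ennreal (indicator J \<xi> * norm (W \<xi>)))\<^sup>2 \<partial>lborel)"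
      by (rule Cauchy_Schwarz_nn_integral) auto
    also have "(\<integral>\<^sup>+\<xi>. (ennreal (norm (h \<xi>)))\<^sup>2 \<partial>lborel) = ennreal H"
      unfolding H_def using h(2) by (simp add: ennreal_power nn_integral_eq_integral)
    also have "(\<integral>\<^sup>+\<xi>. (ennreal (indicator J \<xi> * norm (W \<xi>)))\<^sup>2 \<partial>lborel) = ennreal N"
    proof -
      have "(ennreal (indicator J \<xi> * norm (W \<xi>)))\<^sup>2 = ennreal (indicator J \<xi> * (norm (W \<xi>))\<^sup>2)" for \<xi>
        by (auto simp: ennreal_power indicator_def)
      then show ?thesis unfolding N_def using iN by (simp add: nn_integral_eq_integral)
    qed
    finally show ?thesis using Q0 by (simp add: ennreal_power flip: ennreal_mult')
  qed
  define k2 where "k2 x y = (LINT \<xi>|lborel. indicator J \<xi> *\<^sub>R (e x \<xi> * cnj (e y \<xi>)))" for x y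
  have step3: "complex_of_real N = (LINT x|lborel. w x * (LINT y|lborel. cnj (w y) * k2 x y))"
    unfolding N_def W_def k2_def by (rule weighted_energy_identity[OF em ne iw iJ1])
  have k2: "norm (k2 x y) \<le> sqrt (\<kappa> (x - y))" if "x \<in> I" "y \<in> I" for x y
  proof -
    have "e x \<xi> * cnj (e y \<xi>) = cis ((X x - X y) * \<xi> + (T x - T y) * \<Phi> \<xi>)" for \<xi>
      unfolding e_def by (simp add: cis_cnj cis_mult algebra_simps)
    then show ?thesis unfolding k2_def using K[OF that] by (simp add: real_le_rsqrt)
  qed
  have pt: "ennreal (norm (w x * (LINT y|lborel. cnj (w y) * k2 x y)))
      \<le> (\<integral>\<^sup>+y. ennreal (norm (w x)) * ennreal (norm (cnj (w y) * k2 x y)) \<partial>lborel)" for x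
  proof -
    have "ennreal (norm (w x * (LINT y|lborel. cnj (w y) * k2 x y)))
        \<le> ennreal (norm (w x)) * (\<integral>\<^sup>+y. ennreal (norm (cnj (w y) * k2 x y)) \<partial>lborel)"
      unfolding norm_mult ennreal_mult'[OF norm_ge_zero]
      using norm_integral_le_nn_integral[of lborel "\<lambda>y. cnj (w y) * k2 x y"]
      by (intro mult_left_mono) (simp_all only: norm_mult ennreal_mult'[OF norm_ge_zero] zero_le)
    also have "\<dots> = (\<integral>\<^sup>+y. ennreal (norm (w x)) * ennreal (norm (cnj (w y) * k2 x y)) \<partial>lborel)"
      unfolding k2_def by (rule nn_integral_cmult[symmetric]) measurable
    finally show ?thesis .
  qed
  have "ennreal N = ennreal (norm (complex_of_real N))" using Q0 by simp
  also have "\<dots> \<le> (\<integral>\<^sup>+x. ennreal (norm (w x * (LINT y|lborel. cnj (w y) * k2 x y))) \<partial>lborel)"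
    unfolding step3 by (rule norm_integral_le_nn_integral)
  also have "\<dots> \<le> (\<integral>\<^sup>+x. \<integral>\<^sup>+y. ennreal (norm (w x)) * ennreal (norm (cnj (w y) * k2 x y)) \<partial>lborel \<partial>lborel)"
    by (intro nn_integral_mono pt)
  also have "\<dots> \<le> (\<integral>\<^sup>+x. \<integral>\<^sup>+y. ennreal (g x ^ 3 * g y ^ 3 * sqrt (\<kappa> (x - y))) \<partial>lborel \<partial>lborel)"
  proof (intro nn_integral_mono)
    fix x y
    have "norm (w x) * norm (cnj (w y) * k2 x y) \<le> g x ^ 3 * g y ^ 3 * sqrt (\<kappa> (x - y))"
    proof (cases "x \<in> I \<and> y \<in> I")
      case True
      then show ?thesis using k2[of x y] by (simp add: norm_mult nw mult_left_mono g0 mult.assoc)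
    qed (auto simp: norm_mult nw g_def)
    then show "ennreal (norm (w x)) * ennreal (norm (cnj (w y) * k2 x y)) \<le> ennreal (g x ^ 3 * g y ^ 3 * sqrt (\<kappa> (x - y)))"
      by (simp add: ennreal_leI flip: ennreal_mult')
  qed
  finally have "(ennreal N)\<^sup>2 \<le> (\<dots>)\<^sup>2" by (rule power_mono) simp
  also have "\<dots> \<le> ennreal L * (\<integral>\<^sup>+x. ennreal (g x ^ 4) \<partial>lborel) ^ 3"
    by (rule bilinear_L4_bound[OF _ _ _ _ I]) (use k L in \<open>auto simp: g_def\<close>)
  also have "(\<integral>\<^sup>+x. ennreal (g x ^ 4) \<partial>lborel) = ennreal Q"
    unfolding Q_def using ig by (simp add: nn_integral_eq_integral)
  finally have step4: "N\<^sup>2 \<le> L * Q ^ 3" using Q0 L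
    by (simp add: ennreal_power flip: ennreal_mult')
  have "Q \<le> L * H\<^sup>2"
  proof (cases "Q = 0")
    case False
    have "Q ^ 3 * Q = (Q\<^sup>2)\<^sup>2" by (simp add: eval_nat_numeral)
    also have "\<dots> \<le> (H * N)\<^sup>2" using step2 by (intro power_mono) auto
    also have "\<dots> = H\<^sup>2 * N\<^sup>2" by (rule power_mult_distrib)
    also have "\<dots> \<le> H\<^sup>2 * (L * Q ^ 3)" by (intro mult_left_mono step4) auto
    finally have "Q ^ 3 * Q \<le> Q ^ 3 * (L * H\<^sup>2)" by (simp add: mult_ac)
    then show ?thesis using False Q0 by (simp add: mult_le_cancel_left)
  qed (use L in simp)
  moreover have "(\<integral>\<^sup>+x. ennreal (norm (LINT \<xi>|lborel. cis (X x * \<xi> + T x * \<Phi> \<xi>) * h \<xi>) ^ 4) * indicator I x \<partial>lborel) = ennreal Q"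
  proof -
    have "ennreal (norm (LINT \<xi>|lborel. cis (X x * \<xi> + T x * \<Phi> \<xi>) * h \<xi>) ^ 4) * indicator I x = ennreal (g x ^ 4)" for x
      by (auto simp: g_def G_def e_def indicator_def)
    then show ?thesis unfolding Q_def using ig by (simp add: nn_integral_eq_integral)
  qed
  ultimately show ?thesis unfolding H_def by (simp add: ennreal_leI)
qed

section \<open>Maximal functions of a frequency-localised wave\<close>

text \<open>
Linearising a maximal function: for a finite index set a maximising index can be chosen measurably.
\<close>

lemma measurable_argmax:
  fixes F :: "'i \<Rightarrow> 'a \<Rightarrow> ennreal"
  assumes "finite S" "S \<noteq> {}" "\<And>i. i \<in> S \<Longrightarrow> F i \<in> borel_measurable M"
  shows "\<exists>\<sigma>\<in>measurable M (count_space S). \<forall>x\<in>space M. \<forall>i\<in>S. F i x \<le> F (\<sigma> x) x"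
  using assms
proof (induction S rule: finite_ne_induct)
  case (singleton a)
  then show ?case by (intro bexI[of _ "\<lambda>_. a"]) auto
next
  case (insert a S)
  then obtain \<sigma> where s: "\<sigma> \<in> measurable M (count_space S)" "\<forall>x\<in>space M. \<forall>i\<in>S. F i x \<le> F (\<sigma> x) x"
    by blast
  have [measurable]: "F a \<in> borel_measurable M" using insert by auto
  have [measurable]: "(\<lambda>x. F (\<sigma> x) x) \<in> borel_measurable M"
    by (rule measurable_compose_countable'[OF _ s(1)]) (use insert in \<open>auto intro: countable_finite\<close>)
  have [measurable]: "\<sigma> \<in> measurable M (count_space (insert a S))"
    using measurable_compose[OF s(1), of "\<lambda>i. i" "count_space (insert a S)"] by auto
  define \<tau> where "\<tau> x = (if F (\<sigma> x) x \<le> F a x then a else \<sigma> x)" for x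
  have "\<tau> \<in> measurable M (count_space (insert a S))"
    unfolding \<tau>_def by (rule measurable_If) (simp_all, measurable)
  moreover have "\<forall>x\<in>space M. \<forall>i\<in>insert a S. F i x \<le> F (\<tau> x) x"
  proof (intro ballI)
    fix x i assume x: "x \<in> space M" and i: "i \<in> insert a S"
    show "F i x \<le> F (\<tau> x) x"
    proof (cases "F (\<sigma> x) x \<le> F a x")
      case True
      then show ?thesis using i s(2) x order_trans[of "F i x" "F (\<sigma> x) x" "F a x"] by (auto simp: \<tau>_def)
    next
      case False
      then show ?thesis using i s(2) x by (auto simp: \<tau>_def)
    qed
  qed
  ultimately show ?case by blast
qed

text \<open>
By monotone convergence a countable supremum reduces to finite ones, and these are attained along a measurable
choice of the index.
\<close>

lemma nn_integral_SUP_by_selection: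
  fixes F :: "'i \<Rightarrow> 'a \<Rightarrow> ennreal"
  assumes D: "countable D" and F: "\<And>i. i \<in> D \<Longrightarrow> F i \<in> borel_measurable M"
    and sel: "\<And>\<sigma> S. S \<subseteq> D \<Longrightarrow> finite S \<Longrightarrow> \<sigma> \<in> measurable M (count_space S) \<Longrightarrow> (\<integral>\<^sup>+x. F (\<sigma> x) x \<partial>M) \<le> B"
  shows "(\<integral>\<^sup>+x. (SUP i\<in>D. F i x) \<partial>M) \<le> B"
proof (cases "D = {}")
  case False
  define E where "E n = from_nat_into D ` {..n}" for n
  have E: "E n \<subseteq> D" "finite (E n)" "E n \<noteq> {}" for n
    using from_nat_into[OF False] by (auto simp: E_def)
  have "D = range (from_nat_into D)" using range_from_nat_into[OF False D] by simp
  also have "\<dots> = (\<Union>n. E n)" by (auto simp: E_def)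
  finally have "(SUP i\<in>D. F i x) = (SUP n. SUP i\<in>E n. F i x)" for x
    using SUP_UNION[of "\<lambda>i. F i x" E UNIV] by simp
  then have "(\<integral>\<^sup>+x. (SUP i\<in>D. F i x) \<partial>M) = (\<integral>\<^sup>+x. (SUP n. SUP i\<in>E n. F i x) \<partial>M)" by simp
  also have "\<dots> = (SUP n. \<integral>\<^sup>+x. (SUP i\<in>E n. F i x) \<partial>M)"
  proof (rule nn_integral_monotone_convergence_SUP)
    show "incseq (\<lambda>n x. SUP i\<in>E n. F i x)"
      by (auto simp: incseq_def le_fun_def E_def intro!: SUP_subset_mono)
    show "(\<lambda>x. SUP i\<in>E n. F i x) \<in> borel_measurable M" for n
      using E(1,2) F by (intro borel_measurable_SUP countable_finite) auto
  qed
  also have "\<dots> \<le> B"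
  proof (rule SUP_least)
    fix n
    obtain \<sigma> where s: "\<sigma> \<in> measurable M (count_space (E n))" "\<forall>x\<in>space M. \<forall>i\<in>E n. F i x \<le> F (\<sigma> x) x"
      using measurable_argmax[OF E(2,3), of n F M] F E(1) by blast
    have "(\<integral>\<^sup>+x. (SUP i\<in>E n. F i x) \<partial>M) \<le> (\<integral>\<^sup>+x. F (\<sigma> x) x \<partial>M)"
      by (intro nn_integral_mono SUP_least) (use s(2) in auto)
    also have "\<dots> \<le> B" by (rule sel[OF E(1,2) s(1)])
    finally show "(\<integral>\<^sup>+x. (SUP i\<in>E n. F i x) \<partial>M) \<le> B" .
  qed
  finally show ?thesis .
qed (simp add: bot_ennreal)

definition osc_integral :: "(real \<Rightarrow> real) \<Rightarrow> (real \<Rightarrow> complex) \<Rightarrow> real \<Rightarrow> real \<Rightarrow> complex" where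
  "osc_integral \<Phi> h t y = (LINT \<xi>|lborel. cis (y * \<xi> + t * \<Phi> \<xi>) * h \<xi>)"

lemma borel_measurable_osc_integral [measurable]:
  assumes [measurable]: "\<Phi> \<in> borel_measurable borel" "h \<in> borel_measurable borel"
  shows "osc_integral \<Phi> h t \<in> borel_measurable borel"
  unfolding osc_integral_def by measurable

text \<open>
The fourth power is taken inside the supremum, and the restriction to \<open>[-1,1]\<close> is built in, because every estimate
below is for the integral of this function.
\<close>

definition quartic_maximal :: "(real \<Rightarrow> real) \<Rightarrow> (real \<Rightarrow> complex) \<Rightarrow> (real \<times> real) set \<Rightarrow> real \<Rightarrow> ennreal" where
  "quartic_maximal \<Phi> h D x =
     (SUP (t, \<theta>)\<in>D. ennreal (norm (osc_integral \<Phi> h t (x + t * \<theta>)) ^ 4) * indicator {-1..1} x)"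

lemma borel_measurable_quartic_maximal:
  assumes [measurable]: "\<Phi> \<in> borel_measurable borel" "h \<in> borel_measurable borel" and D: "countable D"
  shows "quartic_maximal \<Phi> h D \<in> borel_measurable borel"
  unfolding quartic_maximal_def case_prod_beta using D by (intro borel_measurable_SUP) measurable

text \<open>
The directions are allowed to vary by \<open>1/R\<close>, the uncertainty scale of the frequency band: their contribution to
the phase, at most \<open>2/R\<close> times \<open>\<xi>\<close>, is absorbed by the kernel bound.
\<close>

lemma maximal_L4_near_direction:
  fixes h :: "real \<Rightarrow> complex" and \<Phi> \<Phi>' \<Phi>'' :: "real \<Rightarrow> real" and a b \<sigma> c R \<theta>0 :: real
  assumes ab: "a \<le> b" "b - a \<le> R" and R: "R > 0" and c: "c > 0"
    and m[measurable]: "\<Phi> \<in> borel_measurable borel"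
    and d1: "\<And>\<xi>. \<xi> \<in> {a..b} \<Longrightarrow> (\<Phi> has_real_derivative \<Phi>' \<xi>) (at \<xi> within {a..b})"
    and d2: "\<And>\<xi>. \<xi> \<in> {a..b} \<Longrightarrow> (\<Phi>' has_real_derivative \<Phi>'' \<xi>) (at \<xi> within {a..b})"
    and sg: "\<bar>\<sigma>\<bar> = 1" "\<And>\<xi>. \<xi> \<in> {a..b} \<Longrightarrow> 0 \<le> \<sigma> * \<Phi>'' \<xi>"
    and cv: "\<And>\<xi>. \<xi> \<in> {a..b} \<Longrightarrow> c * \<bar>\<Phi>' \<xi> + \<theta>0\<bar> \<le> R * \<bar>\<Phi>'' \<xi>\<bar>"
    and h: "integrable lborel h" "integrable lborel (\<lambda>\<xi>. (norm (h \<xi>))\<^sup>2)" "\<And>\<xi>. \<xi> \<notin> {a..b} \<Longrightarrow> h \<xi> = 0"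
    and D: "countable D" "D \<subseteq> {-1..1} \<times> {\<theta>. \<bar>\<theta> - \<theta>0\<bar> \<le> 1 / R}"
  shows "(\<integral>\<^sup>+x. quartic_maximal \<Phi> h D x \<partial>lborel)
    \<le> ennreal (8 * (9 + 7 / c)\<^sup>2 * R * arsinh (2 * R) * (LINT \<xi>|lborel. (norm (h \<xi>))\<^sup>2)\<^sup>2)"
proof -
  have [measurable]: "h \<in> borel_measurable borel" using h(1) by auto
  define \<kappa> where "\<kappa> z = 4 * (9 + 7 / c)\<^sup>2 * kernel_majorant R z" for z
  have [measurable]: "\<kappa> \<in> borel_measurable borel" unfolding \<kappa>_def kernel_majorant_def by simp
  define L where "L = 4 * (9 + 7 / c)\<^sup>2 * (2 * R * arsinh (2 * R))"
  have as0: "arsinh (2 * R) \<ge> 0" using R arsinh_real_pos_iff[of "2 * R"] by (simp add: less_imp_le)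
  define F where "F = (\<lambda>p x. ennreal (norm (osc_integral \<Phi> h (fst p) (x + fst p * snd p)) ^ 4) * indicator {-1..1} x)"
  have "(\<integral>\<^sup>+x. (SUP p\<in>D. F p x) \<partial>lborel) \<le> ennreal (L * (LINT \<xi>|lborel. (norm (h \<xi>))\<^sup>2)\<^sup>2)"
  proof (rule nn_integral_SUP_by_selection[OF D(1)])
    show "F p \<in> borel_measurable lborel" for p unfolding F_def by measurable
  next
    fix s :: "real \<Rightarrow> real \<times> real" and S
    assume S: "S \<subseteq> D" "finite S" and s[measurable]: "s \<in> measurable lborel (count_space S)"
    have sS: "s x \<in> S" for x using measurable_space[OF s, of x] by simp
    have sb: "\<bar>fst (s x)\<bar> \<le> 1" "\<bar>snd (s x) - \<theta>0\<bar> \<le> 1 / R" for x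
    proof -
      have "s x \<in> {-1..1} \<times> {\<theta>. \<bar>\<theta> - \<theta>0\<bar> \<le> 1 / R}" using sS[of x] S(1) D(2) by blast
      then show "\<bar>fst (s x)\<bar> \<le> 1" "\<bar>snd (s x) - \<theta>0\<bar> \<le> 1 / R" by auto
    qed
    have m1[measurable]: "(\<lambda>x. fst (s x)) \<in> borel_measurable borel" "(\<lambda>x. snd (s x)) \<in> borel_measurable borel"
      using measurable_compose[OF s, of fst borel] measurable_compose[OF s, of snd borel] by simp_all
    have "(\<integral>\<^sup>+x. F (s x) x \<partial>lborel)
      = (\<integral>\<^sup>+x. ennreal (norm (LINT \<xi>|lborel. cis ((x + fst (s x) * snd (s x)) * \<xi> + fst (s x) * \<Phi> \<xi>) * h \<xi>) ^ 4) * indicator {-1..1} x \<partial>lborel)"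
      unfolding F_def osc_integral_def by simp
    also have "\<dots> \<le> ennreal (L * (LINT \<xi>|lborel. (norm (h \<xi>))\<^sup>2)\<^sup>2)"
    proof (rule TT_star_L4[where \<kappa> = \<kappa> and J = "{a..b}"])
      fix x y :: real
      define \<tau> where "\<tau> = fst (s x) - fst (s y)"
      \<comment> \<open>The frequency shift by \<open>\<theta>0\<close> goes into the phase function, the rest into \<open>u\<close>.\<close>
      define u where "u = (x - y) + fst (s x) * (snd (s x) - \<theta>0) - fst (s y) * (snd (s y) - \<theta>0)"
      have u: "\<bar>u - (x - y)\<bar> \<le> 2 / R"
      proof -
        have "\<bar>fst (s x) * (snd (s x) - \<theta>0)\<bar> \<le> 1 * (1 / R)" for x
          unfolding abs_mult using sb[of x] by (intro mult_mono) auto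
        from this[of x] this[of y] show ?thesis unfolding u_def by (simp add: abs_le_iff)
      qed
      have ph: "(x + fst (s x) * snd (s x) - (y + fst (s y) * snd (s y))) * \<xi> + (fst (s x) - fst (s y)) * \<Phi> \<xi>
         = u * \<xi> + \<tau> * (\<Phi> \<xi> + \<theta>0 * \<xi>)" for \<xi>
        unfolding u_def \<tau>_def by (simp add: algebra_simps)
      have dp: "((\<lambda>\<xi>. \<Phi> \<xi> + \<theta>0 * \<xi>) has_real_derivative \<Phi>' \<xi> + \<theta>0) (at \<xi> within {a..b})"
        "((\<lambda>\<xi>. \<Phi>' \<xi> + \<theta>0) has_real_derivative \<Phi>'' \<xi>) (at \<xi> within {a..b})" if "\<xi> \<in> {a..b}" for \<xi>
        using d1[OF that] d2[OF that] by (auto intro!: derivative_eq_intros)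
      have "(LINT \<xi>|lborel. indicator {a..b} \<xi> *\<^sub>R cis (u * \<xi> + \<tau> * (\<Phi> \<xi> + \<theta>0 * \<xi>)))
          = integral {a..b} (\<lambda>\<xi>. cis (u * \<xi> + \<tau> * (\<Phi> \<xi> + \<theta>0 * \<xi>)))"
        unfolding set_lebesgue_integral_def[symmetric]
        by (intro set_borel_integral_eq_integral borel_integrable_atLeastAtMost' continuous_on_cis continuous_intros
            DERIV_continuous_on[OF d1])
      then show "(norm (LINT \<xi>|lborel. indicator {a..b} \<xi> *\<^sub>R
           cis ((x + fst (s x) * snd (s x) - (y + fst (s y) * snd (s y))) * \<xi> + (fst (s x) - fst (s y)) * \<Phi> \<xi>)))\<^sup>2 \<le> \<kappa> (x - y)"
        unfolding ph \<kappa>_def using phase_kernel_bound[OF ab R c dp sg cv u, of \<tau>] by simp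
    next
      show "0 \<le> \<kappa> z" "\<kappa> (- z) = \<kappa> z" for z using R by (auto simp: \<kappa>_def kernel_majorant_def)
      show "L \<ge> 0" using R as0 by (simp add: L_def)
      fix x :: real assume x: "x \<in> {-1..1}"
      have "(\<integral>\<^sup>+y. ennreal (\<kappa> (x - y)) * indicator {-1..1} y \<partial>lborel)
        = ennreal (4 * (9 + 7 / c)\<^sup>2) * (\<integral>\<^sup>+y. ennreal (kernel_majorant R (x - y)) * indicator {-1..1} y \<partial>lborel)"
      proof -
        have "ennreal (\<kappa> (x - y)) * indicator {-1..1} y
            = ennreal (4 * (9 + 7 / c)\<^sup>2) * (ennreal (kernel_majorant R (x - y)) * indicator {-1..1} y)" for y
          unfolding \<kappa>_def by (subst ennreal_mult') (simp_all add: mult.assoc del: ennreal_numeral)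
        then show ?thesis by (simp only:) (rule nn_integral_cmult, simp add: kernel_majorant_def)
      qed
      also have "\<dots> \<le> ennreal (4 * (9 + 7 / c)\<^sup>2) * ennreal (2 * R * arsinh (2 * R))"
        by (intro mult_left_mono kernel_majorant_integral R x) auto
      also have "\<dots> = ennreal L" unfolding L_def by (rule ennreal_mult'[symmetric]) simp
      finally show "(\<integral>\<^sup>+y. ennreal (\<kappa> (x - y)) * indicator {-1..1} y \<partial>lborel) \<le> ennreal L" .
    next
      show "(\<lambda>x. x + fst (s x) * snd (s x)) \<in> borel_measurable borel" by (intro borel_measurable_add borel_measurable_times m1) simp
      show "emeasure lborel {a..b} < top" "emeasure lborel {-1..1::real} < top" using ab(1) by simp_all
    qed (fact | simp)+
    finally show "(\<integral>\<^sup>+x. F (s x) x \<partial>lborel) \<le> ennreal (L * (LINT \<xi>|lborel. (norm (h \<xi>))\<^sup>2)\<^sup>2)" .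
  qed
  then show ?thesis unfolding quartic_maximal_def F_def L_def by (simp add: case_prod_beta mult_ac)
qed

text \<open>
A supremum over a union is at most the sum of the suprema, here of fourth powers.  The direction \<open>\<theta>0\<close> attached to
a covering interval is taken in \<open>\<Theta>\<close>, where the curvature condition is available.
\<close>

lemma maximal_L4_directions:
  fixes h :: "real \<Rightarrow> complex" and \<Phi> \<Phi>' \<Phi>'' :: "real \<Rightarrow> real" and a b \<sigma> c R :: real
  assumes ab: "a \<le> b" "b - a \<le> R" and R: "R > 0" and c: "c > 0"
    and m[measurable]: "\<Phi> \<in> borel_measurable borel"
    and d1: "\<And>\<xi>. \<xi> \<in> {a..b} \<Longrightarrow> (\<Phi> has_real_derivative \<Phi>' \<xi>) (at \<xi> within {a..b})"
    and d2: "\<And>\<xi>. \<xi> \<in> {a..b} \<Longrightarrow> (\<Phi>' has_real_derivative \<Phi>'' \<xi>) (at \<xi> within {a..b})"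
    and sg: "\<bar>\<sigma>\<bar> = 1" "\<And>\<xi>. \<xi> \<in> {a..b} \<Longrightarrow> 0 \<le> \<sigma> * \<Phi>'' \<xi>"
    and cv: "\<And>\<xi> \<theta>. \<xi> \<in> {a..b} \<Longrightarrow> \<theta> \<in> \<Theta> \<Longrightarrow> c * \<bar>\<Phi>' \<xi> + \<theta>\<bar> \<le> R * \<bar>\<Phi>'' \<xi>\<bar>"
    and h: "integrable lborel h" "integrable lborel (\<lambda>\<xi>. (norm (h \<xi>))\<^sup>2)" "\<And>\<xi>. \<xi> \<notin> {a..b} \<Longrightarrow> h \<xi> = 0"
    and D: "countable D" "D \<subseteq> {-1..1} \<times> \<Theta>"
    and A: "finite A" "\<Theta> \<subseteq> (\<Union>a\<in>A. {a..a + 1 / R})"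
  shows "(\<integral>\<^sup>+x. quartic_maximal \<Phi> h D x \<partial>lborel)
    \<le> ennreal (card A * (8 * (9 + 7 / c)\<^sup>2 * R * arsinh (2 * R) * (LINT \<xi>|lborel. (norm (h \<xi>))\<^sup>2)\<^sup>2))"
    (is "_ \<le> ennreal (_ * ?B)")
proof -
  have [measurable]: "h \<in> borel_measurable borel" using h(1) by auto
  define E where "E \<alpha> = {p \<in> D. snd p \<in> {\<alpha>..\<alpha> + 1 / R}}" for \<alpha>
  have E: "countable (E \<alpha>)" for \<alpha> using D(1) by (rule countable_subset[rotated]) (auto simp: E_def)
  have B0: "?B \<ge> 0" using R arsinh_real_pos_iff[of "2 * R"] by (simp add: less_imp_le)
  have piece: "(\<integral>\<^sup>+x. quartic_maximal \<Phi> h (E \<alpha>) x \<partial>lborel) \<le> ennreal ?B" for \<alpha>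
  proof (cases "\<Theta> \<inter> {\<alpha>..\<alpha> + 1 / R} = {}")
    case True
    then have "E \<alpha> = {}" using D(2) by (force simp: E_def)
    then show ?thesis by (simp add: quartic_maximal_def bot_ennreal)
  next
    case False
    then obtain \<theta>0 where t: "\<theta>0 \<in> \<Theta>" "\<theta>0 \<in> {\<alpha>..\<alpha> + 1 / R}" by blast
    have "E \<alpha> \<subseteq> {-1..1} \<times> {\<theta>. \<bar>\<theta> - \<theta>0\<bar> \<le> 1 / R}"
      using D(2) t(2) by (force simp: E_def)
    from maximal_L4_near_direction[OF ab R c m d1 d2 sg cv[OF _ t(1)] h E this]
    show ?thesis .
  qed
  have "(\<integral>\<^sup>+x. quartic_maximal \<Phi> h D x \<partial>lborel)
      \<le> (\<integral>\<^sup>+x. (\<Sum>\<alpha>\<in>A. quartic_maximal \<Phi> h (E \<alpha>) x) \<partial>lborel)"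
  proof (intro nn_integral_mono)
    fix x
    have "D \<subseteq> (\<Union>\<alpha>\<in>A. E \<alpha>)" using D(2) A(2) by (force simp: E_def)
    then have "quartic_maximal \<Phi> h D x \<le> (SUP \<alpha>\<in>A. quartic_maximal \<Phi> h (E \<alpha>) x)"
      unfolding quartic_maximal_def SUP_UNION[symmetric] by (rule SUP_subset_mono) simp
    also have "\<dots> \<le> (\<Sum>\<alpha>\<in>A. quartic_maximal \<Phi> h (E \<alpha>) x)"
      by (intro SUP_least member_le_sum) (auto simp: A)
    finally show "quartic_maximal \<Phi> h D x \<le> (\<Sum>\<alpha>\<in>A. quartic_maximal \<Phi> h (E \<alpha>) x)" .
  qed
  also have "\<dots> = (\<Sum>\<alpha>\<in>A. \<integral>\<^sup>+x. quartic_maximal \<Phi> h (E \<alpha>) x \<partial>lborel)"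
    by (rule nn_integral_sum) (simp add: borel_measurable_quartic_maximal[OF m _ E])
  also have "\<dots> \<le> (\<Sum>\<alpha>\<in>A. ennreal ?B)" by (intro sum_mono piece)
  also have "\<dots> = ennreal (card A * ?B)"
    by (simp only: sum_constant ennreal_of_nat_eq_real_of_nat ennreal_mult'[OF of_nat_0_le_iff])
  finally show ?thesis .
qed

section \<open>Plancherel inequalities for integrable functions\<close>

definition fourier_integral :: "(real \<Rightarrow> complex) \<Rightarrow> real \<Rightarrow> complex" where
  "fourier_integral f \<xi> = (LINT x|lborel. f x * cis (- (x * \<xi>)))"

lemma gaussian_fourier:
  fixes m z :: real
  assumes m: "m > 0"
  shows "(LINT \<xi>|lborel. exp (- (\<xi> / m)\<^sup>2 / 2) *\<^sub>R cis (- (z * \<xi>))) = of_real (2 * pi * normal_density 0 (1 / m) z)"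
proof -
  have "(LINT \<xi>|lborel. exp (- (\<xi> / m)\<^sup>2 / 2) *\<^sub>R cis (- (z * \<xi>)))
      = m *\<^sub>R (LINT v|lborel. exp (- v\<^sup>2 / 2) *\<^sub>R cis (- (z * (m * v))))"
    using m lborel_integral_real_affine[of m "\<lambda>\<xi>. exp (- (\<xi> / m)\<^sup>2 / 2) *\<^sub>R cis (- (z * \<xi>))" 0] by simp
  also have "(LINT v|lborel. exp (- v\<^sup>2 / 2) *\<^sub>R cis (- (z * (m * v))))
      = (LINT v|lborel. sqrt (2 * pi) *\<^sub>R (std_normal_density v *\<^sub>R iexp (- (z * m) * v)))"
    by (intro Bochner_Integration.integral_cong refl) (simp add: std_normal_density_def cis_conv_exp mult_ac)
  also have "\<dots> = sqrt (2 * pi) *\<^sub>R char std_normal_distribution (- (z * m))"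
  proof -
    have "char std_normal_distribution t = (LINT v|lborel. std_normal_density v *\<^sub>R iexp (t * v))" for t
      unfolding char_def by (rule integral_density) auto
    then show ?thesis by (simp only: integral_scaleR_right)
  qed
  also have "\<dots> = of_real (sqrt (2 * pi) * exp (- (z * m)\<^sup>2 / 2))"
    by (simp add: char_std_normal_distribution scaleR_conv_of_real)
  also have "m *\<^sub>R \<dots> = of_real (m * (sqrt (2 * pi) * exp (- (z * m)\<^sup>2 / 2)))"
    by (simp add: scaleR_conv_of_real)
  also have "m * (sqrt (2 * pi) * exp (- (z * m)\<^sup>2 / 2)) = 2 * pi * normal_density 0 (1 / m) z"
  proof -
    have "2 * pi = sqrt (2 * pi) * sqrt (2 * pi)" by simp
    then show ?thesis using m unfolding normal_density_def
      by (simp add: real_sqrt_divide real_sqrt_mult power_divide power_mult_distrib)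
  qed
  finally show ?thesis .
qed

text \<open>
The Gaussian weight makes the frequency integral absolutely convergent; its transform is again a Gaussian
density, which concentrates at the diagonal as \<open>m\<close> grows.
\<close>

lemma gaussian_energy:
  fixes F :: "real \<Rightarrow> complex" and m :: real
  assumes F: "integrable lborel F" and m: "m > 0"
  shows gaussian_energy_integrable: "integrable lborel (\<lambda>\<xi>. exp (- (\<xi> / m)\<^sup>2 / 2) * (norm (fourier_integral F \<xi>))\<^sup>2)"
    and gaussian_energy_eq: "complex_of_real (LINT \<xi>|lborel. exp (- (\<xi> / m)\<^sup>2 / 2) * (norm (fourier_integral F \<xi>))\<^sup>2)
      = of_real (2 * pi) * (LINT x|lborel. F x * (LINT y|lborel. cnj (F y) * normal_density 0 (1 / m) (x - y)))"
proof -
  have r: "integrable lborel (\<lambda>\<xi>::real. exp (- (\<xi> / m)\<^sup>2 / 2))"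
  proof -
    have "exp (- (\<xi> / m)\<^sup>2 / 2) = sqrt (2 * pi * m\<^sup>2) * normal_density 0 m \<xi>" for \<xi>
      using m by (simp add: normal_density_def power_divide)
    then show ?thesis using m by simp
  qed
  have em: "(\<lambda>(x, \<xi>). cis (- (x * \<xi>))) \<in> borel_measurable (lborel \<Otimes>\<^sub>M lborel)" by measurable
  show "integrable lborel (\<lambda>\<xi>. exp (- (\<xi> / m)\<^sup>2 / 2) * (norm (fourier_integral F \<xi>))\<^sup>2)"
    unfolding fourier_integral_def by (rule weighted_energy_integrable[OF em _ F r]) simp
  have k: "(LINT \<xi>|lborel. exp (- (\<xi> / m)\<^sup>2 / 2) *\<^sub>R (cis (- (x * \<xi>)) * cnj (cis (- (y * \<xi>)))))
     = of_real (2 * pi * normal_density 0 (1 / m) (x - y))" for x y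
  proof -
    have "cis (- (x * \<xi>)) * cnj (cis (- (y * \<xi>))) = cis (- ((x - y) * \<xi>))" for \<xi>
      by (simp add: cis_cnj cis_mult algebra_simps)
    then show ?thesis using gaussian_fourier[OF m, of "x - y"] by simp
  qed
  have "complex_of_real (LINT \<xi>|lborel. exp (- (\<xi> / m)\<^sup>2 / 2) * (norm (fourier_integral F \<xi>))\<^sup>2)
    = (LINT x|lborel. F x * (LINT y|lborel. cnj (F y) * of_real (2 * pi * normal_density 0 (1 / m) (x - y))))"
    unfolding fourier_integral_def k[symmetric] by (rule weighted_energy_identity[OF em _ F r]) simp
  also have "\<dots> = (LINT x|lborel. of_real (2 * pi) * (F x * (LINT y|lborel. cnj (F y) * normal_density 0 (1 / m) (x - y))))"
    by (simp only: of_real_mult mult.left_commute[of _ "of_real 2 * of_real pi :: complex"] integral_mult_right_zero)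
  also have "\<dots> = of_real (2 * pi) * (LINT x|lborel. F x * (LINT y|lborel. cnj (F y) * normal_density 0 (1 / m) (x - y)))"
    by (rule integral_mult_right_zero)
  finally show "complex_of_real (LINT \<xi>|lborel. exp (- (\<xi> / m)\<^sup>2 / 2) * (norm (fourier_integral F \<xi>))\<^sup>2)
      = of_real (2 * pi) * (LINT x|lborel. F x * (LINT y|lborel. cnj (F y) * normal_density 0 (1 / m) (x - y)))" .
qed

lemma nn_integral_normal_density_shift:
  assumes "s > 0"
  shows "(\<integral>\<^sup>+y. ennreal (normal_density 0 s (x - y)) \<partial>lborel) = 1"
    and "(\<integral>\<^sup>+y. ennreal (normal_density 0 s (y - x)) \<partial>lborel) = 1"
proof -
  have "(\<integral>\<^sup>+y. ennreal (normal_density x s y) \<partial>lborel) = 1"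
    using assms by (subst nn_integral_eq_integral) auto
  moreover have "normal_density 0 s (x - y) = normal_density x s y" "normal_density 0 s (y - x) = normal_density x s y" for y
    by (simp_all add: normal_density_def power2_commute)
  ultimately show "(\<integral>\<^sup>+y. ennreal (normal_density 0 s (x - y)) \<partial>lborel) = 1"
     "(\<integral>\<^sup>+y. ennreal (normal_density 0 s (y - x)) \<partial>lborel) = 1" by simp_all
qed

text \<open>
Schur's test for convolution with a probability density.
\<close>

lemma nn_integral_gaussian_bilinear:
  fixes g :: "real \<Rightarrow> real"
  assumes [measurable]: "g \<in> borel_measurable borel" and g: "\<And>x. g x \<ge> 0" and s: "s > 0"
  shows "(\<integral>\<^sup>+x. \<integral>\<^sup>+y. ennreal (g x * g y * normal_density 0 s (x - y)) \<partial>lborel \<partial>lborel)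
    \<le> (\<integral>\<^sup>+x. ennreal ((g x)\<^sup>2) \<partial>lborel)"
proof -
  let ?p = "\<lambda>z. normal_density 0 s z"
  define Q where "Q = (\<integral>\<^sup>+x. ennreal ((g x)\<^sup>2) \<partial>lborel)"
  have 1: "(\<integral>\<^sup>+x. \<integral>\<^sup>+y. ennreal ((g x)\<^sup>2) * ennreal (?p (x - y)) \<partial>lborel \<partial>lborel) = Q"
    by (simp add: nn_integral_cmult nn_integral_normal_density_shift s Q_def)
  have "(\<integral>\<^sup>+x. \<integral>\<^sup>+y. ennreal ((g y)\<^sup>2) * ennreal (?p (x - y)) \<partial>lborel \<partial>lborel)
      = (\<integral>\<^sup>+y. \<integral>\<^sup>+x. ennreal ((g y)\<^sup>2) * ennreal (?p (x - y)) \<partial>lborel \<partial>lborel)"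
    by (rule lborel_pair.Fubini'[symmetric]) measurable
  also have "\<dots> = Q"
    by (simp add: nn_integral_cmult nn_integral_normal_density_shift s Q_def)
  finally have 2: "(\<integral>\<^sup>+x. \<integral>\<^sup>+y. ennreal ((g y)\<^sup>2) * ennreal (?p (x - y)) \<partial>lborel \<partial>lborel) = Q" .
  have "2 * (\<integral>\<^sup>+x. \<integral>\<^sup>+y. ennreal (g x * g y * ?p (x - y)) \<partial>lborel \<partial>lborel)
     = (\<integral>\<^sup>+x. \<integral>\<^sup>+y. 2 * ennreal (g x * g y * ?p (x - y)) \<partial>lborel \<partial>lborel)"
    by (simp add: nn_integral_cmult)
  also have "\<dots> \<le> (\<integral>\<^sup>+x. \<integral>\<^sup>+y. ennreal ((g x)\<^sup>2) * ennreal (?p (x - y)) + ennreal ((g y)\<^sup>2) * ennreal (?p (x - y)) \<partial>lborel \<partial>lborel)"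
  proof (intro nn_integral_mono)
    fix x y
    have "2 * (g x * g y * ?p (x - y)) \<le> ((g x)\<^sup>2 + (g y)\<^sup>2) * ?p (x - y)"
      using mult_right_mono[OF sum_squares_bound[of "g x" "g y"], of "?p (x - y)"] by simp
    then have "ennreal (2 * (g x * g y * ?p (x - y))) \<le> ennreal ((g x)\<^sup>2 * ?p (x - y) + (g y)\<^sup>2 * ?p (x - y))"
      by (intro ennreal_leI) (simp add: distrib_right)
    then show "2 * ennreal (g x * g y * ?p (x - y)) \<le> ennreal ((g x)\<^sup>2) * ennreal (?p (x - y)) + ennreal ((g y)\<^sup>2) * ennreal (?p (x - y))"
      by (simp add: ennreal_mult' g)
  qed
  also have "\<dots> = Q + Q"
    by (simp add: nn_integral_add 1 2)
  also have "\<dots> = 2 * Q" by (simp add: mult_2)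
  finally show ?thesis unfolding Q_def[symmetric]
    by (subst (asm) ennreal_mult_le_mult_iff) simp_all
qed

lemma borel_measurable_fourier_integral [measurable]:
  assumes [measurable]: "F \<in> borel_measurable borel"
  shows "fourier_integral F \<in> borel_measurable borel"
  unfolding fourier_integral_def by measurable

text \<open>
The Gaussian energies are bounded by the \<open>L\<^sup>2\<close> norm of \<open>F\<close>, uniformly in the width, and Fatou's lemma removes the
weight.
\<close>

lemma plancherel_upper_borel:
  fixes F :: "real \<Rightarrow> complex"
  assumes F: "integrable lborel F"
  shows "(\<integral>\<^sup>+\<xi>. ennreal ((norm (fourier_integral F \<xi>))\<^sup>2) \<partial>lborel) \<le> ennreal (2 * pi) * (\<integral>\<^sup>+x. ennreal ((norm (F x))\<^sup>2) \<partial>lborel)"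
    (is "?L \<le> ?R")
proof -
  have [measurable]: "F \<in> borel_measurable borel" using F by auto
  define u where "u n \<xi> = ennreal (exp (- (\<xi> / Suc n)\<^sup>2 / 2) * (norm (fourier_integral F \<xi>))\<^sup>2)" for n \<xi>
  have [measurable]: "u n \<in> borel_measurable lborel" for n unfolding u_def by measurable
  have un: "(\<integral>\<^sup>+\<xi>. u n \<xi> \<partial>lborel) \<le> ?R" for n
  proof -
    let ?p = "normal_density 0 (1 / real (Suc n))"
    define E where "E = (LINT \<xi>|lborel. exp (- (\<xi> / Suc n)\<^sup>2 / 2) * (norm (fourier_integral F \<xi>))\<^sup>2)"
    have E0: "E \<ge> 0" unfolding E_def by simp
    have "(\<integral>\<^sup>+\<xi>. u n \<xi> \<partial>lborel) = ennreal E"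
      unfolding u_def E_def by (rule nn_integral_eq_integral[OF gaussian_energy_integrable[OF F]]) auto
    also have "\<dots> = ennreal (norm (complex_of_real E))" using E0 by simp
    also have "\<dots> = ennreal (2 * pi) * ennreal (norm (LINT x|lborel. F x * (LINT y|lborel. cnj (F y) * ?p (x - y))))"
      unfolding E_def by (subst gaussian_energy_eq[OF F]) (simp_all add: norm_mult ennreal_mult')
    also have "\<dots> \<le> ennreal (2 * pi) * (\<integral>\<^sup>+x. ennreal (norm (F x * (LINT y|lborel. cnj (F y) * ?p (x - y)))) \<partial>lborel)"
      by (intro mult_left_mono norm_integral_le_nn_integral) auto
    also have "\<dots> \<le> ennreal (2 * pi) * (\<integral>\<^sup>+x. \<integral>\<^sup>+y. ennreal (norm (F x) * norm (F y) * ?p (x - y)) \<partial>lborel \<partial>lborel)"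
    proof (intro mult_left_mono nn_integral_mono)
      fix x
      have "ennreal (norm (F x * (LINT y|lborel. cnj (F y) * ?p (x - y))))
         = ennreal (norm (F x)) * ennreal (norm (LINT y|lborel. cnj (F y) * ?p (x - y)))"
        by (simp add: norm_mult ennreal_mult')
      also have "\<dots> \<le> ennreal (norm (F x)) * (\<integral>\<^sup>+y. ennreal (norm (cnj (F y) * ?p (x - y))) \<partial>lborel)"
        by (intro mult_left_mono norm_integral_le_nn_integral) auto
      also have "\<dots> = (\<integral>\<^sup>+y. ennreal (norm (F x)) * ennreal (norm (cnj (F y) * ?p (x - y))) \<partial>lborel)"
        by (rule nn_integral_cmult[symmetric]) measurable
      also have "\<dots> = (\<integral>\<^sup>+y. ennreal (norm (F x) * norm (F y) * ?p (x - y)) \<partial>lborel)"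
        by (intro nn_integral_cong) (simp add: norm_mult ennreal_mult' mult.assoc)
      finally show "ennreal (norm (F x * (LINT y|lborel. cnj (F y) * ?p (x - y))))
          \<le> (\<integral>\<^sup>+y. ennreal (norm (F x) * norm (F y) * ?p (x - y)) \<partial>lborel)" .
    qed auto
    also have "\<dots> \<le> ?R"
      by (intro mult_left_mono nn_integral_gaussian_bilinear) auto
    finally show ?thesis .
  qed
  have lim: "(\<lambda>n. u n \<xi>) \<longlonglongrightarrow> ennreal ((norm (fourier_integral F \<xi>))\<^sup>2)" for \<xi>
  proof -
    have "(\<lambda>n. exp (- (\<xi> / Suc n)\<^sup>2 / 2) * (norm (fourier_integral F \<xi>))\<^sup>2) \<longlonglongrightarrow> exp (- 0\<^sup>2 / 2) * (norm (fourier_integral F \<xi>))\<^sup>2"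
      by (intro tendsto_intros LIMSEQ_Suc[OF lim_const_over_n]) auto
    then show ?thesis unfolding u_def by (intro tendsto_ennrealI) simp
  qed
  have "?L = (\<integral>\<^sup>+\<xi>. liminf (\<lambda>n. u n \<xi>) \<partial>lborel)"
    by (intro nn_integral_cong) (simp add: lim_imp_Liminf[OF _ lim])
  also have "\<dots> \<le> liminf (\<lambda>n. \<integral>\<^sup>+\<xi>. u n \<xi> \<partial>lborel)"
    by (rule nn_integral_liminf) measurable
  also have "\<dots> \<le> ?R"
    using un by (intro Liminf_le) auto
  finally show ?thesis .
qed

text \<open>
A class for which the Gaussian means converge by dominated convergence alone, because its members are bounded,
compactly supported and continuous off two points, and which is still dense in \<open>L\<^sup>2\<close>.
\<close>

definition cut_continuous :: "(real \<Rightarrow> complex) \<Rightarrow> bool" where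
  "cut_continuous G \<longleftrightarrow> (\<exists>q r B. continuous_on UNIV q \<and> (\<forall>x. norm (q x) \<le> B) \<and> G = (\<lambda>x. if \<bar>x\<bar> \<le> r then q x else 0))"

lemma cut_continuous_integrable:
  assumes "cut_continuous G"
  shows "integrable lborel G" "(\<integral>\<^sup>+x. ennreal ((norm (G x))\<^sup>2) \<partial>lborel) < top"
proof -
  obtain q r B where q: "continuous_on UNIV q" "\<And>x. norm (q x) \<le> B" "G = (\<lambda>x. if \<bar>x\<bar> \<le> r then q x else (0::complex))"
    using assms unfolding cut_continuous_def by blast
  have [measurable]: "q \<in> borel_measurable borel" using q(1) by (rule borel_measurable_continuous_onI)
  have B0: "B \<ge> 0" using norm_ge_zero order_trans q(2) by blast
  have [measurable]: "G \<in> borel_measurable borel" unfolding q(3) by measurable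
  have i: "integrable lborel (\<lambda>x. c * indicator {-r..r} x :: real)" for c
    by (cases "-r \<le> r") auto
  show "integrable lborel G"
    by (rule Bochner_Integration.integrable_bound[OF i[of B]]) (use q(2) B0 in \<open>auto simp: q(3) indicator_def intro!: AE_I2\<close>)
  have "integrable lborel (\<lambda>x. (norm (G x))\<^sup>2)"
    by (rule Bochner_Integration.integrable_bound[OF i[of "B\<^sup>2"]])
       (use q(2) B0 in \<open>auto simp: q(3) indicator_def intro!: AE_I2 power_mono\<close>)
  then show "(\<integral>\<^sup>+x. ennreal ((norm (G x))\<^sup>2) \<partial>lborel) < top"
    by (simp add: nn_integral_eq_integral)
qed

text \<open>
Convolving \<open>G\<close> with a Gaussian of width \<open>1 / (n + 1)\<close> recovers \<open>G\<close> at its points of continuity, so the Gaussian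
energies tend to \<open>2 \<pi> \<parallel>G\<parallel>\<^sup>2\<close>; they are at most the full energy of the transform.
\<close>

lemma plancherel_lower_cut_continuous:
  assumes "cut_continuous G"
  shows "ennreal (2 * pi) * (\<integral>\<^sup>+x. ennreal ((norm (G x))\<^sup>2) \<partial>lborel) \<le> (\<integral>\<^sup>+\<xi>. ennreal ((norm (fourier_integral G \<xi>))\<^sup>2) \<partial>lborel)"
proof -
  obtain q r B where q: "continuous_on UNIV q" "\<And>x. norm (q x) \<le> B" "G = (\<lambda>x. if \<bar>x\<bar> \<le> r then q x else (0::complex))"
    using assms unfolding cut_continuous_def by blast
  have B0: "B \<ge> 0" using norm_ge_zero order_trans q(2) by blast
  have GB: "norm (G x) \<le> B * indicator {-r..r} x" for x using q(2) by (auto simp: q(3) indicator_def)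
  have GB': "norm (G x) \<le> B" for x using q(2) B0 by (auto simp: q(3))
  have iG: "integrable lborel G" by (rule cut_continuous_integrable[OF assms])
  then have [measurable]: "G \<in> borel_measurable borel" by auto
  define N where "N = (LINT x|lborel. (norm (G x))\<^sup>2)"
  have i: "integrable lborel (\<lambda>x. c * indicator {-r..r} x :: real)" for c
    by (cases "-r \<le> r") auto
  have iN: "integrable lborel (\<lambda>x. (norm (G x))\<^sup>2)"
    using cut_continuous_integrable(2)[OF assms] by (simp add: integrable_iff_bounded)
  define s where "s n = 1 / real (Suc n)" for n
  define E where "E n = (LINT \<xi>|lborel. exp (- (\<xi> / Suc n)\<^sup>2 / 2) * (norm (fourier_integral G \<xi>))\<^sup>2)" for n
  define V where "V n x = (LINT y|lborel. cnj (G y) * normal_density 0 (s n) (x - y))" for n x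
  have Veq: "V n x = (LINT v|lborel. cnj (G (x - s n * v)) * std_normal_density v)" for n x
  proof -
    have sn: "s n > 0" by (simp add: s_def)
    have "V n x = \<bar>- s n\<bar> *\<^sub>R (LINT v|lborel. cnj (G (x + - s n * v)) * normal_density 0 (s n) (x - (x + - s n * v)))"
      unfolding V_def by (rule lborel_integral_real_affine) (use sn in simp)
    also have "\<dots> = (LINT v|lborel. cnj (G (x - s n * v)) * (s n * normal_density 0 (s n) (s n * v)))"
      using sn by (simp add: scaleR_conv_of_real mult.left_commute flip: integral_mult_right_zero)
    also have "\<dots> = (LINT v|lborel. cnj (G (x - s n * v)) * std_normal_density v)"
    proof -
      have "s n * normal_density 0 (s n) (s n * v) = std_normal_density v" for v
        using sn by (simp add: normal_density_def real_sqrt_mult power_mult_distrib)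
      then show ?thesis by (simp only: flip: of_real_mult)
    qed
    finally show ?thesis .
  qed
  have [measurable]: "V n \<in> borel_measurable borel" for n unfolding V_def by measurable
  have s0: "s \<longlonglongrightarrow> 0" unfolding s_def using LIMSEQ_Suc[OF lim_1_over_n] by simp
  have Vlim: "(\<lambda>n. V n x) \<longlonglongrightarrow> cnj (G x)" if x: "\<bar>x\<bar> \<noteq> r" for x
  proof -
    have cG: "isCont G x"
    proof (cases "\<bar>x\<bar> < r")
      case True
      then have "x \<in> {-r<..<r}" by auto
      then have "eventually (\<lambda>y. y \<in> {-r<..<r}) (nhds x)" by (intro eventually_nhds_in_open) auto
      then have "eventually (\<lambda>y. G y = q y) (nhds x)" by eventually_elim (auto simp: q(3))
      then show ?thesis using q(1) isCont_cong[of G q x] continuous_on_eq_continuous_at[OF open_UNIV] by auto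
    next
      case False
      then have "x \<in> {y. r < \<bar>y\<bar>}" using x by auto
      moreover have "open {y::real. r < \<bar>y\<bar>}" by (intro open_Collect_less continuous_intros)
      ultimately have "eventually (\<lambda>y. y \<in> {y. r < \<bar>y\<bar>}) (nhds x)" by (intro eventually_nhds_in_open) auto
      then have "eventually (\<lambda>y. G y = 0) (nhds x)" by eventually_elim (auto simp: q(3))
      then show ?thesis using isCont_cong[of G "\<lambda>_. 0" x] by auto
    qed
    have "(\<lambda>n. LINT v|lborel. cnj (G (x - s n * v)) * std_normal_density v) \<longlonglongrightarrow> (LINT v|lborel. cnj (G x) * std_normal_density v)"
    proof (rule integral_dominated_convergence[where w = "\<lambda>v. B * std_normal_density v"])
      show "AE v in lborel. (\<lambda>n. cnj (G (x - s n * v)) * std_normal_density v) \<longlonglongrightarrow> cnj (G x) * std_normal_density v"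
      proof (intro AE_I2 tendsto_intros)
        fix v
        have "(\<lambda>n. x - s n * v) \<longlonglongrightarrow> x - 0 * v" by (intro tendsto_intros s0)
        then show "(\<lambda>n. G (x - s n * v)) \<longlonglongrightarrow> G x" using isCont_tendsto_compose[OF cG] by simp
      qed
      show "AE v in lborel. norm (cnj (G (x - s n * v)) * std_normal_density v) \<le> B * std_normal_density v" for n
        by (intro AE_I2) (auto simp: norm_mult intro!: mult_right_mono GB')
    qed simp_all
    also have "(LINT v|lborel. cnj (G x) * std_normal_density v) = cnj (G x)"
      by (simp add: integral_complex_of_real)
    finally show ?thesis unfolding Veq .
  qed
  have VB: "norm (V n x) \<le> B" for n x
  proof -
    have "norm (V n x) \<le> (LINT v|lborel. norm (cnj (G (x - s n * v)) * std_normal_density v))"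
      unfolding Veq by (rule integral_norm_bound)
    also have "\<dots> \<le> (LINT v|lborel. B * std_normal_density v)"
      by (rule integral_mono') (auto simp: norm_mult B0 intro!: mult_right_mono GB')
    finally show ?thesis by simp
  qed
  have "(\<lambda>n. LINT x|lborel. G x * V n x) \<longlonglongrightarrow> (LINT x|lborel. G x * cnj (G x))"
  proof (rule integral_dominated_convergence[where w = "\<lambda>x. (B * B) * indicator {-r..r} x"])
    have "AE x in lborel. \<bar>x\<bar> \<noteq> r"
    proof -
      have "AE x in lborel. x \<notin> {r, -r}" by (intro AE_not_in finite_imp_null_set_lborel) auto
      then show ?thesis by eventually_elim auto
    qed
    then show "AE x in lborel. (\<lambda>n. G x * V n x) \<longlonglongrightarrow> G x * cnj (G x)"
      by eventually_elim (intro tendsto_intros Vlim)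
    show "AE x in lborel. norm (G x * V n x) \<le> (B * B) * indicator {-r..r} x" for n
    proof (intro AE_I2)
      fix x
      have "norm (G x * V n x) \<le> (B * indicator {-r..r} x) * B"
        unfolding norm_mult by (intro mult_mono GB VB) (auto simp: B0)
      then show "norm (G x * V n x) \<le> (B * B) * indicator {-r..r} x" by (simp add: mult_ac)
    qed
  qed (use i[of 1] in auto)
  then have "(\<lambda>n. of_real (2 * pi) * (LINT x|lborel. G x * V n x)) \<longlonglongrightarrow> of_real (2 * pi) * (LINT x|lborel. G x * cnj (G x))"
    by (intro tendsto_intros)
  moreover have "of_real (2 * pi) * (LINT x|lborel. G x * V n x) = complex_of_real (E n)" for n
    unfolding E_def V_def s_def by (rule gaussian_energy_eq[OF iG, symmetric]) simp
  moreover have "(LINT x|lborel. G x * cnj (G x)) = complex_of_real N"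
    unfolding N_def integral_complex_of_real[symmetric]
    by (intro Bochner_Integration.integral_cong refl) (simp only: complex_norm_square)
  ultimately have "(\<lambda>n. complex_of_real (E n)) \<longlonglongrightarrow> complex_of_real (2 * pi * N)"
    by (simp only: of_real_mult)
  then have "E \<longlonglongrightarrow> 2 * pi * N" by (simp only: tendsto_of_real_iff)
  then have "(\<lambda>n. ennreal (E n)) \<longlonglongrightarrow> ennreal (2 * pi * N)" by (rule tendsto_ennrealI)
  moreover have "ennreal (E n) \<le> (\<integral>\<^sup>+\<xi>. ennreal ((norm (fourier_integral G \<xi>))\<^sup>2) \<partial>lborel)" for n
  proof -
    have "ennreal (E n) = (\<integral>\<^sup>+\<xi>. ennreal (exp (- (\<xi> / Suc n)\<^sup>2 / 2) * (norm (fourier_integral G \<xi>))\<^sup>2) \<partial>lborel)"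
      unfolding E_def by (rule nn_integral_eq_integral[OF gaussian_energy_integrable[OF iG], symmetric]) auto
    also have "\<dots> \<le> (\<integral>\<^sup>+\<xi>. ennreal ((norm (fourier_integral G \<xi>))\<^sup>2) \<partial>lborel)"
      by (intro nn_integral_mono ennreal_leI) (simp add: mult_left_le_one_le)
    finally show ?thesis .
  qed
  ultimately have "ennreal (2 * pi * N) \<le> (\<integral>\<^sup>+\<xi>. ennreal ((norm (fourier_integral G \<xi>))\<^sup>2) \<partial>lborel)"
    by (meson LIMSEQ_le_const2)
  moreover have "(\<integral>\<^sup>+x. ennreal ((norm (G x))\<^sup>2) \<partial>lborel) = ennreal N"
    unfolding N_def by (rule nn_integral_eq_integral[OF iN]) auto
  ultimately show ?thesis by (simp add: ennreal_mult' mult.assoc)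
qed

section \<open>The Fourier transform of square-integrable functions\<close>

text \<open>
The square of the \<open>L\<^sup>2\<close> norm.  Since constants do not matter, working with squares avoids Minkowski's inequality.
\<close>

definition energy :: "(real \<Rightarrow> complex) \<Rightarrow> ennreal" where
  "energy f = (\<integral>\<^sup>+x. ennreal ((norm (f x))\<^sup>2) \<partial>lborel)"

lemma energy_lebesgue: "energy f = (\<integral>\<^sup>+x. ennreal ((norm (f x))\<^sup>2) \<partial>lebesgue)"
  unfolding energy_def by (rule nn_integral_completion[symmetric])

lemma ennreal_powr_half_square: "(ennreal_powr a (1 / 2))\<^sup>2 = a"
  by (cases a) (auto simp: ennreal_powr_def ennreal_power powr_half_sqrt top_power_ennreal ennreal_top_mult power2_eq_square
     simp flip: ennreal_mult')

lemma L2_norm_square: "(L2_norm f)\<^sup>2 = energy f"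
proof -
  have "ennreal_powr (ennreal (norm (f x))) 2 = ennreal ((norm (f x))\<^sup>2)" for x
    by (simp add: ennreal_powr_def powr_numeral)
  then show ?thesis
    unfolding L2_norm_def Lp_norm_def energy_lebesgue by (simp add: ennreal_powr_half_square)
qed

lemma in_L2_iff: "in_L2 f \<longleftrightarrow> f \<in> borel_measurable lebesgue \<and> energy f < top"
  unfolding in_L2_def L2_norm_square[symmetric] power2_eq_square
  by (auto simp: ennreal_mult_less_top less_top ennreal_mult_eq_top_iff)

lemma ennreal_tendsto_0_square_iff:
  fixes a :: "nat \<Rightarrow> ennreal"
  shows "(\<lambda>n. (a n)\<^sup>2) \<longlonglongrightarrow> 0 \<longleftrightarrow> a \<longlonglongrightarrow> 0"
proof
  assume l: "(\<lambda>n. (a n)\<^sup>2) \<longlonglongrightarrow> 0"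
  show "a \<longlonglongrightarrow> 0"
  proof (rule order_tendstoI)
    fix e :: ennreal assume "0 < e"
    then have "0 < e\<^sup>2" by (simp add: ennreal_zero_less_mult_iff power2_eq_square)
    then have "eventually (\<lambda>n. (a n)\<^sup>2 < e\<^sup>2) sequentially" using l by (rule order_tendstoD(2)[rotated])
    then show "eventually (\<lambda>n. a n < e) sequentially"
      by eventually_elim (metis not_le power_mono zero_le)
  qed simp
next
  assume l: "a \<longlonglongrightarrow> 0"
  have "eventually (\<lambda>n. a n < 1) sequentially" using l by (rule order_tendstoD(2)) simp
  then have "eventually (\<lambda>n. (a n)\<^sup>2 \<le> a n) sequentially"
  proof eventually_elim
    case (elim n)
    then show ?case using mult_left_mono[of "a n" 1 "a n"] by (simp add: power2_eq_square less_imp_le)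
  qed
  then show "(\<lambda>n. (a n)\<^sup>2) \<longlonglongrightarrow> 0"
    using tendsto_sandwich[of "\<lambda>_. 0" "\<lambda>n. (a n)\<^sup>2" sequentially a 0] l by simp
qed

lemma L2_norm_tendsto_0_iff: "(\<lambda>n. L2_norm (f n)) \<longlonglongrightarrow> 0 \<longleftrightarrow> (\<lambda>n. energy (f n)) \<longlonglongrightarrow> 0"
  unfolding L2_norm_square[symmetric] ennreal_tendsto_0_square_iff ..

lemma borel_measurable_lebesgueI: "f \<in> borel_measurable borel \<Longrightarrow> f \<in> borel_measurable lebesgue"
  by (rule measurable_completion) simp

lemma energy_triangle:
  assumes f: "f \<in> borel_measurable lebesgue" and g: "g \<in> borel_measurable lebesgue" and k: "k \<in> borel_measurable lebesgue"
  shows "energy (\<lambda>x. f x - g x) \<le> 2 * energy (\<lambda>x. f x - k x) + 2 * energy (\<lambda>x. g x - k x)"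
proof -
  note [measurable] = f g k
  have "energy (\<lambda>x. f x - g x) \<le> (\<integral>\<^sup>+x. 2 * ennreal ((norm (f x - k x))\<^sup>2) + 2 * ennreal ((norm (g x - k x))\<^sup>2) \<partial>lebesgue)"
    unfolding energy_lebesgue
  proof (rule nn_integral_mono)
    fix x
    have "norm (f x - g x) \<le> norm (f x - k x) + norm (g x - k x)"
      using norm_triangle_ineq4[of "f x - k x" "g x - k x"] by simp
    then have "(norm (f x - g x))\<^sup>2 \<le> (norm (f x - k x) + norm (g x - k x))\<^sup>2" by (intro power_mono) auto
    also have "\<dots> \<le> 2 * (norm (f x - k x))\<^sup>2 + 2 * (norm (g x - k x))\<^sup>2"
      using sum_squares_bound[of "norm (f x - k x)" "norm (g x - k x)"] by (simp add: power2_sum)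
    finally have "ennreal ((norm (f x - g x))\<^sup>2) \<le> ennreal (2 * (norm (f x - k x))\<^sup>2 + 2 * (norm (g x - k x))\<^sup>2)"
      by (rule ennreal_leI)
    then show "ennreal ((norm (f x - g x))\<^sup>2) \<le> 2 * ennreal ((norm (f x - k x))\<^sup>2) + 2 * ennreal ((norm (g x - k x))\<^sup>2)"
      by (simp add: ennreal_mult')
  qed
  also have "\<dots> = 2 * energy (\<lambda>x. f x - k x) + 2 * energy (\<lambda>x. g x - k x)"
    unfolding energy_lebesgue by (simp add: nn_integral_add nn_integral_cmult)
  finally show ?thesis .
qed

lemma energy_add_le:
  assumes f: "f \<in> borel_measurable lebesgue" and g: "g \<in> borel_measurable lebesgue"
  shows "energy f \<le> 2 * energy (\<lambda>x. f x - g x) + 2 * energy g"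
  using energy_triangle[OF f _ g, of "\<lambda>_. 0"] by (simp add: energy_def)

lemma energy_commute: "energy (\<lambda>x. f x - g x) = energy (\<lambda>x. g x - f x)"
  unfolding energy_def by (simp add: norm_minus_commute)

text \<open>
A Lebesgue measurable function is an almost everywhere limit of continuous ones.
\<close>

lemma borel_representative:
  fixes f :: "real \<Rightarrow> complex"
  assumes "f \<in> borel_measurable lebesgue"
  obtains f' where "f' \<in> borel_measurable borel" "AE x in lborel. f x = f' x"
proof -
  have "f measurable_on UNIV" using assms by (simp add: lebesgue_measurable_imp_measurable_on)
  then obtain N g where N: "negligible N" and g: "\<And>n. continuous_on UNIV (g n)"
    and l: "\<And>x. x \<notin> N \<Longrightarrow> (\<lambda>n. g n x) \<longlonglongrightarrow> f x"
    unfolding measurable_on_def by auto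
  have [measurable]: "g n \<in> borel_measurable borel" for n using g by (rule borel_measurable_continuous_onI)
  show thesis
  proof
    show "(\<lambda>x. lim (\<lambda>n. g n x)) \<in> borel_measurable borel" by measurable
    have "AE x in lebesgue. x \<notin> N" using N by (intro AE_not_in) (simp add: negligible_iff_null_sets)
    then have "AE x in lborel. x \<notin> N" by (simp add: AE_completion_iff)
    then show "AE x in lborel. f x = lim (\<lambda>n. g n x)" by eventually_elim (simp add: limI[OF l])
  qed
qed

lemma fourier_L1_cong_AE:
  assumes f: "f \<in> borel_measurable lebesgue" and f': "f' \<in> borel_measurable borel" and ae: "AE x in lborel. f x = f' x"
  shows "fourier_L1 f = fourier_integral f'" "energy f = energy f'" "integrable lebesgue f \<longleftrightarrow> integrable lborel f'"
proof -
  note [measurable] = f' borel_measurable_lebesgueI[OF f'] f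
  have ae': "AE x in lebesgue. f x = f' x" using ae by (rule AE_completion)
  show "fourier_L1 f = fourier_integral f'"
  proof
    fix \<xi>
    have c: "exp (- \<i> * of_real (x * \<xi>)) = cis (- (x * \<xi>))" for x by (simp add: cis_conv_exp)
    have m: "(\<lambda>x. f' x * cis (- (x * \<xi>))) \<in> borel_measurable borel" by measurable
    have [measurable]: "(\<lambda>x. cis (- (x * \<xi>))) \<in> borel_measurable lebesgue"
      by (rule borel_measurable_lebesgueI) measurable
    have "fourier_L1 f \<xi> = (LINT x|lebesgue. f' x * cis (- (x * \<xi>)))"
      unfolding fourier_L1_def c
      by (rule integral_cong_AE) (use ae' in \<open>auto intro: borel_measurable_lebesgueI[OF m]\<close>)
    also have "\<dots> = fourier_integral f' \<xi>" unfolding fourier_integral_def using m by (intro integral_completion) simp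
    finally show "fourier_L1 f \<xi> = fourier_integral f' \<xi>" .
  qed
  show "energy f = energy f'"
    unfolding energy_def by (rule nn_integral_cong_AE) (use ae in eventually_elim, simp)
  have "integrable lebesgue f \<longleftrightarrow> integrable lebesgue f'"
    by (rule integrable_cong_AE[OF _ _ ae']) measurable
  also have "\<dots> \<longleftrightarrow> integrable lborel f'" by (rule integrable_completion) simp
  finally show "integrable lebesgue f \<longleftrightarrow> integrable lborel f'" .
qed

lemma borel_measurable_fourier_L1:
  assumes "integrable lebesgue f"
  shows "fourier_L1 f \<in> borel_measurable borel"
proof -
  have m: "f \<in> borel_measurable lebesgue" using assms by auto
  obtain f' where f': "f' \<in> borel_measurable borel" "AE x in lborel. f x = f' x" by (rule borel_representative[OF m])
  show ?thesis unfolding fourier_L1_cong_AE(1)[OF m f'] using f'(1) by measurable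
qed

lemma energy_fourier_L1_le:
  assumes "integrable lebesgue f"
  shows "energy (fourier_L1 f) \<le> ennreal (2 * pi) * energy f"
proof -
  have m: "f \<in> borel_measurable lebesgue" using assms by auto
  obtain f' where f': "f' \<in> borel_measurable borel" "AE x in lborel. f x = f' x" by (rule borel_representative[OF m])
  note c = fourier_L1_cong_AE[OF m f']
  show ?thesis using plancherel_upper_borel[of f'] assms unfolding c by (simp add: energy_def)
qed

lemma fourier_L1_diff:
  assumes f: "integrable lebesgue f" and g: "integrable lebesgue g"
  shows "fourier_L1 (\<lambda>x. f x - g x) \<xi> = fourier_L1 f \<xi> - fourier_L1 g \<xi>"
proof -
  have m: "(\<lambda>x. exp (- \<i> * of_real (x * \<xi>))) \<in> borel_measurable lebesgue"
    by (rule borel_measurable_lebesgueI) measurable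
  have *: "integrable lebesgue (\<lambda>x. exp (- \<i> * of_real (x * \<xi>)) * f x)" if f: "integrable lebesgue f" for f
  proof (rule Bochner_Integration.integrable_bound[OF f])
    show "(\<lambda>x. exp (- \<i> * of_real (x * \<xi>)) * f x) \<in> borel_measurable lebesgue"
      using m f by (intro borel_measurable_times) auto
    show "AE x in lebesgue. norm (exp (- \<i> * of_real (x * \<xi>)) * f x) \<le> norm (f x)"
      by (intro AE_I2) (simp add: norm_mult norm_exp_eq_Re)
  qed
  show ?thesis unfolding fourier_L1_def
    using Bochner_Integration.integral_diff[OF *[OF f] *[OF g]] by (simp add: right_diff_distrib)
qed

lemma energy_fourier_L1_diff_le:
  assumes f: "integrable lebesgue f" and g: "integrable lebesgue g"
  shows "energy (\<lambda>\<xi>. fourier_L1 f \<xi> - fourier_L1 g \<xi>) \<le> ennreal (2 * pi) * energy (\<lambda>x. f x - g x)"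
proof -
  have "fourier_L1 (\<lambda>x. f x - g x) = (\<lambda>\<xi>. fourier_L1 f \<xi> - fourier_L1 g \<xi>)"
    by (rule ext, rule fourier_L1_diff[OF f g])
  then show ?thesis using energy_fourier_L1_le[OF Bochner_Integration.integrable_diff[OF f g]] by simp
qed

lemma cut_continuous_facts:
  assumes "cut_continuous G"
  shows "integrable lebesgue G" "in_L2 G" "G \<in> borel_measurable borel"
    "ennreal (2 * pi) * energy G \<le> energy (fourier_L1 G)"
proof -
  note n = cut_continuous_integrable[OF assms]
  show m: "G \<in> borel_measurable borel" using n(1) by auto
  have m': "G \<in> borel_measurable lebesgue" by (rule borel_measurable_lebesgueI[OF m])
  note c = fourier_L1_cong_AE[OF m' m]
  show "integrable lebesgue G" using c(3) n(1) by simp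
  show "in_L2 G" unfolding in_L2_iff using m' n(2) by (simp add: energy_def)
  show "ennreal (2 * pi) * energy G \<le> energy (fourier_L1 G)"
    using c(1) plancherel_lower_cut_continuous[OF assms] by (simp add: energy_def)
qed

text \<open>
Truncation in space and in height approximates \<open>g\<close> by bounded functions of bounded support.  Such a function is
an almost everywhere limit of continuous functions; projecting these to the disc that contains its values keeps
the convergence dominated.
\<close>

lemma cut_continuous_dense:
  assumes g: "in_L2 g" and e: "0 < (e::ennreal)"
  obtains G where "cut_continuous G" "energy (\<lambda>x. G x - g x) < e"
proof -
  have gm[measurable]: "g \<in> borel_measurable lebesgue" and gE: "energy g < top" using g by (auto simp: in_L2_iff)
  have [measurable]: "(\<lambda>x. x) \<in> borel_measurable lebesgue" by (rule borel_measurable_lebesgueI) simp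
  define e4 where "e4 = min (e / 8) 1"
  have e4: "0 < e4" "2 * e4 + 2 * e4 < e"
  proof -
    show "0 < e4" using e by (simp add: e4_def ennreal_zero_less_divide)
    show "2 * e4 + 2 * e4 < e"
    proof (cases e)
      case (real r)
      have r0: "r > 0" using e real by simp
      have "e4 \<le> ennreal (r / 8)" unfolding e4_def real using r0
        by (intro min.coboundedI1) (simp flip: ennreal_numeral add: divide_ennreal)
      then have "2 * e4 + 2 * e4 \<le> 2 * ennreal (r / 8) + 2 * ennreal (r / 8)" by (intro add_mono mult_left_mono) auto
      also have "\<dots> = ennreal (r / 2)" using r0
        by (simp flip: ennreal_numeral ennreal_mult' ennreal_plus)
      also have "\<dots> < e" using r0 real by (simp add: ennreal_less_iff)
      finally show ?thesis .
    next
      case top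
      have "2 * e4 + 2 * e4 \<le> 2 * 1 + 2 * 1" unfolding e4_def by (intro add_mono mult_left_mono) auto
      also have "\<dots> < e" unfolding top by (simp add: less_top[symmetric])
      finally show ?thesis .
    qed
  qed
  define g1 where "g1 n x = (if \<bar>x\<bar> \<le> real n \<and> norm (g x) \<le> real n then g x else 0)" for n x
  have g1m[measurable]: "g1 n \<in> borel_measurable lebesgue" for n unfolding g1_def by measurable
  have "(\<lambda>n. \<integral>\<^sup>+x. ennreal ((norm (g1 n x - g x))\<^sup>2) \<partial>lebesgue) \<longlonglongrightarrow> (\<integral>\<^sup>+x. 0 \<partial>(lebesgue::real measure))"
  proof (rule nn_integral_dominated_convergence[where w = "\<lambda>x. ennreal ((norm (g x))\<^sup>2)"])
    show "AE x in lebesgue. (\<lambda>n. ennreal ((norm (g1 n x - g x))\<^sup>2)) \<longlonglongrightarrow> 0"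
    proof (intro AE_I2)
      fix x
      obtain m where "max \<bar>x\<bar> (norm (g x)) \<le> real m" using real_arch_simple by blast
      then have "eventually (\<lambda>n. ennreal ((norm (g1 n x - g x))\<^sup>2) = 0) sequentially"
        unfolding eventually_sequentially by (intro exI[of _ m]) (auto simp: g1_def)
      then show "(\<lambda>n. ennreal ((norm (g1 n x - g x))\<^sup>2)) \<longlonglongrightarrow> 0" by (rule tendsto_eventually)
    qed
    show "(\<integral>\<^sup>+x. ennreal ((norm (g x))\<^sup>2) \<partial>lebesgue) < \<infinity>" using gE by (simp add: energy_lebesgue)
    show "AE x in lebesgue. ennreal ((norm (g1 n x - g x))\<^sup>2) \<le> ennreal ((norm (g x))\<^sup>2)" for n
      by (intro AE_I2) (auto simp: g1_def)
  qed measurable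
  then have "eventually (\<lambda>n. energy (\<lambda>x. g1 n x - g x) < e4) sequentially"
    unfolding energy_lebesgue using e4(1) by (intro order_tendstoD(2)) simp_all
  then obtain n where n: "energy (\<lambda>x. g1 n x - g x) < e4" unfolding eventually_sequentially by blast
  have "g1 n measurable_on UNIV" by (simp add: lebesgue_measurable_imp_measurable_on)
  then obtain N p where N: "negligible N" and p: "\<And>k. continuous_on UNIV (p k)"
    and l: "\<And>x. x \<notin> N \<Longrightarrow> (\<lambda>k. p k x) \<longlonglongrightarrow> g1 n x"
    unfolding measurable_on_def by auto
  define C where "C = cball (0::complex) (real n)"
  have C: "convex C" "closed C" "C \<noteq> {}" unfolding C_def by auto
  have cC: "continuous_on UNIV (closest_point C)" by (rule continuous_on_closest_point[OF C])
  define q where "q k x = closest_point C (p k x)" for k x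
  have q: "continuous_on UNIV (q k)" for k
    unfolding q_def by (rule continuous_on_compose2[OF cC p]) simp
  have qB: "norm (q k x) \<le> real n" for k x
    using closest_point_in_set[OF C(2,3), of "p k x"] by (simp add: q_def C_def)
  define G where "G k x = (if \<bar>x\<bar> \<le> real n then q k x else 0)" for k x
  have nG: "cut_continuous (G k)" for k unfolding cut_continuous_def G_def using q qB by blast
  have [measurable]: "G k \<in> borel_measurable lebesgue" for k
    by (rule borel_measurable_lebesgueI[OF cut_continuous_facts(3)[OF nG]])
  have "(\<lambda>k. \<integral>\<^sup>+x. ennreal ((norm (G k x - g1 n x))\<^sup>2) \<partial>lebesgue) \<longlonglongrightarrow> (\<integral>\<^sup>+x. 0 \<partial>(lebesgue::real measure))"
  proof (rule nn_integral_dominated_convergence[where w = "\<lambda>x. ennreal ((2 * real n)\<^sup>2) * indicator {-real n..real n} x"])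
    have "AE x in lebesgue. x \<notin> N" using N by (intro AE_not_in) (simp add: negligible_iff_null_sets)
    then show "AE x in lebesgue. (\<lambda>k. ennreal ((norm (G k x - g1 n x))\<^sup>2)) \<longlonglongrightarrow> 0"
    proof eventually_elim
      fix x assume x: "x \<notin> N"
      have "(\<lambda>k. G k x) \<longlonglongrightarrow> g1 n x"
      proof (cases "\<bar>x\<bar> \<le> real n")
        case True
        have "isCont (closest_point C) (g1 n x)" using cC continuous_on_eq_continuous_at by blast
        then have "(\<lambda>k. q k x) \<longlonglongrightarrow> closest_point C (g1 n x)"
          unfolding q_def by (rule isCont_tendsto_compose) (rule l[OF x])
        moreover have "closest_point C (g1 n x) = g1 n x"
          by (rule closest_point_self) (auto simp: C_def g1_def)
        ultimately show ?thesis using True by (simp add: G_def)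
      qed (simp add: G_def g1_def)
      then have "(\<lambda>k. (norm (G k x - g1 n x))\<^sup>2) \<longlonglongrightarrow> (norm (g1 n x - g1 n x))\<^sup>2" by (intro tendsto_intros)
      then show "(\<lambda>k. ennreal ((norm (G k x - g1 n x))\<^sup>2)) \<longlonglongrightarrow> 0" using tendsto_ennrealI by fastforce
    qed
    have "(\<integral>\<^sup>+x. ennreal ((2 * real n)\<^sup>2) * indicator {-real n..real n} x \<partial>lebesgue)
        = ennreal ((2 * real n)\<^sup>2) * emeasure lebesgue {-real n..real n}"
      by (rule nn_integral_cmult_indicator) simp
    also have "\<dots> < \<infinity>" by (simp add: ennreal_mult_less_top)
    finally show "(\<integral>\<^sup>+x. ennreal ((2 * real n)\<^sup>2) * indicator {-real n..real n} x \<partial>lebesgue) < \<infinity>" .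
    show "AE x in lebesgue. ennreal ((norm (G k x - g1 n x))\<^sup>2) \<le> ennreal ((2 * real n)\<^sup>2) * indicator {-real n..real n} x" for k
    proof (intro AE_I2)
      fix x
      have "norm (G k x) \<le> real n" "norm (g1 n x) \<le> real n" using qB by (auto simp: G_def g1_def)
      then have "norm (G k x - g1 n x) \<le> 2 * real n" using norm_triangle_ineq4[of "G k x" "g1 n x"] by linarith
      then have "ennreal ((norm (G k x - g1 n x))\<^sup>2) \<le> ennreal ((2 * real n)\<^sup>2)" by (intro ennreal_leI power_mono) auto
      then show "ennreal ((norm (G k x - g1 n x))\<^sup>2) \<le> ennreal ((2 * real n)\<^sup>2) * indicator {-real n..real n} x"
        by (cases "\<bar>x\<bar> \<le> real n") (auto simp: indicator_def G_def g1_def)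
    qed
  qed measurable
  then have "eventually (\<lambda>k. energy (\<lambda>x. G k x - g1 n x) < e4) sequentially"
    unfolding energy_lebesgue using e4(1) by (intro order_tendstoD(2)) simp_all
  then obtain k where k: "energy (\<lambda>x. G k x - g1 n x) < e4" unfolding eventually_sequentially by blast
  have "energy (\<lambda>x. G k x - g x) \<le> 2 * energy (\<lambda>x. G k x - g1 n x) + 2 * energy (\<lambda>x. g x - g1 n x)"
    by (rule energy_triangle) measurable
  also have "\<dots> \<le> 2 * e4 + 2 * e4"
    using k n energy_commute[of g "g1 n"] by (intro add_mono mult_left_mono) auto
  also have "\<dots> < e" by (rule e4(2))
  finally show thesis by (rule that[OF nG])
qed

text \<open>
From \<open>d k = (1/2)^k (2^k d k)\<close> and \<open>2 x y \<le> x\<^sup>2 + y\<^sup>2\<close>.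
\<close>

lemma summable_if_weighted_squares:
  fixes d :: "nat \<Rightarrow> real"
  assumes "summable (\<lambda>k. 4 ^ k * (d k)\<^sup>2)" and d: "\<And>k. d k \<ge> 0"
  shows "summable d"
proof (rule summable_comparison_test')
  have "summable (\<lambda>k. (1 / 4) ^ k :: real)" by (rule summable_geometric) simp
  then show "summable (\<lambda>k. (1 / 4) ^ k + 4 ^ k * (d k)\<^sup>2)" by (intro summable_add assms)
  fix k :: nat
  have "d k = ((1 / 2) ^ k) * (2 ^ k * d k)" by (simp add: power_one_over)
  also have "2 * \<dots> \<le> ((1 / 2) ^ k)\<^sup>2 + (2 ^ k * d k)\<^sup>2"
    using sum_squares_bound[of "(1 / 2) ^ k" "2 ^ k * d k"] by simp
  also have "\<dots> = (1 / 4) ^ k + 4 ^ k * (d k)\<^sup>2"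
    by (simp add: power_mult_distrib power2_eq_square flip: power_mult_distrib)
  finally show "norm (d k) \<le> (1 / 4) ^ k + 4 ^ k * (d k)\<^sup>2" using d[of k] by simp
qed

text \<open>
The completeness of \<open>L\<^sup>2\<close> for rapidly converging sequences, which have a pointwise limit almost everywhere; Fatou's
lemma passes the estimate to it.
\<close>

lemma energy_limit:
  fixes \<phi> :: "nat \<Rightarrow> real \<Rightarrow> complex"
  assumes m: "\<And>k. \<phi> k \<in> borel_measurable borel" and A: "A \<ge> 0"
    and c: "\<And>k m. k \<le> m \<Longrightarrow> energy (\<lambda>\<xi>. \<phi> k \<xi> - \<phi> m \<xi>) \<le> ennreal (A * (1 / 8) ^ k)"
  obtains h where "h \<in> borel_measurable borel" "\<And>k. energy (\<lambda>\<xi>. \<phi> k \<xi> - h \<xi>) \<le> ennreal (A * (1 / 8) ^ k)"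
proof -
  note [measurable] = m
  define d where "d k \<xi> = norm (\<phi> k \<xi> - \<phi> (Suc k) \<xi>)" for k \<xi>
  have [measurable]: "d k \<in> borel_measurable borel" for k unfolding d_def by measurable
  have "(\<integral>\<^sup>+\<xi>. (\<Sum>k. ennreal (4 ^ k * (d k \<xi>)\<^sup>2)) \<partial>lborel) = (\<Sum>k. \<integral>\<^sup>+\<xi>. ennreal (4 ^ k * (d k \<xi>)\<^sup>2) \<partial>lborel)"
    by (rule nn_integral_suminf) measurable
  also have "\<dots> \<le> (\<Sum>k. ennreal (A * (1 / 2) ^ k))"
  proof (rule suminf_le)
    fix k
    have "(\<integral>\<^sup>+\<xi>. ennreal (4 ^ k * (d k \<xi>)\<^sup>2) \<partial>lborel) = ennreal (4 ^ k) * energy (\<lambda>\<xi>. \<phi> k \<xi> - \<phi> (Suc k) \<xi>)"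
      unfolding energy_def d_def by (subst nn_integral_cmult[symmetric]) (auto simp: ennreal_mult')
    also have "\<dots> \<le> ennreal (4 ^ k) * ennreal (A * (1 / 8) ^ k)" by (intro mult_left_mono c) auto
    also have "\<dots> = ennreal (A * (1 / 2) ^ k)"
    proof -
      have "(4::real) ^ k * (1 / 8) ^ k = (1 / 2) ^ k" by (simp flip: power_mult_distrib)
      then have "(4::real) ^ k * (A * (1 / 8) ^ k) = A * (1 / 2) ^ k" by (simp add: mult.left_commute)
      then show ?thesis by (simp only: ennreal_mult'[OF zero_le_power[OF zero_le_numeral], symmetric])
    qed
    finally show "(\<integral>\<^sup>+\<xi>. ennreal (4 ^ k * (d k \<xi>)\<^sup>2) \<partial>lborel) \<le> ennreal (A * (1 / 2) ^ k)" .
  qed auto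
  also have "\<dots> < \<infinity>"
  proof -
    have "summable (\<lambda>k. A * (1 / 2) ^ k)" by (intro summable_mult summable_geometric) simp
    then show ?thesis using A by (subst suminf_ennreal2) auto
  qed
  finally have "AE \<xi> in lborel. (\<Sum>k. ennreal (4 ^ k * (d k \<xi>)\<^sup>2)) \<noteq> \<infinity>"
    by (intro nn_integral_noteq_infinite) auto
  then have conv: "AE \<xi> in lborel. convergent (\<lambda>k. \<phi> k \<xi>)"
  proof eventually_elim
    fix \<xi> assume "(\<Sum>k. ennreal (4 ^ k * (d k \<xi>)\<^sup>2)) \<noteq> \<infinity>"
    then have "summable (\<lambda>k. 4 ^ k * (d k \<xi>)\<^sup>2)" by (intro summable_suminf_not_top) auto
    then have "summable (\<lambda>k. d k \<xi>)" by (rule summable_if_weighted_squares) (simp add: d_def)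
    then have "summable (\<lambda>k. norm (\<phi> (Suc k) \<xi> - \<phi> k \<xi>))"
      unfolding d_def norm_minus_commute[of "\<phi> (Suc _) \<xi>"] .
    then have "summable (\<lambda>k. \<phi> (Suc k) \<xi> - \<phi> k \<xi>)" by (rule summable_norm_cancel)
    then have "convergent (\<lambda>n. \<Sum>k<n. \<phi> (Suc k) \<xi> - \<phi> k \<xi>)" by (rule summable_iff_convergent[THEN iffD1])
    then have "convergent (\<lambda>n. \<phi> n \<xi> - \<phi> 0 \<xi>)" using sum_lessThan_telescope[of "\<lambda>n. \<phi> n \<xi>"] by simp
    then have "convergent (\<lambda>n. (\<phi> n \<xi> - \<phi> 0 \<xi>) + \<phi> 0 \<xi>)" by (rule convergent_add[OF _ convergent_const])
    then show "convergent (\<lambda>k. \<phi> k \<xi>)" by simp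
  qed
  define h where "h \<xi> = lim (\<lambda>k. \<phi> k \<xi>)" for \<xi>
  have hm[measurable]: "h \<in> borel_measurable borel" unfolding h_def by measurable
  have "energy (\<lambda>\<xi>. \<phi> k \<xi> - h \<xi>) \<le> ennreal (A * (1 / 8) ^ k)" for k
  proof -
    have "energy (\<lambda>\<xi>. \<phi> k \<xi> - h \<xi>) = (\<integral>\<^sup>+\<xi>. liminf (\<lambda>m. ennreal ((norm (\<phi> k \<xi> - \<phi> m \<xi>))\<^sup>2)) \<partial>lborel)"
      unfolding energy_def
    proof (rule nn_integral_cong_AE, use conv in eventually_elim)
      fix \<xi> assume "convergent (\<lambda>k. \<phi> k \<xi>)"
      then have "(\<lambda>m. \<phi> m \<xi>) \<longlonglongrightarrow> h \<xi>" unfolding h_def by (simp add: convergent_LIMSEQ_iff)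
      then have "(\<lambda>m. ennreal ((norm (\<phi> k \<xi> - \<phi> m \<xi>))\<^sup>2)) \<longlonglongrightarrow> ennreal ((norm (\<phi> k \<xi> - h \<xi>))\<^sup>2)"
        by (intro tendsto_ennrealI tendsto_intros)
      then show "ennreal ((norm (\<phi> k \<xi> - h \<xi>))\<^sup>2) = liminf (\<lambda>m. ennreal ((norm (\<phi> k \<xi> - \<phi> m \<xi>))\<^sup>2))"
        by (intro lim_imp_Liminf[symmetric]) auto
    qed
    also have "\<dots> \<le> liminf (\<lambda>m. energy (\<lambda>\<xi>. \<phi> k \<xi> - \<phi> m \<xi>))"
      unfolding energy_def by (rule nn_integral_liminf) measurable
    also have "\<dots> \<le> ennreal (A * (1 / 8) ^ k)"
      by (intro Liminf_le) (auto simp: eventually_sequentially intro!: exI[of _ k] c)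
    finally show ?thesis .
  qed
  then show thesis by (rule that[OF hm])
qed

lemma is_fourier_L2_exists:
  assumes g: "in_L2 g"
  shows "\<exists>h. is_fourier_L2 g h"
proof -
  have gm: "g \<in> borel_measurable lebesgue" using g by (simp add: in_L2_iff)
  have "\<exists>G. cut_continuous G \<and> energy (\<lambda>x. G x - g x) < ennreal ((1 / 8) ^ k)" for k :: nat
    by (rule cut_continuous_dense[OF g, of "ennreal ((1 / 8) ^ k)"]) auto
  then obtain G where G: "\<And>k. cut_continuous (G k)" "\<And>k. energy (\<lambda>x. G k x - g x) < ennreal ((1 / 8) ^ k)"
    by metis
  note nG = cut_continuous_facts[OF G(1)]
  have Gm: "G k \<in> borel_measurable lebesgue" for k using nG(3) by (rule borel_measurable_lebesgueI)
  define \<phi> where "\<phi> k = fourier_L1 (G k)" for k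
  have pm: "\<phi> k \<in> borel_measurable borel" for k unfolding \<phi>_def by (rule borel_measurable_fourier_L1[OF nG(1)])
  have cauchy: "energy (\<lambda>\<xi>. \<phi> k \<xi> - \<phi> m \<xi>) \<le> ennreal (8 * pi * (1 / 8) ^ k)" if km: "k \<le> m" for k m
  proof -
    have "energy (\<lambda>\<xi>. \<phi> k \<xi> - \<phi> m \<xi>) \<le> ennreal (2 * pi) * energy (\<lambda>x. G k x - G m x)"
      unfolding \<phi>_def by (rule energy_fourier_L1_diff_le[OF nG(1) nG(1)])
    also have "\<dots> \<le> ennreal (2 * pi) * (2 * energy (\<lambda>x. G k x - g x) + 2 * energy (\<lambda>x. G m x - g x))"
      by (intro mult_left_mono energy_triangle Gm gm) auto
    also have "\<dots> \<le> ennreal (2 * pi) * (2 * ennreal ((1 / 8) ^ k) + 2 * ennreal ((1 / 8) ^ k))"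
    proof (intro mult_left_mono add_mono)
      show "energy (\<lambda>x. G k x - g x) \<le> ennreal ((1 / 8) ^ k)" using G(2) by (rule less_imp_le)
      have "energy (\<lambda>x. G m x - g x) \<le> ennreal ((1 / 8) ^ m)" using G(2) by (rule less_imp_le)
      also have "\<dots> \<le> ennreal ((1 / 8) ^ k)" by (intro ennreal_leI power_decreasing km) auto
      finally show "energy (\<lambda>x. G m x - g x) \<le> ennreal ((1 / 8) ^ k)" .
    qed auto
    also have "2 * ennreal ((1 / 8) ^ k) + 2 * ennreal ((1 / 8) ^ k) = ennreal (4 * (1 / 8) ^ k)"
    proof -
      have "2 * ennreal a + 2 * ennreal a = ennreal (4 * a)" if "a \<ge> 0" for a
        using that by (simp add: ennreal_mult' flip: distrib_right)
      then show ?thesis by simp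
    qed
    also have "ennreal (2 * pi) * \<dots> = ennreal (8 * pi * (1 / 8) ^ k)"
      by (subst ennreal_mult'[symmetric]) auto
    finally show ?thesis .
  qed
  obtain h where h: "h \<in> borel_measurable borel" "\<And>k. energy (\<lambda>\<xi>. \<phi> k \<xi> - h \<xi>) \<le> ennreal (8 * pi * (1 / 8) ^ k)"
    by (rule energy_limit[of \<phi> "8 * pi", OF pm _ cauchy]) (simp, assumption+, blast)
  have lim0: "(\<lambda>k. ennreal (c * (1 / 8) ^ k)) \<longlonglongrightarrow> 0" for c
  proof -
    have "(\<lambda>k. c * (1 / 8 :: real) ^ k) \<longlonglongrightarrow> c * 0" by (intro tendsto_intros LIMSEQ_power_zero) simp
    then show ?thesis using tendsto_ennrealI by fastforce
  qed
  have hE: "energy h < top"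
  proof -
    have "energy h \<le> 2 * energy (\<lambda>\<xi>. h \<xi> - \<phi> 0 \<xi>) + 2 * energy (\<phi> 0)"
      by (intro energy_add_le borel_measurable_lebesgueI h pm)
    moreover have "energy (\<lambda>\<xi>. h \<xi> - \<phi> 0 \<xi>) < top"
      using h(2)[of 0] unfolding energy_commute[of h] by (rule le_less_trans) simp
    moreover have "energy (\<phi> 0) < top"
      using energy_fourier_L1_le[OF nG(1)[of 0]] nG(2)[of 0] unfolding \<phi>_def in_L2_iff
      by (auto intro: le_less_trans simp: ennreal_mult_less_top)
    ultimately show ?thesis by (auto intro: le_less_trans simp: ennreal_mult_less_top)
  qed
  have "is_fourier_L2 g h"
    unfolding is_fourier_L2_def L2_norm_tendsto_0_iff
  proof (intro conjI exI[of _ G] allI)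
    show "in_L2 g" by fact
    show "in_L2 h" unfolding in_L2_iff using h(1) hE by (auto intro: borel_measurable_lebesgueI)
    show "integrable lebesgue (G k)" "in_L2 (G k)" for k by (fact nG(1), fact nG(2))
    show "(\<lambda>n. energy (\<lambda>x. G n x - g x)) \<longlonglongrightarrow> 0"
      by (rule tendsto_sandwich[OF _ _ tendsto_const lim0[of 1]]) (use G(2) in \<open>auto intro!: always_eventually less_imp_le\<close>)
    show "(\<lambda>n. energy (\<lambda>\<xi>. fourier_L1 (G n) \<xi> - h \<xi>)) \<longlonglongrightarrow> 0"
      by (rule tendsto_sandwich[OF _ _ tendsto_const lim0[of "8 * pi"]]) (use h(2) in \<open>auto intro!: always_eventually simp: \<phi>_def\<close>)
  qed
  then show ?thesis by blast
qed

text \<open>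
The approximating functions in the definition need not belong to the dense class for which the lower Plancherel
bound is known.  The upper bound compares their transforms with that of a member of the class close to \<open>g\<close>.  The
constant \<open>2\<close> in place of \<open>1 / (2 \<pi>)\<close> leaves room for the losses in the quasi-triangle inequality.
\<close>

lemma is_fourier_L2_lower:
  assumes gh: "is_fourier_L2 g h"
  shows "energy g \<le> 2 * energy h"
proof (rule ennreal_le_epsilon)
  have g: "in_L2 g" and h: "in_L2 h" using gh by (auto simp: is_fourier_L2_def)
  have gm: "g \<in> borel_measurable lebesgue" and hm: "h \<in> borel_measurable lebesgue"
    and gE: "energy g < top" and hE: "energy h < top"
    using g h by (auto simp: in_L2_iff)
  obtain F where F: "\<And>n. integrable lebesgue (F n)" "\<And>n. in_L2 (F n)"
    and l: "(\<lambda>n. energy (\<lambda>x. F n x - g x)) \<longlonglongrightarrow> 0" "(\<lambda>n. energy (\<lambda>\<xi>. fourier_L1 (F n) \<xi> - h \<xi>)) \<longlonglongrightarrow> 0"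
    using gh unfolding is_fourier_L2_def L2_norm_tendsto_0_iff by blast
  fix \<epsilon>' :: real assume e': "\<epsilon>' > 0"
  \<comment> \<open>The approximation errors collected below add up to less than \<open>20 \<epsilon>\<close>.\<close>
  define \<epsilon> where "\<epsilon> = \<epsilon>' / 100"
  have e: "0 < ennreal \<epsilon>" "\<epsilon> > 0" using e' by (auto simp: \<epsilon>_def)
  obtain G where G: "cut_continuous G" "energy (\<lambda>x. G x - g x) < ennreal \<epsilon>" by (rule cut_continuous_dense[OF g e(1)])
  note nG = cut_continuous_facts[OF G(1)]
  have "eventually (\<lambda>n. energy (\<lambda>x. F n x - g x) < ennreal \<epsilon> \<and> energy (\<lambda>\<xi>. fourier_L1 (F n) \<xi> - h \<xi>) < ennreal \<epsilon>) sequentially"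
    by (intro eventually_conj order_tendstoD(2)[OF l(1)] order_tendstoD(2)[OF l(2)] e(1))
  then obtain n where n: "energy (\<lambda>x. F n x - g x) < ennreal \<epsilon>" "energy (\<lambda>\<xi>. fourier_L1 (F n) \<xi> - h \<xi>) < ennreal \<epsilon>"
    unfolding eventually_sequentially by blast
  have Gm: "G \<in> borel_measurable lebesgue" using nG(2) by (simp add: in_L2_iff)
  have Fm: "F n \<in> borel_measurable lebesgue" using F(2) by (simp add: in_L2_iff)
  have pG: "fourier_L1 G \<in> borel_measurable lebesgue"
    by (intro borel_measurable_lebesgueI borel_measurable_fourier_L1 nG)
  have pF: "fourier_L1 (F n) \<in> borel_measurable lebesgue"
    by (intro borel_measurable_lebesgueI borel_measurable_fourier_L1 F)
  have fin: "energy G < top" "energy (\<lambda>x. G x - F n x) < top" "energy (fourier_L1 (F n)) < top"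
  proof -
    show EG: "energy G < top" using nG(2) by (simp add: in_L2_iff)
    have EF: "energy (F n) < top" using F(2) by (simp add: in_L2_iff)
    show "energy (\<lambda>x. G x - F n x) < top"
      using energy_triangle[OF Gm Fm, of "\<lambda>_. 0"] EG EF
      by (auto intro: le_less_trans simp: ennreal_mult_less_top)
    show "energy (fourier_L1 (F n)) < top"
      using energy_fourier_L1_le[OF F(1)[of n]] EF
      by (auto intro: le_less_trans simp: ennreal_mult_less_top)
  qed
  note r1 = energy_add_le[OF gm Gm, unfolded energy_commute[of g G]]
  note r2 = nG(4)
  note r3 = energy_add_le[OF pG pF]
  note r4 = energy_fourier_L1_diff_le[OF nG(1) F(1)[of n]]
  note r5 = energy_triangle[OF Gm Fm gm]
  note r6 = energy_add_le[OF pF hm]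
  have conv: "\<exists>r\<ge>0. x = ennreal r" if "x < top" for x :: ennreal
    using that by (cases x) auto
  obtain a where a: "a \<ge> 0" "energy g = ennreal a" using conv[OF gE] by blast
  obtain b where b: "b \<ge> 0" "energy h = ennreal b" using conv[OF hE] by blast
  obtain c where c: "c \<ge> 0" "energy G = ennreal c" using conv[OF fin(1)] by blast
  obtain d where d: "d \<ge> 0" "energy (\<lambda>x. G x - F n x) = ennreal d" using conv[OF fin(2)] by blast
  obtain p where p: "p \<ge> 0" "energy (fourier_L1 (F n)) = ennreal p" using conv[OF fin(3)] by blast
  obtain u where u: "u \<ge> 0" "energy (\<lambda>x. G x - g x) = ennreal u" using conv[OF order.strict_trans[OF G(2) ennreal_less_top]] by blast
  obtain v where v: "v \<ge> 0" "energy (\<lambda>x. F n x - g x) = ennreal v" using conv[OF order.strict_trans[OF n(1) ennreal_less_top]] by blast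
  obtain w where w: "w \<ge> 0" "energy (\<lambda>\<xi>. fourier_L1 (F n) \<xi> - h \<xi>) = ennreal w" using conv[OF order.strict_trans[OF n(2) ennreal_less_top]] by blast
  have small: "u < \<epsilon>" "v < \<epsilon>" "w < \<epsilon>" using G(2) n u v w by (auto simp: ennreal_less_iff)
  have two: "2 * ennreal x + 2 * ennreal y = ennreal (2 * x + 2 * y)" if "x \<ge> 0" "y \<ge> 0" for x y
    using that by (simp add: ennreal_mult')
  have q1: "a \<le> 2 * u + 2 * c" using r1 unfolding a(2) u(2) c(2) two[OF u(1) c(1)]
    using u(1) c(1) by (subst (asm) ennreal_le_iff) auto
  have q5: "d \<le> 2 * u + 2 * v" using r5 unfolding d(2) u(2) v(2) two[OF u(1) v(1)]
    using u(1) v(1) by (subst (asm) ennreal_le_iff) auto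
  have q6: "p \<le> 2 * w + 2 * b" using r6 unfolding p(2) w(2) b(2) two[OF w(1) b(1)]
    using w(1) b(1) by (subst (asm) ennreal_le_iff) auto
  have q3: "2 * pi * c \<le> 2 * (2 * pi * d) + 2 * p"
  proof -
    have "ennreal (2 * pi) * ennreal c \<le> energy (fourier_L1 G)" using r2 unfolding c .
    also have "\<dots> \<le> 2 * energy (\<lambda>\<xi>. fourier_L1 G \<xi> - fourier_L1 (F n) \<xi>) + 2 * energy (fourier_L1 (F n))" by (rule r3)
    also have "\<dots> \<le> 2 * (ennreal (2 * pi) * ennreal d) + 2 * ennreal p"
      using r4 unfolding d p by (intro add_mono mult_left_mono) auto
    also have "ennreal (2 * pi) * ennreal d = ennreal (2 * pi * d)" by (rule ennreal_mult'[symmetric]) simp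
    also have "2 * \<dots> + 2 * ennreal p = ennreal (2 * (2 * pi * d) + 2 * p)" using d p by (intro two) auto
    also have "ennreal (2 * pi) * ennreal c = ennreal (2 * pi * c)" by (rule ennreal_mult'[symmetric]) simp
    finally show ?thesis using d p by (subst (asm) ennreal_le_iff) auto
  qed
  have "2 * pi * c \<le> 2 * pi * (2 * d) + 2 * pi * (p / 3)"
  proof -
    have "6 * (p / 3) \<le> 2 * pi * (p / 3)" using pi_gt3 p by (intro mult_right_mono) auto
    then show ?thesis using q3 by simp
  qed
  then have "2 * pi * c \<le> 2 * pi * (2 * d + p / 3)" by (simp add: distrib_left)
  then have "c \<le> 2 * d + p / 3" by (simp only: mult_le_cancel_left_pos[of "2 * pi"] pi_gt_zero zero_less_mult_iff zero_less_numeral simp_thms)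
  then have "a \<le> 2 * b + \<epsilon>'" using q1 q5 q6 small b(1) e' unfolding \<epsilon>_def by linarith
  then show "energy g \<le> 2 * energy h + ennreal \<epsilon>'"
  proof -
    have "ennreal a \<le> ennreal (2 * b + \<epsilon>')" by (rule ennreal_leI) fact
    also have "\<dots> = 2 * ennreal b + ennreal \<epsilon>'" using b(1) e' by (simp add: ennreal_mult')
    finally show ?thesis unfolding a b .
  qed
qed

text \<open>
Here \<open>80\<close> bounds \<open>2 \<cdot> (2 \<pi>)\<^sup>2\<close>.
\<close>

lemma energy_le_inv_fourier:
  assumes g: "in_L2 g"
  shows "energy g \<le> 80 * energy (inv_fourier g)"
proof -
  have "is_fourier_L2 g (fourier g)"
    unfolding fourier_def using is_fourier_L2_exists[OF g] by (rule someI_ex)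
  then have le: "energy g \<le> 2 * energy (fourier g)" and h: "in_L2 (fourier g)"
    using is_fourier_L2_lower by (auto simp: is_fourier_L2_def)
  have hm[measurable]: "fourier g \<in> borel_measurable lebesgue" using h by (simp add: in_L2_iff)
  have "energy (fourier g) = (\<integral>\<^sup>+x. ennreal ((norm (fourier g (- x)))\<^sup>2) \<partial>lebesgue)"
    unfolding energy_lebesgue
    using nn_integral_real_affine_lebesgue[of "\<lambda>x. ennreal ((norm (fourier g x))\<^sup>2)" "-1" 0] by simp
  also have "\<dots> \<le> (\<integral>\<^sup>+x. ennreal 40 * ennreal ((norm (inv_fourier g x))\<^sup>2) \<partial>lebesgue)"
  proof (rule nn_integral_mono)
    fix x
    have "pi\<^sup>2 \<le> 10" using power_mono[of pi "3.1416" 2] pi_approx pi_ge_zero by (simp add: power2_eq_square)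
    then have "4 * pi\<^sup>2 * (norm (inv_fourier g x))\<^sup>2 \<le> 40 * (norm (inv_fourier g x))\<^sup>2" by (intro mult_right_mono) auto
    moreover have "4 * pi\<^sup>2 * (norm (inv_fourier g x))\<^sup>2 = (norm (fourier g (- x)))\<^sup>2"
      by (simp add: inv_fourier_def norm_divide power_divide norm_mult power_mult_distrib)
    ultimately have "ennreal ((norm (fourier g (- x)))\<^sup>2) \<le> ennreal (40 * (norm (inv_fourier g x))\<^sup>2)"
      by (intro ennreal_leI) linarith
    also have "\<dots> = ennreal 40 * ennreal ((norm (inv_fourier g x))\<^sup>2)" by (rule ennreal_mult') simp
    finally show "ennreal ((norm (fourier g (- x)))\<^sup>2) \<le> ennreal 40 * ennreal ((norm (inv_fourier g x))\<^sup>2)" .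
  qed
  also have "\<dots> = ennreal 40 * energy (inv_fourier g)"
  proof -
    have "(\<lambda>x. fourier g (- x)) \<in> borel_measurable lebesgue"
      using measurable_compose[OF lebesgue_measurable_scaling[of "-1 :: real"] hm] by simp
    then have "inv_fourier g \<in> borel_measurable lebesgue" unfolding inv_fourier_def by measurable
    then show ?thesis unfolding energy_lebesgue by (intro nn_integral_cmult) measurable
  qed
  finally have "energy g \<le> 2 * (ennreal 40 * energy (inv_fourier g))"
    using le by (meson mult_left_mono order_trans zero_le)
  also have "\<dots> = 80 * energy (inv_fourier g)" by (simp add: mult.assoc[symmetric])
  finally show ?thesis .
qed

section \<open>Covering numbers\<close>

lemma bounded_symmetric_interval:
  fixes S :: "real set"
  assumes "bounded S"
  obtains M where "M > 0" "S \<subseteq> {-M..M}"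
proof -
  obtain M where M: "M > 0" "\<forall>x\<in>S. \<bar>x\<bar> \<le> M"
    using assms unfolding bounded_pos real_norm_def by blast
  then have "S \<subseteq> {-M..M}" by (auto simp: abs_le_iff)
  then show thesis by (rule that[OF M(1)])
qed

text \<open>
An equally spaced grid covers a bounded set.  Its size gives the crude bound \<open>O(1/\<delta>)\<close> on the covering number,
which shows that the set of exponents in the definition of the Minkowski dimension is not empty.
\<close>

lemma covering_number_witness:
  assumes "bounded \<Theta>" "\<delta> > 0"
  shows "\<exists>A. finite A \<and> card A = covering_number \<Theta> \<delta> \<and> \<Theta> \<subseteq> (\<Union>a\<in>A. {a..a + \<delta>})"
    and "\<Theta> \<subseteq> {-M..M} \<Longrightarrow> M > 0 \<Longrightarrow> real (covering_number \<Theta> \<delta>) \<le> 2 * M / \<delta> + 2"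
proof -
  define P where "P n \<longleftrightarrow> (\<exists>A. finite A \<and> card A = n \<and> \<Theta> \<subseteq> (\<Union>a\<in>A. {a..a + \<delta>}))" for n
  have cov: "covering_number \<Theta> \<delta> = (LEAST n. P n)" unfolding covering_number_def P_def ..
  have grid: "\<exists>n. P n \<and> real n \<le> 2 * M / \<delta> + 2" if M: "\<Theta> \<subseteq> {-M..M}" "M > 0" for M
  proof -
    define m where "m = nat \<lfloor>2 * M / \<delta>\<rfloor>"
    define A where "A = (\<lambda>i. - M + real i * \<delta>) ` {..m}"
    have "\<Theta> \<subseteq> (\<Union>a\<in>A. {a..a + \<delta>})"
    proof
      fix x assume "x \<in> \<Theta>"
      then have x: "-M \<le> x" "x \<le> M" using M by auto
      define i where "i = nat \<lfloor>(x + M) / \<delta>\<rfloor>"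
      have i0: "\<lfloor>(x + M) / \<delta>\<rfloor> \<ge> 0" using x assms by simp
      have "\<lfloor>(x + M) / \<delta>\<rfloor> \<le> \<lfloor>2 * M / \<delta>\<rfloor>"
        using x assms by (intro floor_mono divide_right_mono) auto
      then have im: "i \<le> m" unfolding i_def m_def by (rule nat_mono)
      have "real i = of_int \<lfloor>(x + M) / \<delta>\<rfloor>" unfolding i_def using i0 by simp
      then have "real i \<le> (x + M) / \<delta>" "(x + M) / \<delta> \<le> real i + 1" by linarith+
      then have "real i * \<delta> \<le> x + M" "x + M \<le> (real i + 1) * \<delta>" using assms(2)
        by (simp_all add: pos_le_divide_eq pos_divide_le_eq)
      then have "x \<in> {- M + real i * \<delta>..- M + real i * \<delta> + \<delta>}" by (simp add: algebra_simps)
      then show "x \<in> (\<Union>a\<in>A. {a..a + \<delta>})" using im unfolding A_def by blast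
    qed
    moreover have "finite A" by (simp add: A_def)
    moreover have "real (card A) \<le> 2 * M / \<delta> + 2"
    proof -
      have "card A \<le> Suc m" unfolding A_def using card_image_le[of "{..m}"] by simp
      moreover have "real m \<le> 2 * M / \<delta>" unfolding m_def using M assms by simp
      ultimately show ?thesis by linarith
    qed
    ultimately show ?thesis unfolding P_def by blast
  qed
  obtain M where M: "M > 0" "\<Theta> \<subseteq> {-M..M}"
    by (rule bounded_symmetric_interval[OF assms(1)])
  obtain n where "P n" using grid[OF M(2,1)] by blast
  then have "P (covering_number \<Theta> \<delta>)" unfolding cov by (rule LeastI)
  then show "\<exists>A. finite A \<and> card A = covering_number \<Theta> \<delta> \<and> \<Theta> \<subseteq> (\<Union>a\<in>A. {a..a + \<delta>})"
    unfolding P_def .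
  show "real (covering_number \<Theta> \<delta>) \<le> 2 * M / \<delta> + 2" if M: "\<Theta> \<subseteq> {-M..M}" "M > 0" for M
  proof -
    obtain n where n: "P n" "real n \<le> 2 * M / \<delta> + 2" using grid[OF M] by blast
    have "covering_number \<Theta> \<delta> \<le> n" unfolding cov by (rule Least_le) (rule n(1))
    then show ?thesis using n(2) by linarith
  qed
qed

lemma minkowski_exponent_exists:
  assumes "bounded \<Theta>" and d: "upper_minkowski_dim \<Theta> < d"
  obtains r where "0 < r" "r < d" "Limsup (at_right 0) (\<lambda>\<delta>. ereal (real (covering_number \<Theta> \<delta>) * \<delta> powr r)) = 0"
proof -
  let ?S = "{r. 0 < r \<and> Limsup (at_right 0) (\<lambda>\<delta>. ereal (real (covering_number \<Theta> \<delta>) * \<delta> powr r)) = 0}"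
  obtain M where M: "M > 0" "\<Theta> \<subseteq> {-M..M}"
    by (rule bounded_symmetric_interval[OF assms(1)])
  have "2 \<in> ?S"
  proof -
    have "((\<lambda>\<delta>. 2 * M * \<delta> + 2 * \<delta>\<^sup>2) \<longlongrightarrow> 2 * M * 0 + 2 * 0\<^sup>2) (at_right 0)"
      by (intro tendsto_intros)
    moreover have ev: "eventually (\<lambda>\<delta>. real (covering_number \<Theta> \<delta>) * \<delta> powr 2 \<le> 2 * M * \<delta> + 2 * \<delta>\<^sup>2) (at_right 0)"
      using eventually_at_right_less[of "0::real"]
    proof eventually_elim
      case (elim \<delta>)
      have "real (covering_number \<Theta> \<delta>) * \<delta>\<^sup>2 \<le> (2 * M / \<delta> + 2) * \<delta>\<^sup>2"
        by (intro mult_right_mono covering_number_witness(2)[OF assms(1) elim M(2,1)]) auto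
      also have "\<dots> = 2 * M * \<delta> + 2 * \<delta>\<^sup>2" using elim by (simp add: power2_eq_square distrib_right)
      finally show ?case using elim by (simp add: powr_numeral)
    qed
    ultimately have "((\<lambda>\<delta>. real (covering_number \<Theta> \<delta>) * \<delta> powr 2) \<longlongrightarrow> 0) (at_right 0)"
      by (intro tendsto_sandwich[OF _ ev tendsto_const]) auto
    then have "((\<lambda>\<delta>. ereal (real (covering_number \<Theta> \<delta>) * \<delta> powr 2)) \<longlongrightarrow> 0) (at_right 0)"
      by (simp add: zero_ereal_def)
    then have "Limsup (at_right 0) (\<lambda>\<delta>. ereal (real (covering_number \<Theta> \<delta>) * \<delta> powr 2)) = 0"
      by (rule lim_imp_Limsup[rotated]) simp
    then show ?thesis by simp
  qed
  then have ne: "?S \<noteq> {}" by blast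
  have lt: "Inf ?S < d" using d by (simp add: upper_minkowski_dim_def)
  obtain r where "r \<in> ?S" "r < d" using cInf_lessD[OF ne lt] by blast
  then show thesis using that by blast
qed

text \<open>
Finitely many scales are not governed by the limit superior; they are absorbed in \<open>C\<close>.
\<close>

lemma dyadic_covers:
  assumes "bounded \<Theta>" and d: "upper_minkowski_dim \<Theta> < d"
  obtains r C where "0 < r" "r < d" "C \<ge> (0::real)"
    "\<And>k. \<exists>A. finite A \<and> \<Theta> \<subseteq> (\<Union>a\<in>A. {a..a + 1 / 2 ^ k}) \<and> real (card A) \<le> C * 2 powr (r * real k)"
proof -
  obtain r where r: "0 < r" "r < d" "Limsup (at_right 0) (\<lambda>\<delta>. ereal (real (covering_number \<Theta> \<delta>) * \<delta> powr r)) = 0"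
    by (rule minkowski_exponent_exists[OF assms])
  let ?N = "\<lambda>k::nat. covering_number \<Theta> (1 / 2 ^ k)"
  have "eventually (\<lambda>\<delta>. ereal (real (covering_number \<Theta> \<delta>) * \<delta> powr r) < 1) (at_right 0)"
    by (rule Limsup_lessD) (simp add: r(3))
  then have ev: "eventually (\<lambda>\<delta>. real (covering_number \<Theta> \<delta>) * \<delta> powr r < 1) (at_right 0)" by simp
  have fl: "filterlim (\<lambda>k. (1 / 2) ^ k :: real) (at_right 0) sequentially"
    by (intro filterlim_atI tendsto_imp_filterlim_at_right LIMSEQ_power_zero) auto
  have "eventually (\<lambda>k. real (?N k) * (1 / 2 ^ k) powr r < 1) sequentially"
    using eventually_compose_filterlim[OF ev fl] by (simp only: power_one_over)
  then obtain k0 where k0: "\<And>k. k \<ge> k0 \<Longrightarrow> real (?N k) * (1 / 2 ^ k) powr r < 1"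
    unfolding eventually_sequentially by blast
  define C where "C = 1 + (\<Sum>k<k0. real (?N k))"
  have C1: "C \<ge> 1" unfolding C_def by (simp add: sum_nonneg)
  have p: "(1 / 2 ^ k) powr r = 1 / 2 powr (r * real k)" for k :: nat
    by (simp add: powr_divide powr_powr mult.commute flip: powr_realpow)
  have NC: "real (?N k) \<le> C * 2 powr (r * real k)" for k
  proof (cases "k \<ge> k0")
    case True
    then have "real (?N k) \<le> 1 * 2 powr (r * real k)" using k0[OF True] unfolding p by (simp add: field_simps)
    also have "\<dots> \<le> C * 2 powr (r * real k)" by (intro mult_right_mono C1) auto
    finally show ?thesis .
  next
    case False
    then have "real (?N k) \<le> (\<Sum>k<k0. real (?N k))" by (intro member_le_sum) auto
    then have "real (?N k) \<le> C * 1" unfolding C_def by simp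
    also have "\<dots> \<le> C * 2 powr (r * real k)" using C1 r(1) by (intro mult_left_mono ge_one_powr_ge_zero) auto
    finally show ?thesis .
  qed
  show thesis
  proof (rule that[of r C])
    fix k
    obtain A where "finite A" "card A = ?N k" "\<Theta> \<subseteq> (\<Union>a\<in>A. {a..a + 1 / 2 ^ k})"
      using covering_number_witness(1)[OF assms(1), of "1 / 2 ^ k"] by auto
    then show "\<exists>A. finite A \<and> \<Theta> \<subseteq> (\<Union>a\<in>A. {a..a + 1 / 2 ^ k}) \<and> real (card A) \<le> C * 2 powr (r * real k)"
      using NC[of k] by auto
  qed (use r C1 in auto)
qed

section \<open>Maximal estimate on a dyadic shell\<close>

definition shell :: "nat \<Rightarrow> real set" where
  "shell j = (if j = 0 then {-1..1} else {\<xi>. 2 ^ (j - 1) < \<bar>\<xi>\<bar> \<and> \<bar>\<xi>\<bar> \<le> 2 ^ j})"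

lemma sets_shell [measurable]: "shell j \<in> sets borel"
proof -
  have "shell j = {-1..1} \<or> shell j = {\<xi> \<in> space borel. 2 ^ (j - 1) < \<bar>\<xi>\<bar> \<and> \<bar>\<xi>\<bar> \<le> 2 ^ j}"
    by (auto simp: shell_def)
  moreover have "{\<xi> \<in> space borel. (2::real) ^ (j - 1) < \<bar>\<xi>\<bar> \<and> \<bar>\<xi>\<bar> \<le> 2 ^ j} \<in> sets borel" by measurable
  ultimately show ?thesis by fastforce
qed

lemma shell_bounded: "shell j \<subseteq> {-(2 ^ j)..2 ^ j}"
  by (auto simp: shell_def abs_le_iff)

lemma sum_indicator_shell:
  "(\<Sum>j\<le>N. indicator (shell j) \<xi> :: real) = indicator {\<xi>. \<bar>\<xi>\<bar> \<le> 2 ^ N} \<xi>"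
proof (induction N)
  case (Suc N)
  have "(2::real) ^ N \<le> 2 ^ Suc N" by simp
  have "(\<Sum>j\<le>Suc N. indicator (shell j) \<xi> :: real)
      = indicator {\<xi>. \<bar>\<xi>\<bar> \<le> 2 ^ N} \<xi> + indicator (shell (Suc N)) \<xi>"
    by (simp only: sum.atMost_Suc Suc.IH)
  also have "\<dots> = indicator {\<xi>. \<bar>\<xi>\<bar> \<le> 2 ^ Suc N} \<xi>"
    using order_trans[OF _ \<open>(2::real) ^ N \<le> 2 ^ Suc N\<close>, of "\<bar>\<xi>\<bar>"] by (auto simp: shell_def indicator_def simp del: power_Suc)
  finally show ?case .
qed (auto simp: shell_def indicator_def abs_le_iff)

lemma arsinh_dyadic: "arsinh (2 * 2 ^ j :: real) \<le> 3 * (real j + 1)"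
proof -
  define R where "R = (2::real) ^ j"
  have R: "R \<ge> 1" unfolding R_def by simp
  have "(2 * R)\<^sup>2 + 1 \<le> (3 * R)\<^sup>2" using one_le_power[OF R, of 2] by (simp add: power_mult_distrib)
  then have "sqrt ((2 * R)\<^sup>2 + 1) \<le> 3 * R" using R by (intro real_le_lsqrt) auto
  then have "arsinh (2 * R) \<le> ln (5 * R)"
    unfolding arsinh_real_def using R arsinh_real_aux[of "2 * R"] by simp
  also have "\<dots> = ln 5 + real j * ln 2" using R unfolding R_def by (simp add: ln_mult ln_realpow)
  also have "ln (5::real) \<le> 3"
  proof -
    have "ln (5::real) \<le> ln (2 ^ 3)" by simp
    also have "\<dots> = 3 * ln 2" by (subst ln_realpow) auto
    also have "\<dots> \<le> 3" using ln_2_less_1 by simp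
    finally show ?thesis .
  qed
  also have "real j * ln 2 \<le> real j * 1" using ln_2_less_1 by (intro mult_left_mono) auto
  finally show ?thesis unfolding R_def by simp
qed

lemma osc_integral_add:
  assumes [measurable]: "\<Phi> \<in> borel_measurable borel" and g: "integrable lborel g" and h: "integrable lborel h"
  shows "osc_integral \<Phi> (\<lambda>\<xi>. g \<xi> + h \<xi>) t y = osc_integral \<Phi> g t y + osc_integral \<Phi> h t y"
proof -
  have "integrable lborel (\<lambda>\<xi>. cis (y * \<xi> + t * \<Phi> \<xi>) * h \<xi>)" if h: "integrable lborel h" for h
    by (rule Bochner_Integration.integrable_bound[OF h])
       (use borel_measurable_integrable[OF h] in \<open>auto simp: norm_mult\<close>)
  from Bochner_Integration.integral_add[OF this[OF g] this[OF h]]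
  show ?thesis unfolding osc_integral_def by (simp add: distrib_left)
qed

lemma norm_osc_integral_le: "norm (osc_integral \<Phi> h t y) \<le> (LINT \<xi>|lborel. norm (h \<xi>))"
  unfolding osc_integral_def by (rule order_trans[OF integral_norm_bound]) (simp add: norm_mult)

lemma fourth_power_add_le: "norm (a + b) ^ 4 \<le> 8 * (norm a ^ 4 + norm (b::complex) ^ 4)"
proof -
  have sq: "(x + y)\<^sup>2 \<le> 2 * (x\<^sup>2 + y\<^sup>2)" for x y :: real
    using sum_squares_bound[of x y] by (simp add: power2_sum)
  have "norm (a + b) ^ 4 \<le> (norm a + norm b) ^ 4" by (intro power_mono norm_triangle_ineq) auto
  also have "\<dots> = ((norm a + norm b)\<^sup>2)\<^sup>2" by simp
  also have "\<dots> \<le> (2 * ((norm a)\<^sup>2 + (norm b)\<^sup>2))\<^sup>2" by (intro power_mono sq) auto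
  also have "\<dots> = 4 * ((norm a)\<^sup>2 + (norm b)\<^sup>2)\<^sup>2" by (simp only: power_mult_distrib) simp
  also have "\<dots> \<le> 4 * (2 * (((norm a)\<^sup>2)\<^sup>2 + ((norm b)\<^sup>2)\<^sup>2))" by (intro mult_left_mono sq) auto
  finally show ?thesis by simp
qed

text \<open>
On a shell of radius \<open>2^j\<close> with \<open>j \<ge> 1\<close> the positive and the negative frequencies are treated separately, as
\<open>\<Phi>''\<close> may have different signs there.  For \<open>j = 0\<close> nothing is assumed about the phase, and the solution is
bounded by the \<open>L\<^sup>1\<close> norm of \<open>h\<close>.
\<close>

lemma shell_maximal_bound:
  fixes h :: "real \<Rightarrow> complex" and \<Phi> \<Phi>' \<Phi>'' :: "real \<Rightarrow> real"
  assumes d1: "\<And>\<xi>. (\<Phi> has_real_derivative \<Phi>' \<xi>) (at \<xi>)"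
    and d2: "\<And>\<xi>. (\<Phi>' has_real_derivative \<Phi>'' \<xi>) (at \<xi>)"
    and s1: "\<bar>\<sigma>1\<bar> = 1" "\<And>\<xi>. 1 \<le> \<xi> \<Longrightarrow> 0 \<le> \<sigma>1 * \<Phi>'' \<xi>"
    and s2: "\<bar>\<sigma>2\<bar> = 1" "\<And>\<xi>. \<xi> \<le> -1 \<Longrightarrow> 0 \<le> \<sigma>2 * \<Phi>'' \<xi>"
    and c: "c > 0" and cv: "\<And>\<xi> \<theta>. 1 \<le> \<bar>\<xi>\<bar> \<Longrightarrow> \<theta> \<in> \<Theta> \<Longrightarrow> c * \<bar>\<Phi>' \<xi> + \<theta>\<bar> \<le> \<bar>\<xi>\<bar> * \<bar>\<Phi>'' \<xi>\<bar>"
    and h: "integrable lborel h" "integrable lborel (\<lambda>\<xi>. (norm (h \<xi>))\<^sup>2)" "\<And>\<xi>. \<xi> \<notin> shell j \<Longrightarrow> h \<xi> = 0"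
    and D: "countable D" "D \<subseteq> {-1..1} \<times> \<Theta>"
    and A: "finite A" "\<Theta> \<subseteq> (\<Union>a\<in>A. {a..a + 1 / 2 ^ j})"
  shows "(\<integral>\<^sup>+x. quartic_maximal \<Phi> h D x \<partial>lborel)
    \<le> ennreal ((8 + 384 * (9 + 7 / c)\<^sup>2 * card A) * 2 ^ j * (real j + 1) * (LINT \<xi>|lborel. (norm (h \<xi>))\<^sup>2)\<^sup>2)"
proof -
  have [measurable]: "h \<in> borel_measurable borel" using h(1) by auto
  have Pm[measurable]: "\<Phi> \<in> borel_measurable borel"
    by (intro borel_measurable_continuous_onI DERIV_continuous_on[where D = \<Phi>'])
       (use d1 in \<open>auto intro: has_field_derivative_at_within\<close>)
  define H where "H = (LINT \<xi>|lborel. (norm (h \<xi>))\<^sup>2)"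
  have H0: "H \<ge> 0" unfolding H_def by simp
  show ?thesis
  proof (cases "j = 0")
    case True
    define L where "L = (LINT \<xi>|lborel. norm (h \<xi>))"
    have L0: "L \<ge> 0" by (simp add: L_def)
    have "L\<^sup>2 \<le> 2 * H"
    proof -
      have "ennreal L = (\<integral>\<^sup>+\<xi>. ennreal (norm (h \<xi>)) \<partial>lborel)"
        unfolding L_def by (rule nn_integral_eq_integral[symmetric]) (use h in auto)
      also have "\<dots> = (\<integral>\<^sup>+\<xi>. ennreal (norm (h \<xi>)) * indicator {-1..1} \<xi> \<partial>lborel)"
        by (intro nn_integral_cong) (use h(3) in \<open>auto simp: True shell_def indicator_def\<close>)
      finally have "(ennreal L)\<^sup>2 \<le> (\<dots>)\<^sup>2" by (rule power_mono[OF eq_refl]) simp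
      also have "\<dots> \<le> (\<integral>\<^sup>+\<xi>. (ennreal (norm (h \<xi>)))\<^sup>2 \<partial>lborel) * (\<integral>\<^sup>+\<xi>. (indicator {-1..1} \<xi>)\<^sup>2 \<partial>(lborel :: real measure))"
        by (rule Cauchy_Schwarz_nn_integral) auto
      also have "(\<integral>\<^sup>+\<xi>. (indicator {-1..1} \<xi>)\<^sup>2 \<partial>(lborel :: real measure)) = (\<integral>\<^sup>+\<xi>. indicator {-1..1} \<xi> \<partial>(lborel :: real measure))"
        by (intro nn_integral_cong) (auto simp: indicator_def)
      also have "\<dots> = ennreal 2" by simp
      also have "(\<integral>\<^sup>+\<xi>. (ennreal (norm (h \<xi>)))\<^sup>2 \<partial>lborel) = ennreal H"
        unfolding H_def using h(2) by (simp add: ennreal_power nn_integral_eq_integral)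
      also have "ennreal H * ennreal 2 = ennreal (H * 2)" by (rule ennreal_mult'[symmetric]) (rule H0)
      finally show ?thesis using L0 H0 by (simp add: ennreal_power mult.commute)
    qed
    then have "(L\<^sup>2)\<^sup>2 \<le> (2 * H)\<^sup>2" by (intro power_mono) auto
    then have L4: "L ^ 4 \<le> 4 * H\<^sup>2" by (simp add: power_mult_distrib)
    have "(\<integral>\<^sup>+x. quartic_maximal \<Phi> h D x \<partial>lborel)
      \<le> (\<integral>\<^sup>+x. ennreal (4 * H\<^sup>2) * indicator {-1..1} x \<partial>(lborel :: real measure))"
      unfolding quartic_maximal_def case_prod_beta
    proof (intro nn_integral_mono SUP_least)
      fix x :: real and p :: "real \<times> real"
      have "norm (osc_integral \<Phi> h (fst p) (x + fst p * snd p)) ^ 4 \<le> L ^ 4" unfolding L_def by (intro power_mono norm_osc_integral_le) auto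
      then show "ennreal (norm (osc_integral \<Phi> h (fst p) (x + fst p * snd p)) ^ 4) * indicator {-1..1} x \<le> ennreal (4 * H\<^sup>2) * indicator {-1..1} x"
        using L4 by (intro mult_right_mono ennreal_leI) auto
    qed
    also have "\<dots> = ennreal (4 * H\<^sup>2) * ennreal 2" by (subst nn_integral_cmult_indicator) auto
    also have "\<dots> = ennreal (4 * H\<^sup>2 * 2)" by (rule ennreal_mult'[symmetric]) simp
    also have "\<dots> \<le> ennreal ((8 + 384 * (9 + 7 / c)\<^sup>2 * card A) * 2 ^ j * (real j + 1) * H\<^sup>2)"
      unfolding True by (intro ennreal_leI) (simp add: mult_right_mono algebra_simps)
    finally show ?thesis unfolding H_def .
  next
    case False
    define R where "R = (2::real) ^ j"
    have R2: "2 ^ (j - 1) = R / 2" unfolding R_def using False by (cases j) auto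
    have shell_R: "shell j = {\<xi>. R / 2 < \<bar>\<xi>\<bar> \<and> \<bar>\<xi>\<bar> \<le> R}"
      using False unfolding R2[symmetric] by (simp add: shell_def R_def)
    have R: "R / 2 \<ge> 1" unfolding R2[symmetric] by simp
    define hp where "hp \<xi> = indicator {0<..} \<xi> *\<^sub>R h \<xi>" for \<xi>
    define hm where "hm \<xi> = indicator {..<0} \<xi> *\<^sub>R h \<xi>" for \<xi>
    have hsum: "h = (\<lambda>\<xi>. hp \<xi> + hm \<xi>)"
    proof
      fix \<xi> show "h \<xi> = hp \<xi> + hm \<xi>"
        using h(3)[of 0] False by (cases "\<xi> = 0") (auto simp: hp_def hm_def indicator_def shell_def)
    qed
    have part: "integrable lborel (\<lambda>\<xi>. indicator B \<xi> *\<^sub>R h \<xi>)"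
        "integrable lborel (\<lambda>\<xi>. (norm (indicator B \<xi> *\<^sub>R h \<xi>))\<^sup>2)"
        "(LINT \<xi>|lborel. (norm (indicator B \<xi> *\<^sub>R h \<xi>))\<^sup>2) \<le> H" if B: "B \<in> sets borel" for B
    proof -
      show "integrable lborel (\<lambda>\<xi>. indicator B \<xi> *\<^sub>R h \<xi>)"
        using h(1) B by (intro integrable_mult_indicator) auto
      have e: "(norm (indicator B \<xi> *\<^sub>R h \<xi>))\<^sup>2 = indicator B \<xi> *\<^sub>R (norm (h \<xi>))\<^sup>2" for \<xi>
        by (auto simp: indicator_def)
      show i: "integrable lborel (\<lambda>\<xi>. (norm (indicator B \<xi> *\<^sub>R h \<xi>))\<^sup>2)"
        unfolding e using h(2) B by (intro integrable_mult_indicator) auto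
      show "(LINT \<xi>|lborel. (norm (indicator B \<xi> *\<^sub>R h \<xi>))\<^sup>2) \<le> H"
        unfolding H_def by (intro integral_mono i h(2)) (auto simp: indicator_def)
    qed
    define K where "K = card A * (8 * (9 + 7 / c)\<^sup>2 * R * arsinh (2 * R))"
    have as0: "arsinh (2 * R) \<ge> 0" using R arsinh_real_pos_iff[of "2 * R"] by (simp add: less_imp_le)
    have K0: "K \<ge> 0" unfolding K_def using R as0 by (intro mult_nonneg_nonneg) auto
    have band: "(\<integral>\<^sup>+x. quartic_maximal \<Phi> (\<lambda>\<xi>. indicator B \<xi> *\<^sub>R h \<xi>) D x \<partial>lborel) \<le> ennreal (K * H\<^sup>2)"
      if B: "B \<in> sets borel" "\<And>\<xi>. \<xi> \<in> B \<Longrightarrow> \<xi> \<in> shell j \<Longrightarrow> \<xi> \<in> {a..a + R / 2}"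
        and a: "\<And>\<xi>. \<xi> \<in> {a..a + R / 2} \<Longrightarrow> R / 2 \<le> \<bar>\<xi>\<bar> \<and> \<bar>\<xi>\<bar> \<le> R"
        and sg: "\<bar>\<sigma>\<bar> = 1" "\<And>\<xi>. \<xi> \<in> {a..a + R / 2} \<Longrightarrow> 0 \<le> \<sigma> * \<Phi>'' \<xi>" for B a \<sigma>
    proof -
      let ?h = "\<lambda>\<xi>. indicator B \<xi> *\<^sub>R h \<xi>"
      have "(\<integral>\<^sup>+x. quartic_maximal \<Phi> ?h D x \<partial>lborel)
          \<le> ennreal (card A * (8 * (9 + 7 / c)\<^sup>2 * R * arsinh (2 * R) * (LINT \<xi>|lborel. (norm (?h \<xi>))\<^sup>2)\<^sup>2))"
      proof (rule maximal_L4_directions[where a = a and b = "a + R / 2" and \<sigma> = \<sigma> and \<Phi>' = \<Phi>' and \<Phi>'' = \<Phi>''])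
        fix \<xi> assume x: "\<xi> \<in> {a..a + R / 2}"
        show "(\<Phi> has_real_derivative \<Phi>' \<xi>) (at \<xi> within {a..a + R / 2})" "(\<Phi>' has_real_derivative \<Phi>'' \<xi>) (at \<xi> within {a..a + R / 2})"
          using d1 d2 by (auto intro: has_field_derivative_at_within)
        show "0 \<le> \<sigma> * \<Phi>'' \<xi>" by (rule sg(2)[OF x])
        fix \<theta> assume t: "\<theta> \<in> \<Theta>"
        have "c * \<bar>\<Phi>' \<xi> + \<theta>\<bar> \<le> \<bar>\<xi>\<bar> * \<bar>\<Phi>'' \<xi>\<bar>" using a[OF x] R by (intro cv t) auto
        also have "\<dots> \<le> R * \<bar>\<Phi>'' \<xi>\<bar>" using a[OF x] by (intro mult_right_mono) auto
        finally show "c * \<bar>\<Phi>' \<xi> + \<theta>\<bar> \<le> R * \<bar>\<Phi>'' \<xi>\<bar>" .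
      next
        show "?h \<xi> = 0" if "\<xi> \<notin> {a..a + R / 2}" for \<xi>
          using that B(2)[of \<xi>] h(3)[of \<xi>] by (auto simp: indicator_def)
        show "\<Theta> \<subseteq> (\<Union>a\<in>A. {a..a + 1 / R})" using A(2) by (simp add: R_def)
      qed (use R c D A sg(1) Pm part(1,2)[OF B(1)] in auto)
      also have "\<dots> = ennreal (K * (LINT \<xi>|lborel. (norm (?h \<xi>))\<^sup>2)\<^sup>2)" by (simp only: K_def mult.assoc)
      also have "\<dots> \<le> ennreal (K * H\<^sup>2)"
        by (intro ennreal_leI mult_left_mono K0 power_mono part(3) B) auto
      finally show ?thesis .
    qed
    have bp: "(\<integral>\<^sup>+x. quartic_maximal \<Phi> hp D x \<partial>lborel) \<le> ennreal (K * H\<^sup>2)"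
      unfolding hp_def by (rule band[of _ "R / 2" \<sigma>1]) (use R s1 in \<open>auto simp: shell_R\<close>)
    have bm: "(\<integral>\<^sup>+x. quartic_maximal \<Phi> hm D x \<partial>lborel) \<le> ennreal (K * H\<^sup>2)"
      unfolding hm_def by (rule band[of _ "- R" \<sigma>2]) (use R s2 in \<open>auto simp: shell_R\<close>)
    have hpi: "integrable lborel hp" "integrable lborel hm" unfolding hp_def hm_def by (intro part; simp)+
    have hpm[measurable]: "hp \<in> borel_measurable borel" "hm \<in> borel_measurable borel" using hpi by auto
    have "(\<integral>\<^sup>+x. quartic_maximal \<Phi> h D x \<partial>lborel) \<le> (\<integral>\<^sup>+x. 8 * (quartic_maximal \<Phi> hp D x + quartic_maximal \<Phi> hm D x) \<partial>lborel)"
    proof (intro nn_integral_mono)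
      fix x
      have "ennreal (norm (osc_integral \<Phi> h t (x + t * \<theta>)) ^ 4) * indicator {-1..1} x \<le> 8 * (quartic_maximal \<Phi> hp D x + quartic_maximal \<Phi> hm D x)"
        if "(t, \<theta>) \<in> D" for t \<theta>
      proof -
        let ?p = "norm (osc_integral \<Phi> hp t (x + t * \<theta>)) ^ 4" and ?m = "norm (osc_integral \<Phi> hm t (x + t * \<theta>)) ^ 4"
        have "osc_integral \<Phi> h t (x + t * \<theta>) = osc_integral \<Phi> hp t (x + t * \<theta>) + osc_integral \<Phi> hm t (x + t * \<theta>)"
          by (subst hsum) (rule osc_integral_add[OF Pm hpi])
        then have "norm (osc_integral \<Phi> h t (x + t * \<theta>)) ^ 4 \<le> 8 * (?p + ?m)" by (simp only: fourth_power_add_le)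
        then have "ennreal (norm (osc_integral \<Phi> h t (x + t * \<theta>)) ^ 4) \<le> ennreal (8 * (?p + ?m))" by (rule ennreal_leI)
        also have "\<dots> = 8 * (ennreal ?p + ennreal ?m)" by (simp add: ennreal_mult')
        finally have "ennreal (norm (osc_integral \<Phi> h t (x + t * \<theta>)) ^ 4) * indicator {-1..1} x
            \<le> 8 * (ennreal ?p + ennreal ?m) * indicator {-1..1} x" by (rule mult_right_mono) simp
        also have "\<dots> = 8 * (ennreal ?p * indicator {-1..1} x + ennreal ?m * indicator {-1..1} x)"
          by (simp add: distrib_right mult.assoc)
        also have "\<dots> \<le> 8 * (quartic_maximal \<Phi> hp D x + quartic_maximal \<Phi> hm D x)"
          unfolding quartic_maximal_def by (intro mult_left_mono add_mono SUP_upper2[OF that]) auto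
        finally show ?thesis .
      qed
      then show "quartic_maximal \<Phi> h D x \<le> 8 * (quartic_maximal \<Phi> hp D x + quartic_maximal \<Phi> hm D x)"
        unfolding quartic_maximal_def[of \<Phi> h] by (intro SUP_least) auto
    qed
    also have "\<dots> = 8 * ((\<integral>\<^sup>+x. quartic_maximal \<Phi> hp D x \<partial>lborel) + (\<integral>\<^sup>+x. quartic_maximal \<Phi> hm D x \<partial>lborel))"
      using borel_measurable_quartic_maximal[OF Pm hpm(1) D(1)] borel_measurable_quartic_maximal[OF Pm hpm(2) D(1)]
      by (simp add: nn_integral_cmult nn_integral_add)
    also have "\<dots> \<le> 8 * (ennreal (K * H\<^sup>2) + ennreal (K * H\<^sup>2))"
      by (intro mult_left_mono add_mono bp bm) auto
    also have "\<dots> = ennreal (16 * K * H\<^sup>2)"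
      using K0 by (simp add: ennreal_mult' mult.assoc flip: ennreal_plus mult_2)
    also have "\<dots> \<le> ennreal ((8 + 384 * (9 + 7 / c)\<^sup>2 * card A) * 2 ^ j * (real j + 1) * H\<^sup>2)"
    proof (intro ennreal_leI mult_right_mono)
      have "16 * K = (128 * (9 + 7 / c)\<^sup>2 * card A * R) * arsinh (2 * R)" by (simp add: K_def)
      also have "\<dots> \<le> (128 * (9 + 7 / c)\<^sup>2 * card A * R) * (3 * (real j + 1))"
        using R arsinh_dyadic[of j] unfolding R_def by (intro mult_left_mono) auto
      also have "\<dots> = (384 * (9 + 7 / c)\<^sup>2 * card A) * (R * (real j + 1))" by simp
      also have "\<dots> \<le> (8 + 384 * (9 + 7 / c)\<^sup>2 * card A) * (R * (real j + 1))"
        using R by (intro mult_right_mono) auto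
      finally show "16 * K \<le> (8 + 384 * (9 + 7 / c)\<^sup>2 * card A) * 2 ^ j * (real j + 1)"
        by (simp only: R_def mult.assoc)
    qed auto
    finally show ?thesis unfolding H_def .
  qed
qed

lemma continuous_on_osc_integral:
  assumes [measurable]: "\<Phi> \<in> borel_measurable borel" and h: "integrable lborel h"
  shows "continuous_on UNIV (\<lambda>p. osc_integral \<Phi> h (fst p) (snd p))"
  unfolding continuous_on_sequentially
proof (intro allI ballI impI, elim conjE)
  fix p :: "nat \<Rightarrow> real \<times> real" and a assume l: "p \<longlonglongrightarrow> a"
  have [measurable]: "h \<in> borel_measurable borel" using h by auto
  show "((\<lambda>p. osc_integral \<Phi> h (fst p) (snd p)) \<circ> p) \<longlonglongrightarrow> osc_integral \<Phi> h (fst a) (snd a)"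
    unfolding osc_integral_def comp_def
  proof (rule integral_dominated_convergence[where w = "\<lambda>\<xi>. norm (h \<xi>)"])
    show "AE \<xi> in lborel. (\<lambda>n. cis (snd (p n) * \<xi> + fst (p n) * \<Phi> \<xi>) * h \<xi>) \<longlonglongrightarrow> cis (snd a * \<xi> + fst a * \<Phi> \<xi>) * h \<xi>"
      by (intro AE_I2 tendsto_intros l)
  qed (use h in \<open>auto simp: norm_mult\<close>)
qed

section \<open>Dyadic series and pointwise convergence\<close>

text \<open>
Applied to \<open>\<Phi>''\<close>, this supplies the monotonicity of the derivative of the phase.
\<close>

lemma constant_sign:
  fixes g :: "real \<Rightarrow> real"
  assumes S: "connected S" and g: "continuous_on S g" "\<And>x. x \<in> S \<Longrightarrow> g x \<noteq> 0"
  shows "\<exists>\<sigma>. \<bar>\<sigma>\<bar> = 1 \<and> (\<forall>x\<in>S. 0 \<le> \<sigma> * g x)"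
proof (cases "\<forall>x\<in>S. 0 \<le> g x")
  case True
  then show ?thesis by (intro exI[of _ 1]) auto
next
  case False
  then obtain x where x: "x \<in> S" "g x < 0" by force
  have "g y \<le> 0" if "y \<in> S" for y
  proof (rule ccontr)
    assume "\<not> g y \<le> 0"
    then have "0 \<in> {g x..g y}" using x by auto
    moreover have "{g x..g y} \<subseteq> g ` S"
      using connected_contains_Icc[OF connected_continuous_image[OF g(1) S]] x(1) that by blast
    ultimately show False using g(2) by force
  qed
  then show ?thesis by (intro exI[of _ "-1"]) auto
qed

lemma dense_upper_bound:
  fixes g :: "'a::metric_space \<Rightarrow> real"
  assumes g: "continuous_on X g" and D: "D \<subseteq> X" "X \<subseteq> closure D" and le: "\<And>p. p \<in> D \<Longrightarrow> g p \<le> c" and p: "p \<in> X"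
  shows "g p \<le> c"
proof -
  obtain d where d: "\<And>n::nat. d n \<in> D" "d \<longlonglongrightarrow> p" using D(2) p closure_sequential by blast
  have "(\<lambda>n. g (d n)) \<longlonglongrightarrow> g p"
    using g p d D(1) unfolding continuous_on_sequentially comp_def by blast
  then show ?thesis by (rule LIMSEQ_le_const2) (use le d in auto)
qed

text \<open>
By continuity the bounds extend from \<open>D\<close> to \<open>X\<close>.  There the series converges uniformly, so its sum is continuous
and the supremum of its modulus is determined by \<open>D\<close>.
\<close>

lemma geometric_series_on_dense:
  fixes a :: "nat \<Rightarrow> 'p::metric_space \<Rightarrow> complex"
  assumes a: "\<And>k. continuous_on X (a k)" and D: "D \<subseteq> X" "X \<subseteq> closure D"
    and t: "0 \<le> \<tau>" "\<tau> < 1" and b: "\<And>k p. p \<in> D \<Longrightarrow> norm (a k p) \<le> B * \<tau> ^ k" and B: "B \<ge> 0"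
  defines "L \<equiv> \<lambda>p. lim (\<lambda>N. \<Sum>k\<le>N. a k p)"
  shows "\<And>p. p \<in> X \<Longrightarrow> convergent (\<lambda>N. \<Sum>k\<le>N. a k p)"
    and "\<And>p. p \<in> X \<Longrightarrow> norm (L p) \<le> B / (1 - \<tau>)"
    and "(SUP p\<in>X. ennreal (norm (L p))) = (SUP p\<in>D. ennreal (norm (L p)))"
proof -
  have bX: "norm (a k p) \<le> B * \<tau> ^ k" if "p \<in> X" for k p
    by (rule dense_upper_bound[OF _ D _ that, of "\<lambda>p. norm (a k p)"]) (auto intro!: continuous_intros a b)
  have sg: "summable (\<lambda>k. B * \<tau> ^ k)" "(\<Sum>k. B * \<tau> ^ k) = B / (1 - \<tau>)"
    using t by (auto intro!: summable_mult summable_geometric simp: suminf_mult suminf_geometric)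
  have sm: "summable (\<lambda>k. norm (a k p))" if "p \<in> X" for p
    by (rule summable_comparison_test'[OF sg(1)]) (use bX[OF that] in auto)
  have lim: "(\<lambda>N. \<Sum>k\<le>N. a k p) \<longlonglongrightarrow> (\<Sum>k. a k p)" if "p \<in> X" for p
    by (rule summable_LIMSEQ'[OF summable_norm_cancel[OF sm[OF that]]])
  then show "\<And>p. p \<in> X \<Longrightarrow> convergent (\<lambda>N. \<Sum>k\<le>N. a k p)" by (auto simp: convergent_def)
  have L: "L p = (\<Sum>k. a k p)" if "p \<in> X" for p
    unfolding L_def by (rule limI[OF lim[OF that]])
  show nL: "norm (L p) \<le> B / (1 - \<tau>)" if "p \<in> X" for p
  proof -
    have "norm (\<Sum>k. a k p) \<le> (\<Sum>k. norm (a k p))" by (rule summable_norm[OF sm[OF that]])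
    also have "\<dots> \<le> (\<Sum>k. B * \<tau> ^ k)" by (rule suminf_le[OF bX[OF that] sm[OF that] sg(1)])
    finally show ?thesis using L[OF that] sg(2) by simp
  qed
  have "uniform_limit X (\<lambda>n p. \<Sum>k<n. a k p) (\<lambda>p. \<Sum>k. a k p) sequentially"
    by (rule Weierstrass_m_test[OF bX sg(1)])
  then have "continuous_on X (\<lambda>p. \<Sum>k. a k p)"
    by (rule uniform_limit_theorem[rotated]) (auto intro!: always_eventually continuous_intros a)
  then have cL: "continuous_on X (\<lambda>p. norm (L p))"
    using L by (intro continuous_on_norm) (simp cong: continuous_on_cong)
  show "(SUP p\<in>X. ennreal (norm (L p))) = (SUP p\<in>D. ennreal (norm (L p)))" (is "?l = ?r")
  proof (rule antisym)
    have rB: "?r \<le> ennreal (B / (1 - \<tau>))" using nL D(1) by (intro SUP_least ennreal_leI) auto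
    then obtain c where c: "?r = ennreal c" "c \<ge> 0"
      by (cases ?r) (auto simp: top_unique)
    have "norm (L p) \<le> c" if "p \<in> D" for p
    proof -
      have "ennreal (norm (L p)) \<le> ennreal c" unfolding c(1)[symmetric] by (rule SUP_upper[OF that])
      then show ?thesis using c(2) by (simp add: ennreal_le_iff)
    qed
    then have "norm (L p) \<le> c" if "p \<in> X" for p by (rule dense_upper_bound[OF cL D _ that])
    then show "?l \<le> ?r" unfolding c(1) by (intro SUP_least ennreal_leI)
    show "?r \<le> ?l" by (rule SUP_subset_mono[OF D(1)]) simp
  qed
qed

definition dyadic_piece :: "(real \<Rightarrow> complex) \<Rightarrow> nat \<Rightarrow> real \<Rightarrow> complex" where
  "dyadic_piece h k \<xi> = indicator (shell k) \<xi> *\<^sub>R h \<xi>"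

text \<open>
On the shell of index \<open>k\<close> the weight \<open>(1 + \<xi>\<^sup>2)\<^sup>s\<close> is at least \<open>4^{-s} 2^{2 s k}\<close>.
\<close>

lemma dyadic_piece_facts:
  fixes h :: "real \<Rightarrow> complex"
  assumes [measurable]: "h \<in> borel_measurable borel" and s: "s > 0"
    and E: "integrable lborel (\<lambda>\<xi>. (1 + \<xi>\<^sup>2) powr s * (norm (h \<xi>))\<^sup>2)"
  shows "integrable lborel (dyadic_piece h k)"
    and "integrable lborel (\<lambda>\<xi>. (norm (dyadic_piece h k \<xi>))\<^sup>2)"
    and "(LINT \<xi>|lborel. (norm (dyadic_piece h k \<xi>))\<^sup>2)
      \<le> 4 powr s * 2 powr (- 2 * s * real k) * (LINT \<xi>|lborel. (1 + \<xi>\<^sup>2) powr s * (norm (h \<xi>))\<^sup>2)"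
proof -
  let ?e = "\<lambda>\<xi>. (1 + \<xi>\<^sup>2) powr s * (norm (h \<xi>))\<^sup>2"
  have [measurable]: "dyadic_piece h k \<in> borel_measurable borel" unfolding dyadic_piece_def by measurable
  have w: "2 powr (2 * s * real k) \<le> 4 powr s * (1 + \<xi>\<^sup>2) powr s" if "\<xi> \<in> shell k" for \<xi>
  proof -
    \<comment> \<open>The factor \<open>4\<close> accounts for the inner radius \<open>2^{k-1}\<close> of the shell.\<close>
    have "(2 powr real k)\<^sup>2 \<le> 4 * (1 + \<xi>\<^sup>2)"
    proof (cases k)
      case (Suc n)
      then have "2 ^ n \<le> \<bar>\<xi>\<bar>" using that by (simp add: shell_def)
      then have "(2 ^ n)\<^sup>2 \<le> \<xi>\<^sup>2" using power_mono[of "2 ^ n" "\<bar>\<xi>\<bar>" 2] by simp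
      moreover have "2 powr real k = 2 * 2 ^ n" unfolding Suc by (subst powr_realpow) simp_all
      ultimately show ?thesis by (simp add: power_mult_distrib)
    qed simp
    then have "((2 powr real k)\<^sup>2) powr s \<le> (4 * (1 + \<xi>\<^sup>2)) powr s" using s by (intro powr_mono2) auto
    moreover have "((2 powr real k)\<^sup>2) powr s = 2 powr (2 * s * real k)"
      by (simp add: powr_powr mult_ac flip: powr_numeral)
    moreover have "(4 * (1 + \<xi>\<^sup>2)) powr s = 4 powr s * (1 + \<xi>\<^sup>2) powr s" by (subst powr_mult) auto
    ultimately show ?thesis by (simp only:)
  qed
  have pw: "(norm (dyadic_piece h k \<xi>))\<^sup>2 \<le> 4 powr s * 2 powr (- 2 * s * real k) * ?e \<xi>" for \<xi>
  proof (cases "\<xi> \<in> shell k")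
    case True
    have "2 powr (- 2 * s * real k) * 2 powr (2 * s * real k) = 1" by (simp flip: powr_add)
    then have "(norm (h \<xi>))\<^sup>2 = 2 powr (- 2 * s * real k) * 2 powr (2 * s * real k) * (norm (h \<xi>))\<^sup>2" by simp
    also have "\<dots> \<le> 2 powr (- 2 * s * real k) * (4 powr s * (1 + \<xi>\<^sup>2) powr s) * (norm (h \<xi>))\<^sup>2"
      by (intro mult_right_mono mult_left_mono w[OF True]) auto
    finally show ?thesis using True by (simp add: dyadic_piece_def mult_ac)
  qed (simp add: dyadic_piece_def)
  show i2: "integrable lborel (\<lambda>\<xi>. (norm (dyadic_piece h k \<xi>))\<^sup>2)"
    by (rule Bochner_Integration.integrable_bound[OF integrable_mult_right[OF E, of "4 powr s * 2 powr (- 2 * s * real k)"]])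
       (use pw in \<open>auto intro!: AE_I2 simp: abs_mult\<close>)
  show "(LINT \<xi>|lborel. (norm (dyadic_piece h k \<xi>))\<^sup>2) \<le> 4 powr s * 2 powr (- 2 * s * real k) * (LINT \<xi>|lborel. ?e \<xi>)"
    unfolding integral_mult_right_zero[symmetric]
    by (rule integral_mono[OF i2 integrable_mult_right[OF E] pw])
  have iS: "integrable lborel (indicator (shell k) :: real \<Rightarrow> real)"
  proof -
    have "emeasure lborel (shell k) \<le> emeasure lborel {-(2 ^ k)..2 ^ k :: real}"
      by (rule emeasure_mono[OF shell_bounded]) simp
    also have "\<dots> < \<infinity>" by simp
    finally show ?thesis by simp
  qed
  show "integrable lborel (dyadic_piece h k)"
  proof (rule Bochner_Integration.integrable_bound[OF Bochner_Integration.integrable_add[OF iS i2]])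
    have "norm (dyadic_piece h k \<xi>) \<le> indicator (shell k) \<xi> + (norm (dyadic_piece h k \<xi>))\<^sup>2" for \<xi>
    proof -
      have "norm (h \<xi>) \<le> 1 + (norm (h \<xi>))\<^sup>2"
      proof -
        have "2 * norm (h \<xi>) \<le> 1 + (norm (h \<xi>))\<^sup>2" using sum_squares_bound[of 1 "norm (h \<xi>)"] by simp
        then show ?thesis using norm_ge_zero[of "h \<xi>"] by linarith
      qed
      then show ?thesis by (auto simp: dyadic_piece_def indicator_def)
    qed
    then show "AE \<xi> in lborel. norm (dyadic_piece h k \<xi>) \<le> norm (indicator (shell k) \<xi> + (norm (dyadic_piece h k \<xi>))\<^sup>2)"
      by (intro AE_I2) (auto intro: order_trans)
  qed simp
qed

lemma evol_partial_dyadic: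
  fixes \<Phi> :: "real \<Rightarrow> real"
  assumes P[measurable]: "\<Phi> \<in> borel_measurable borel" and h[measurable]: "h \<in> borel_measurable borel"
    and fm: "fourier f \<in> borel_measurable lebesgue" and ae: "AE \<xi> in lborel. fourier f \<xi> = h \<xi>"
    and ip: "\<And>k. integrable lborel (dyadic_piece h k)"
  shows "evol_partial \<Phi> t f y N = (\<Sum>k\<le>N. osc_integral \<Phi> (dyadic_piece h k) t y / of_real (2 * pi))"
proof -
  let ?B = "{\<xi>. \<bar>\<xi>\<bar> \<le> (2::real) ^ N}"
  have [measurable]: "?B \<in> sets borel" by measurable
  have c: "exp (\<i> * of_real (y * \<xi> + t * \<Phi> \<xi>)) = cis (y * \<xi> + t * \<Phi> \<xi>)" for \<xi> by (simp add: cis_conv_exp)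
  have m1: "(\<lambda>\<xi>. indicator ?B \<xi> *\<^sub>R (cis (y * \<xi> + t * \<Phi> \<xi>) * h \<xi>)) \<in> borel_measurable lborel" by measurable
  have "(LINT \<xi>:?B|lebesgue. exp (\<i> * of_real (y * \<xi> + t * \<Phi> \<xi>)) * fourier f \<xi>)
     = (LINT \<xi>|lebesgue. indicator ?B \<xi> *\<^sub>R (cis (y * \<xi> + t * \<Phi> \<xi>) * h \<xi>))"
    unfolding set_lebesgue_integral_def c
  proof (rule integral_cong_AE)
    have "(\<lambda>\<xi>. indicator ?B \<xi> *\<^sub>R cis (y * \<xi> + t * \<Phi> \<xi>)) \<in> borel_measurable lebesgue"
      by (rule borel_measurable_lebesgueI) measurable
    from borel_measurable_times[OF this fm]
    show "(\<lambda>\<xi>. indicator ?B \<xi> *\<^sub>R (cis (y * \<xi> + t * \<Phi> \<xi>) * fourier f \<xi>)) \<in> borel_measurable lebesgue"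
      by simp
    show "(\<lambda>\<xi>. indicator ?B \<xi> *\<^sub>R (cis (y * \<xi> + t * \<Phi> \<xi>) * h \<xi>)) \<in> borel_measurable lebesgue"
      by (rule borel_measurable_lebesgueI) measurable
    show "AE \<xi> in lebesgue. indicator ?B \<xi> *\<^sub>R (cis (y * \<xi> + t * \<Phi> \<xi>) * fourier f \<xi>)
        = indicator ?B \<xi> *\<^sub>R (cis (y * \<xi> + t * \<Phi> \<xi>) * h \<xi>)"
      using AE_completion[OF ae] by eventually_elim simp
  qed
  also have "\<dots> = (LINT \<xi>|lborel. indicator ?B \<xi> *\<^sub>R (cis (y * \<xi> + t * \<Phi> \<xi>) * h \<xi>))"
    by (rule integral_completion[OF m1])
  also have "\<dots> = (LINT \<xi>|lborel. (\<Sum>k\<le>N. cis (y * \<xi> + t * \<Phi> \<xi>) * dyadic_piece h k \<xi>))"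
  proof (rule Bochner_Integration.integral_cong[OF refl])
    fix \<xi>
    show "indicator ?B \<xi> *\<^sub>R (cis (y * \<xi> + t * \<Phi> \<xi>) * h \<xi>) = (\<Sum>k\<le>N. cis (y * \<xi> + t * \<Phi> \<xi>) * dyadic_piece h k \<xi>)"
      unfolding sum_indicator_shell[symmetric] dyadic_piece_def by (simp only: scaleR_sum_left mult_scaleR_right)
  qed
  also have "\<dots> = (\<Sum>k\<le>N. LINT \<xi>|lborel. cis (y * \<xi> + t * \<Phi> \<xi>) * dyadic_piece h k \<xi>)"
  proof (rule Bochner_Integration.integral_sum)
    fix k
    show "integrable lborel (\<lambda>\<xi>. cis (y * \<xi> + t * \<Phi> \<xi>) * dyadic_piece h k \<xi>)"
      by (rule Bochner_Integration.integrable_bound[OF ip[of k]])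
         (use borel_measurable_integrable[OF ip[of k]] in \<open>auto simp: norm_mult\<close>)
  qed
  finally show ?thesis unfolding evol_partial_def osc_integral_def by (simp only: sum_divide_distrib)
qed

section \<open>Measurability and Lebesgue norms of the maximal function\<close>

lemma ennreal_powr_mono: "a \<le> b \<Longrightarrow> 0 \<le> p \<Longrightarrow> ennreal_powr a p \<le> ennreal_powr b p"
  by (auto simp: ennreal_powr_def top_unique less_top[symmetric] intro!: ennreal_leI powr_mono2 enn2real_mono)

text \<open>
Pointwise, \<open>u^{q/4} \<le> 1 + u\<close> for \<open>u = S(x)/A\<close>, and the measure of the space is at most \<open>2\<close>; this replaces Hoelder's
inequality between \<open>L\<^sup>q\<close> and \<open>L\<^sup>4\<close>.
\<close>

lemma Lp_norm_from_quartic: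
  assumes S[measurable]: "S \<in> borel_measurable M" and M: "emeasure M (space M) \<le> 2"
    and SA: "(\<integral>\<^sup>+x. S x \<partial>M) \<le> ennreal A" and A: "A > 0" and k: "\<kappa> > 0" and q: "1 \<le> q" "q \<le> 4"
    and F: "AE x in M. S x < top \<longrightarrow> F x \<le> ennreal (\<kappa> * root 4 (enn2real (S x)))"
  shows "Lp_norm M q F \<le> ennreal (3 * (\<kappa> * root 4 A))"
proof -
  define B where "B = \<kappa> * root 4 A"
  have B: "B > 0" using k A by (simp add: B_def)
  have "(\<integral>\<^sup>+x. S x \<partial>M) < \<infinity>" using SA by (rule le_less_trans) simp
  then have "AE x in M. S x \<noteq> \<infinity>" by (intro nn_integral_noteq_infinite) auto
  then have "AE x in M. ennreal_powr (F x) q \<le> ennreal (B powr q) * (1 + ennreal (1 / A) * S x)"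
    using F
  proof eventually_elim
    case (elim x)
    define u where "u = enn2real (S x) / A"
    have u0: "u \<ge> 0" using A by (simp add: u_def)
    have Sx: "S x = ennreal (A * u)" using elim(1) A by (simp add: u_def less_top)
    have "F x \<le> ennreal (\<kappa> * root 4 (A * u))" using elim Sx A u0 by (simp add: less_top)
    also have "\<kappa> * root 4 (A * u) = B * root 4 u" by (simp add: B_def real_root_mult)
    finally have "ennreal_powr (F x) q \<le> ennreal_powr (ennreal (B * root 4 u)) q"
      using q by (intro ennreal_powr_mono) auto
    also have "\<dots> = ennreal (B powr q * root 4 u powr q)"
      using B u0 by (simp add: ennreal_powr_def powr_mult)
    also have "\<dots> \<le> ennreal (B powr q * (1 + u))"
    proof (intro ennreal_leI mult_left_mono)
      show "root 4 u powr q \<le> 1 + u"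
      proof (cases "u \<le> 1")
        case True
        then have "root 4 u \<le> 1" by simp
        then have "root 4 u powr q \<le> 1 powr q" using q u0 by (intro powr_mono2) auto
        then show ?thesis using u0 by simp
      next
        case False
        then have "root 4 u \<ge> 1" by simp
        then have "root 4 u powr q \<le> root 4 u powr 4" using q by (intro powr_mono) auto
        also have "\<dots> = u" using u0 False by (simp add: powr_numeral)
        finally show ?thesis by simp
      qed
    qed auto
    also have "\<dots> = ennreal (B powr q) * (1 + ennreal (1 / A) * S x)"
    proof -
      have "ennreal (1 / A) * ennreal (A * u) = ennreal (1 / A * (A * u))"
        by (rule ennreal_mult'[symmetric]) (use A in simp)
      also have "1 / A * (A * u) = u" using A by simp
      finally have "1 + ennreal (1 / A) * S x = ennreal (1 + u)" unfolding Sx using u0 by simp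
      then show ?thesis by (simp only: ennreal_mult'[OF powr_ge_zero])
    qed
    finally show ?case .
  qed
  then have "(\<integral>\<^sup>+x. ennreal_powr (F x) q \<partial>M) \<le> (\<integral>\<^sup>+x. ennreal (B powr q) * (1 + ennreal (1 / A) * S x) \<partial>M)"
    by (rule nn_integral_mono_AE)
  also have "\<dots> = ennreal (B powr q) * (emeasure M (space M) + ennreal (1 / A) * (\<integral>\<^sup>+x. S x \<partial>M))"
    by (simp add: nn_integral_cmult nn_integral_add)
  also have "\<dots> \<le> ennreal (B powr q) * (2 + ennreal (1 / A) * ennreal A)"
    by (intro mult_left_mono add_mono M SA) auto
  also have "ennreal (1 / A) * ennreal A = 1"
    using A ennreal_mult'[of "1 / A" A] by simp
  also have "ennreal (B powr q) * (2 + 1) = ennreal (3 * B powr q)" by (simp add: ennreal_mult' mult.commute)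
  finally have "Lp_norm M q F \<le> ennreal_powr (ennreal (3 * B powr q)) (1 / q)"
    unfolding Lp_norm_def using q by (intro ennreal_powr_mono) auto
  also have "\<dots> = ennreal (3 powr (1 / q) * B)"
    using q B by (simp add: ennreal_powr_def powr_mult powr_powr)
  also have "\<dots> \<le> ennreal (3 * B)"
  proof (intro ennreal_leI mult_right_mono)
    have "(3::real) powr (1 / q) \<le> 3 powr 1" using q by (intro powr_mono) auto
    then show "(3::real) powr (1 / q) \<le> 3" by simp
  qed (use B in simp)
  finally show ?thesis unfolding B_def .
qed

text \<open>
Lebesgue measure is complete, so changing a function on a null set keeps it measurable.
\<close>

lemma measurable_lebesgue_on_AE_eq:
  fixes F G :: "real \<Rightarrow> ennreal"
  assumes S: "S \<in> sets lebesgue" and G: "G \<in> borel_measurable lebesgue" and ae: "AE x in lebesgue. x \<in> S \<longrightarrow> F x = G x"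
  shows "F \<in> borel_measurable (lebesgue_on S)"
proof -
  note [measurable] = S G
  define F1 where "F1 x = (if x \<in> S then F x else 0)" for x
  define G1 where "G1 x = (if x \<in> S then G x else 0)" for x
  have [measurable]: "G1 \<in> borel_measurable lebesgue" unfolding G1_def by measurable
  have ae1: "AE x in lebesgue. G1 x = F1 x" using ae by eventually_elim (auto simp: F1_def G1_def)
  have "F1 \<in> borel_measurable lebesgue"
  proof (rule measurableI)
    fix A :: "ennreal set" assume A: "A \<in> sets borel"
    have "G1 -` A \<inter> space lebesgue \<in> sets lebesgue" using A by (rule measurable_sets[rotated]) measurable
    then show "F1 -` A \<inter> space lebesgue \<in> sets lebesgue"
      by (rule completion.in_sets_AE[rotated]) (use ae1 in \<open>auto elim!: eventually_mono\<close>)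
  qed simp
  then have "F1 \<in> borel_measurable (lebesgue_on S)" by (rule measurable_restrict_space1)
  then show ?thesis by (rule measurable_cong[THEN iffD1, rotated]) (simp add: F1_def)
qed

section \<open>The maximal theorem\<close>

text \<open>
With \<open>b\<^sup>2 = 2^{-(4 s - 1 - r)}\<close> the integral of the \<open>k\<close>-th maximal function, raised to the fourth power, is
\<open>O((k + 1) b^{2 k})\<close>.  The sum of these functions with weights \<open>b^{-k}\<close> is still integrable and dominates each term, which
leaves pointwise decay like \<open>b^{k/4}\<close>.  Bounding every piece by the one function \<open>S\<close> takes the place of the
triangle inequality in \<open>L\<^sup>4\<close>.
\<close>

lemma dyadic_majorant:
  fixes h :: "real \<Rightarrow> complex" and \<Phi> \<Phi>' \<Phi>'' :: "real \<Rightarrow> real"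
  assumes d1: "\<And>\<xi>. (\<Phi> has_real_derivative \<Phi>' \<xi>) (at \<xi>)"
    and d2: "\<And>\<xi>. (\<Phi>' has_real_derivative \<Phi>'' \<xi>) (at \<xi>)"
    and s1: "\<bar>\<sigma>1\<bar> = 1" "\<And>\<xi>. 1 \<le> \<xi> \<Longrightarrow> 0 \<le> \<sigma>1 * \<Phi>'' \<xi>"
    and s2: "\<bar>\<sigma>2\<bar> = 1" "\<And>\<xi>. \<xi> \<le> -1 \<Longrightarrow> 0 \<le> \<sigma>2 * \<Phi>'' \<xi>"
    and c: "c > 0" and cv: "\<And>\<xi> \<theta>. 1 \<le> \<bar>\<xi>\<bar> \<Longrightarrow> \<theta> \<in> \<Theta> \<Longrightarrow> c * \<bar>\<Phi>' \<xi> + \<theta>\<bar> \<le> \<bar>\<xi>\<bar> * \<bar>\<Phi>'' \<xi>\<bar>"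
    and D: "countable D" "D \<subseteq> {-1..1} \<times> \<Theta>"
    and r: "0 < r" "r < 4 * s - 1" and C: "C \<ge> 0"
    and cover: "\<And>k. \<exists>A. finite A \<and> \<Theta> \<subseteq> (\<Union>a\<in>A. {a..a + 1 / 2 ^ k}) \<and> real (card A) \<le> C * 2 powr (r * real k)"
    and h: "h \<in> borel_measurable borel" and E: "integrable lborel (\<lambda>\<xi>. (1 + \<xi>\<^sup>2) powr s * (norm (h \<xi>))\<^sup>2)"
  defines "b \<equiv> 2 powr (- (4 * s - 1 - r) / 2)"
  defines "K \<equiv> (8 + 384 * (9 + 7 / c)\<^sup>2 * C) * 16 powr s"
  shows "\<exists>S \<in> borel_measurable borel.
    (\<integral>\<^sup>+x. S x \<partial>lborel) \<le> ennreal (K / (1 - b)\<^sup>2 * (LINT \<xi>|lborel. (1 + \<xi>\<^sup>2) powr s * (norm (h \<xi>))\<^sup>2)\<^sup>2) \<and>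
    (\<forall>x t \<theta> k. x \<in> {-1..1} \<longrightarrow> S x < top \<longrightarrow> (t, \<theta>) \<in> D \<longrightarrow>
      norm (osc_integral \<Phi> (dyadic_piece h k) t (x + t * \<theta>)) \<le> root 4 (enn2real (S x)) * root 4 b ^ k)"
proof -
  define \<epsilon> where "\<epsilon> = (LINT \<xi>|lborel. (1 + \<xi>\<^sup>2) powr s * (norm (h \<xi>))\<^sup>2)"
  have e0: "\<epsilon> \<ge> 0" unfolding \<epsilon>_def by simp
  have s0: "s > 0" using r by linarith
  note P = dyadic_piece_facts[OF h s0 E]
  have b: "0 < b" "b < 1" unfolding b_def using r by (auto intro!: powr_less_one)
  define K' where "K' = 8 + 384 * (9 + 7 / c)\<^sup>2 * C"
  have K': "K' \<ge> 0" using C by (simp add: K'_def)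
  have K0: "K \<ge> 0" unfolding K_def K'_def[symmetric] using K' by simp
  have Pm[measurable]: "\<Phi> \<in> borel_measurable borel"
    by (intro borel_measurable_continuous_onI DERIV_continuous_on[where D = \<Phi>'])
       (use d1 in \<open>auto intro: has_field_derivative_at_within\<close>)
  have pm[measurable]: "dyadic_piece h k \<in> borel_measurable borel" for k
    using P(1)[of k] by auto
  define V where "V k = quartic_maximal \<Phi> (dyadic_piece h k) D" for k
  have Vm[measurable]: "V k \<in> borel_measurable borel" for k
    unfolding V_def by (rule borel_measurable_quartic_maximal[OF Pm pm D(1)])
  have VI: "(\<integral>\<^sup>+x. V k x \<partial>lborel) \<le> ennreal (K * \<epsilon>\<^sup>2 * ((real k + 1) * (b ^ k)\<^sup>2))" for k
  proof -
    obtain A where A: "finite A" "\<Theta> \<subseteq> (\<Union>a\<in>A. {a..a + 1 / 2 ^ k})" "real (card A) \<le> C * 2 powr (r * real k)"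
      using cover[of k] by blast
    define H where "H = (LINT \<xi>|lborel. (norm (dyadic_piece h k \<xi>))\<^sup>2)"
    have H0: "H \<ge> 0" by (simp add: H_def)
    have "(\<integral>\<^sup>+x. V k x \<partial>lborel) \<le> ennreal ((8 + 384 * (9 + 7 / c)\<^sup>2 * card A) * 2 ^ k * (real k + 1) * H\<^sup>2)"
      unfolding V_def H_def
      by (rule shell_maximal_bound[OF d1 d2 s1 s2 c cv P(1) P(2) _ D A(1,2)]) (auto simp: dyadic_piece_def)
    also have "\<dots> \<le> ennreal (K * \<epsilon>\<^sup>2 * ((real k + 1) * (b ^ k)\<^sup>2))"
    proof (rule ennreal_leI)
      have 1: "8 + 384 * (9 + 7 / c)\<^sup>2 * card A \<le> K' * 2 powr (r * real k)"
      proof -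
        have "384 * (9 + 7 / c)\<^sup>2 * card A \<le> 384 * (9 + 7 / c)\<^sup>2 * (C * 2 powr (r * real k))"
          by (intro mult_left_mono A(3)) auto
        moreover have "(1::real) \<le> 2 powr (r * real k)" using r by (intro ge_one_powr_ge_zero) auto
        ultimately show ?thesis unfolding K'_def by (simp add: distrib_right)
      qed
      have 2: "H\<^sup>2 \<le> 16 powr s * 2 powr (- 4 * s * real k) * \<epsilon>\<^sup>2"
      proof -
        have "H\<^sup>2 \<le> (4 powr s * 2 powr (- 2 * s * real k) * \<epsilon>)\<^sup>2"
          unfolding H_def \<epsilon>_def by (intro power_mono P(3)) auto
        also have "\<dots> = (4 powr s)\<^sup>2 * (2 powr (- 2 * s * real k))\<^sup>2 * \<epsilon>\<^sup>2" by (simp only: power_mult_distrib)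
        also have "(4 powr s)\<^sup>2 = (16::real) powr s"
          by (simp add: power2_eq_square flip: powr_mult)
        also have "(2 powr (- 2 * s * real k))\<^sup>2 = (2::real) powr (- 4 * s * real k)"
          by (simp add: power2_eq_square mult.assoc flip: powr_add)
        finally show ?thesis .
      qed
      have 3: "(b ^ k)\<^sup>2 = 2 powr (r * real k) * 2 ^ k * 2 powr (- 4 * s * real k)"
      proof -
        have "b ^ k = 2 powr (- (4 * s - 1 - r) / 2 * real k)"
          unfolding b_def by (simp only: powr_powr powr_gt_zero zero_less_numeral powr_realpow[symmetric] simp_thms)
        then have "(b ^ k)\<^sup>2 = 2 powr (- (4 * s - 1 - r) / 2 * real k + - (4 * s - 1 - r) / 2 * real k)"
          by (simp only: power2_eq_square powr_add)
        also have "\<dots> = 2 powr (r * real k + real k + - 4 * s * real k)"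
          by (intro arg_cong[where f = "\<lambda>u. 2 powr u"]) (simp add: field_simps)
        also have "\<dots> = 2 powr (r * real k) * 2 ^ k * 2 powr (- 4 * s * real k)"
          by (simp only: powr_add powr_realpow[OF zero_less_numeral])
        finally show ?thesis .
      qed
      have "(8 + 384 * (9 + 7 / c)\<^sup>2 * card A) * 2 ^ k * (real k + 1) * H\<^sup>2
          \<le> (K' * 2 powr (r * real k)) * 2 ^ k * (real k + 1) * (16 powr s * 2 powr (- 4 * s * real k) * \<epsilon>\<^sup>2)"
        by (intro mult_mono 1 2 mult_nonneg_nonneg K') auto
      also have "\<dots> = K * \<epsilon>\<^sup>2 * ((real k + 1) * (b ^ k)\<^sup>2)"
        unfolding 3 K_def K'_def[symmetric] by (simp only: mult_ac)
      finally show "(8 + 384 * (9 + 7 / c)\<^sup>2 * card A) * 2 ^ k * (real k + 1) * H\<^sup>2 \<le> K * \<epsilon>\<^sup>2 * ((real k + 1) * (b ^ k)\<^sup>2)" .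
    qed
    finally show ?thesis .
  qed
  define S where "S x = (\<Sum>k. ennreal ((1 / b) ^ k) * V k x)" for x
  show ?thesis
  proof (intro bexI[of _ S] conjI allI impI)
    show "S \<in> borel_measurable borel" unfolding S_def by measurable
    have "(\<integral>\<^sup>+x. S x \<partial>lborel) = (\<Sum>k. ennreal ((1 / b) ^ k) * (\<integral>\<^sup>+x. V k x \<partial>lborel))"
      unfolding S_def by (subst nn_integral_suminf) (simp_all add: nn_integral_cmult)
    also have "\<dots> \<le> (\<Sum>k. ennreal (K * \<epsilon>\<^sup>2 * (real (Suc k) * b ^ k)))"
    proof (rule suminf_le)
      fix k
      have "ennreal ((1 / b) ^ k) * (\<integral>\<^sup>+x. V k x \<partial>lborel) \<le> ennreal ((1 / b) ^ k) * ennreal (K * \<epsilon>\<^sup>2 * ((real k + 1) * (b ^ k)\<^sup>2))"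
        by (intro mult_left_mono VI) auto
      also have "\<dots> = ennreal ((1 / b) ^ k * (K * \<epsilon>\<^sup>2 * ((real k + 1) * (b ^ k)\<^sup>2)))"
        by (rule ennreal_mult'[symmetric]) (use b in simp)
      also have "(1 / b) ^ k * (K * \<epsilon>\<^sup>2 * ((real k + 1) * (b ^ k)\<^sup>2)) = K * \<epsilon>\<^sup>2 * (real (Suc k) * b ^ k)"
      proof -
        have "(1 / b) ^ k * (b ^ k)\<^sup>2 = b ^ k" using b by (simp add: power_divide power2_eq_square)
        then have "K * \<epsilon>\<^sup>2 * ((real k + 1) * ((1 / b) ^ k * (b ^ k)\<^sup>2)) = K * \<epsilon>\<^sup>2 * ((real k + 1) * b ^ k)" by (simp only:)
        then show ?thesis by (simp only: mult_ac of_nat_Suc add.commute)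
      qed
      finally show "ennreal ((1 / b) ^ k) * (\<integral>\<^sup>+x. V k x \<partial>lborel) \<le> ennreal (K * \<epsilon>\<^sup>2 * (real (Suc k) * b ^ k))" .
    qed auto
    also have "\<dots> = ennreal (K / (1 - b)\<^sup>2 * \<epsilon>\<^sup>2)"
    proof -
      have "(\<lambda>k. K * \<epsilon>\<^sup>2 * (real (Suc k) * b ^ k)) sums (K * \<epsilon>\<^sup>2 * (1 / (1 - b)\<^sup>2))"
        by (intro sums_mult geometric_deriv_sums) (use b in simp)
      then have "summable (\<lambda>k. K * \<epsilon>\<^sup>2 * (real (Suc k) * b ^ k))"
        "(\<Sum>k. K * \<epsilon>\<^sup>2 * (real (Suc k) * b ^ k)) = K / (1 - b)\<^sup>2 * \<epsilon>\<^sup>2"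
        by (auto simp: sums_iff)
      then show ?thesis using K0 b by (subst suminf_ennreal2) auto
    qed
    finally show "(\<integral>\<^sup>+x. S x \<partial>lborel) \<le> ennreal (K / (1 - b)\<^sup>2 * (LINT \<xi>|lborel. (1 + \<xi>\<^sup>2) powr s * (norm (h \<xi>))\<^sup>2)\<^sup>2)"
      unfolding \<epsilon>_def .
    fix x t \<theta> and k :: nat assume x: "x \<in> {-1..1}" and Sx: "S x < top" and p: "(t, \<theta>) \<in> D"
    define n where "n = norm (osc_integral \<Phi> (dyadic_piece h k) t (x + t * \<theta>))"
    define \<sigma> where "\<sigma> = enn2real (S x)"
    have \<sigma>: "\<sigma> \<ge> 0" "S x = ennreal \<sigma>" using Sx by (auto simp: \<sigma>_def)
    have "ennreal (n ^ 4) * indicator {-1..1} x \<le> V k x"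
      unfolding V_def quartic_maximal_def n_def by (rule SUP_upper2[OF p]) simp
    then have "ennreal ((1 / b) ^ k) * ennreal (n ^ 4) \<le> ennreal ((1 / b) ^ k) * V k x"
      using x by (intro mult_left_mono) auto
    also have "\<dots> \<le> S x"
      using sum_le_suminf[of "\<lambda>k. ennreal ((1 / b) ^ k) * V k x" "{k}"] unfolding S_def by simp
    finally have "(1 / b) ^ k * n ^ 4 \<le> \<sigma>"
      unfolding \<sigma>(2) using b \<sigma>(1) by (subst (asm) ennreal_mult'[symmetric]) (auto simp: ennreal_le_iff)
    then have n4: "n ^ 4 \<le> \<sigma> * b ^ k" using b by (simp add: power_divide field_simps)
    also have "\<dots> = (root 4 \<sigma> * root 4 b ^ k) ^ 4"
    proof -
      have "(root 4 \<sigma> * root 4 b ^ k) ^ 4 = root 4 \<sigma> ^ 4 * (root 4 b ^ 4) ^ k"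
        by (simp only: power_mult_distrib power_mult[symmetric] mult.commute[of k])
      also have "root 4 \<sigma> ^ 4 = \<sigma>" using \<sigma> by simp
      also have "root 4 b ^ 4 = b" using b by simp
      finally show ?thesis by simp
    qed
    finally have "n \<le> root 4 \<sigma> * root 4 b ^ k"
      by (rule power_le_imp_le_base[of _ 3, simplified]) (use b \<sigma> in auto)
    then show "norm (osc_integral \<Phi> (dyadic_piece h k) t (x + t * \<theta>)) \<le> root 4 (enn2real (S x)) * root 4 b ^ k"
      unfolding n_def \<sigma>_def .
  qed
qed

text \<open>
Where the dyadic pieces decay geometrically on \<open>D\<close>, the limit defining the evolution exists for every time and
direction, so the default value \<open>0\<close> is never taken.
\<close>

lemma evol_at_good_point:
  fixes h :: "real \<Rightarrow> complex"
  assumes P: "\<Phi> \<in> borel_measurable borel" and h: "h \<in> borel_measurable borel"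
    and fm: "fourier f \<in> borel_measurable lebesgue" and ae: "AE \<xi> in lborel. fourier f \<xi> = h \<xi>"
    and ip: "\<And>k. integrable lborel (dyadic_piece h k)"
    and D: "D \<subseteq> {-1..1} \<times> \<Theta>" "{-1..1} \<times> \<Theta> \<subseteq> closure D"
    and t: "0 \<le> \<tau>" "\<tau> < 1" and B: "B \<ge> 0"
    and bd: "\<And>t \<theta> k. (t, \<theta>) \<in> D \<Longrightarrow> norm (osc_integral \<Phi> (dyadic_piece h k) t (x + t * \<theta>)) \<le> B * \<tau> ^ k"
  shows "maximal_evol \<Phi> \<Theta> f x = (SUP (t, \<theta>)\<in>D. ennreal (norm (lim (evol_partial \<Phi> t f (x + t * \<theta>)))))"
    and "maximal_evol \<Phi> \<Theta> f x \<le> ennreal (B / (1 - \<tau>))"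
proof -
  let ?X = "{-1..1} \<times> \<Theta>"
  define a where "a k p = osc_integral \<Phi> (dyadic_piece h k) (fst p) (x + fst p * snd p) / of_real (2 * pi)" for k p
  have ep: "evol_partial \<Phi> (fst p) f (x + fst p * snd p) = (\<lambda>N. \<Sum>k\<le>N. a k p)" for p
    unfolding a_def by (rule ext) (rule evol_partial_dyadic[OF P h fm ae ip])
  have ca: "continuous_on ?X (a k)" for k
  proof -
    have "continuous_on ?X (\<lambda>p. (fst p, x + fst p * snd p))" by (intro continuous_intros)
    from continuous_on_compose2[OF continuous_on_osc_integral[OF P ip[of k]] this]
    have "continuous_on ?X (\<lambda>p. osc_integral \<Phi> (dyadic_piece h k) (fst p) (x + fst p * snd p))" by simp
    then show ?thesis unfolding a_def by (intro continuous_intros) auto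
  qed
  have ba: "norm (a k p) \<le> B * \<tau> ^ k" if "p \<in> D" for k p
  proof -
    have "norm (a k p) = norm (osc_integral \<Phi> (dyadic_piece h k) (fst p) (x + fst p * snd p)) / (2 * pi)"
      by (simp add: a_def norm_divide)
    also have "\<dots> \<le> norm (osc_integral \<Phi> (dyadic_piece h k) (fst p) (x + fst p * snd p)) / 1"
      using pi_gt3 by (intro divide_left_mono) auto
    also have "\<dots> \<le> B * \<tau> ^ k" using bd[of "fst p" "snd p" k] that by simp
    finally show ?thesis .
  qed
  note G = geometric_series_on_dense[OF ca D t ba B]
  have ev: "evol \<Phi> (fst p) f (x + fst p * snd p) = lim (\<lambda>N. \<Sum>k\<le>N. a k p)" if "p \<in> ?X" for p
    unfolding evol_def ep using G(1)[OF _ that] by simp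
  have m: "maximal_evol \<Phi> \<Theta> f x = (SUP p\<in>?X. ennreal (norm (lim (\<lambda>N. \<Sum>k\<le>N. a k p))))"
    unfolding maximal_evol_def case_prod_beta by (rule SUP_cong[OF refl]) (simp only: ev)
  show "maximal_evol \<Phi> \<Theta> f x = (SUP (t, \<theta>)\<in>D. ennreal (norm (lim (evol_partial \<Phi> t f (x + t * \<theta>)))))"
    unfolding case_prod_beta ep m by (rule G(3))
  show "maximal_evol \<Phi> \<Theta> f x \<le> ennreal (B / (1 - \<tau>))"
    unfolding m by (intro SUP_least ennreal_leI G(2))
qed

text \<open>
The whole proof uses \<open>f\<close> only through a Borel version \<open>h\<close> of its transform and the weighted norm of \<open>h\<close>.
\<close>

lemma sobolev_energy:
  assumes f: "in_sobolev s f"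
  obtains h where "fourier f \<in> borel_measurable lebesgue" "h \<in> borel_measurable borel" "AE \<xi> in lborel. fourier f \<xi> = h \<xi>"
    "integrable lborel (\<lambda>\<xi>. (1 + \<xi>\<^sup>2) powr s * (norm (h \<xi>))\<^sup>2)"
    "ennreal (sqrt (LINT \<xi>|lborel. (1 + \<xi>\<^sup>2) powr s * (norm (h \<xi>))\<^sup>2)) \<le> 9 * sobolev_norm s f"
proof -
  have w: "1 + \<xi>\<^sup>2 > 0" for \<xi> :: real by (simp add: add_pos_nonneg)
  define g where "g = bessel_symbol s f"
  have g: "in_L2 g" using f by (simp add: in_sobolev_def g_def)
  have gm: "g \<in> borel_measurable lebesgue" and gE: "energy g < top" using g by (auto simp: in_L2_iff)
  have fg: "fourier f \<xi> = of_real ((1 + \<xi>\<^sup>2) powr (- (s / 2))) * g \<xi>" for \<xi>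
  proof -
    have "(1 + \<xi>\<^sup>2) powr (- (s / 2)) * (1 + \<xi>\<^sup>2) powr (s / 2) = 1"
      using w[of \<xi>] by (simp flip: powr_add)
    then have "of_real ((1 + \<xi>\<^sup>2) powr (- (s / 2))) * of_real ((1 + \<xi>\<^sup>2) powr (s / 2)) = (1 :: complex)"
      by (metis of_real_1 of_real_mult)
    then show ?thesis unfolding g_def bessel_symbol_def mult.assoc[symmetric] by simp
  qed
  have fm: "fourier f \<in> borel_measurable lebesgue"
  proof -
    have "(\<lambda>\<xi>. complex_of_real ((1 + \<xi>\<^sup>2) powr (- (s / 2)))) \<in> borel_measurable lebesgue"
      by (rule borel_measurable_lebesgueI) measurable
    from borel_measurable_times[OF this gm] show ?thesis unfolding fg[symmetric] by simp
  qed
  obtain h where h: "h \<in> borel_measurable borel" "AE \<xi> in lborel. fourier f \<xi> = h \<xi>"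
    by (rule borel_representative[OF fm])
  note [measurable] = h(1)
  let ?e = "\<lambda>\<xi>. (1 + \<xi>\<^sup>2) powr s * (norm (h \<xi>))\<^sup>2"
  have eg: "energy g = (\<integral>\<^sup>+\<xi>. ennreal (?e \<xi>) \<partial>lborel)"
    unfolding energy_def
  proof (rule nn_integral_cong_AE, use h(2) in eventually_elim)
    fix \<xi> assume e: "fourier f \<xi> = h \<xi>"
    have "(norm (g \<xi>))\<^sup>2 = ((1 + \<xi>\<^sup>2) powr (s / 2))\<^sup>2 * (norm (h \<xi>))\<^sup>2"
      by (simp add: g_def bessel_symbol_def e norm_mult power_mult_distrib)
    also have "((1 + \<xi>\<^sup>2) powr (s / 2))\<^sup>2 = (1 + \<xi>\<^sup>2) powr s"
      by (simp add: power2_eq_square flip: powr_add)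
    finally show "ennreal ((norm (g \<xi>))\<^sup>2) = ennreal (?e \<xi>)" by simp
  qed
  have i: "integrable lborel ?e"
    using gE unfolding eg integrable_iff_bounded by simp
  define E where "E = (LINT \<xi>|lborel. ?e \<xi>)"
  have E: "E \<ge> 0" "energy g = ennreal E"
    unfolding E_def eg by (auto intro!: nn_integral_eq_integral i)
  have le: "ennreal E \<le> 80 * (sobolev_norm s f)\<^sup>2"
    using energy_le_inv_fourier[OF g]
    unfolding E(2)[symmetric] sobolev_norm_def bessel_def L2_norm_square g_def .
  have "ennreal (sqrt E) \<le> 9 * sobolev_norm s f"
  proof (cases "sobolev_norm s f")
    case (real b)
    have "ennreal E \<le> ennreal (80 * b\<^sup>2)"
      using le real by (simp add: ennreal_power ennreal_mult')
    then have "E \<le> 80 * b\<^sup>2" by (subst (asm) ennreal_le_iff) auto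
    also have "\<dots> \<le> (9 * b)\<^sup>2" by (simp add: power_mult_distrib)
    finally have "sqrt E \<le> 9 * b" using real by (intro real_le_lsqrt) (auto simp: E)
    then have "ennreal (sqrt E) \<le> ennreal (9 * b)" by (rule ennreal_leI)
    then show ?thesis using real by (simp add: ennreal_mult')
  qed (simp add: ennreal_mult_top)
  then show thesis using that[OF fm h i] unfolding E_def by blast
qed

theorem theorem1:
  fixes \<Theta> :: "real set" and \<Phi> :: "real \<Rightarrow> real" and C1 C2 q s :: real
  assumes "compact \<Theta>"
    and "\<Phi> differentiable_on UNIV" and "deriv \<Phi> C1_differentiable_on UNIV"
    and "C1 > 0" and "C2 > 0"
    and "\<And>\<xi>. \<bar>\<xi>\<bar> \<ge> 1 \<Longrightarrow> \<bar>\<xi>\<bar> * \<bar>deriv (deriv \<Phi>) \<xi>\<bar> \<ge> C1"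
    and "\<And>\<xi>. \<bar>\<xi>\<bar> \<ge> 1 \<Longrightarrow> \<bar>\<xi>\<bar> * \<bar>deriv (deriv \<Phi>) \<xi>\<bar> \<ge> C2 * \<bar>deriv \<Phi> \<xi>\<bar>"
    and "1 \<le> q" and "q \<le> 4"
    and "s > (upper_minkowski_dim \<Theta> + 1) / 4"
  shows "\<exists>C::real. C \<ge> 0 \<and> (\<forall>f. in_sobolev s f \<longrightarrow>
           maximal_evol \<Phi> \<Theta> f \<in> borel_measurable (lebesgue_on {-1<..<1}) \<and>
           Lp_norm (lebesgue_on {-1<..<1}) q (maximal_evol \<Phi> \<Theta> f)
             \<le> ennreal C * sobolev_norm s f)"
proof -
  let ?p = "deriv \<Phi>" and ?pp = "deriv (deriv \<Phi>)"
  have d1: "(\<Phi> has_real_derivative ?p \<xi>) (at \<xi>)" for \<xi>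
    using assms(2) by (simp add: differentiable_on_def DERIV_deriv_iff_real_differentiable)
  obtain P2 where P2: "\<And>\<xi>. (?p has_vector_derivative P2 \<xi>) (at \<xi>)" "continuous_on UNIV P2"
    using assms(3) unfolding C1_differentiable_on_def by blast
  have P2': "P2 = ?pp"
    by (rule ext) (rule DERIV_imp_deriv[OF P2(1)[folded has_real_derivative_iff_has_vector_derivative], symmetric])
  have d2: "(?p has_real_derivative ?pp \<xi>) (at \<xi>)" for \<xi>
    using P2(1)[of \<xi>] unfolding P2' has_real_derivative_iff_has_vector_derivative .
  have cpp: "continuous_on A ?pp" for A
    using P2(2) unfolding P2' by (rule continuous_on_subset) simp
  have nz: "?pp \<xi> \<noteq> 0" if "\<bar>\<xi>\<bar> \<ge> 1" for \<xi>
    using assms(6)[OF that] assms(4) by auto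
  have "\<exists>\<sigma>. \<bar>\<sigma>\<bar> = 1 \<and> (\<forall>\<xi>\<in>{1..}. 0 \<le> \<sigma> * ?pp \<xi>)"
    by (intro constant_sign cpp nz) auto
  then obtain \<sigma>1 where s1: "\<bar>\<sigma>1\<bar> = 1" "\<And>\<xi>. 1 \<le> \<xi> \<Longrightarrow> 0 \<le> \<sigma>1 * ?pp \<xi>" by auto
  have "\<exists>\<sigma>. \<bar>\<sigma>\<bar> = 1 \<and> (\<forall>\<xi>\<in>{..-1}. 0 \<le> \<sigma> * ?pp \<xi>)"
    by (intro constant_sign cpp nz) auto
  then obtain \<sigma>2 where s2: "\<bar>\<sigma>2\<bar> = 1" "\<And>\<xi>. \<xi> \<le> -1 \<Longrightarrow> 0 \<le> \<sigma>2 * ?pp \<xi>" by auto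
  have bT: "bounded \<Theta>" by (rule compact_imp_bounded[OF assms(1)])
  obtain M where M: "M > 0" "\<Theta> \<subseteq> {-M..M}" by (rule bounded_symmetric_interval[OF bT])
  \<comment> \<open>From \<open>|\<Phi>' + \<theta>| \<le> |\<Phi>'| + M\<close>, where the hypothesis with \<open>C2\<close> bounds the first term and the one with \<open>C1\<close> the second.\<close>
  define c where "c = 1 / (1 / C2 + M / C1)"
  have k0: "1 / C2 + M / C1 > 0" using assms(4,5) M by (simp add: add_pos_pos)
  have c: "c > 0" using k0 by (simp add: c_def)
  have cv: "c * \<bar>?p \<xi> + \<theta>\<bar> \<le> \<bar>\<xi>\<bar> * \<bar>?pp \<xi>\<bar>" if x: "1 \<le> \<bar>\<xi>\<bar>" and t: "\<theta> \<in> \<Theta>" for \<xi> \<theta>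
  proof -
    define X where "X = \<bar>\<xi>\<bar> * \<bar>?pp \<xi>\<bar>"
    have "\<bar>?p \<xi>\<bar> \<le> X / C2" using assms(7)[OF x] assms(5) by (simp add: X_def field_simps)
    moreover have "\<bar>\<theta>\<bar> \<le> M" using t M by (auto simp: abs_le_iff)
    moreover have "M * 1 \<le> M * (X / C1)" using assms(6)[OF x] assms(4) M by (intro mult_left_mono) (auto simp: X_def)
    ultimately have "\<bar>?p \<xi> + \<theta>\<bar> \<le> X / C2 + M * (X / C1)" by linarith
    also have "\<dots> = X * (1 / C2 + M / C1)" by (simp add: distrib_left)
    finally show ?thesis unfolding c_def X_def[symmetric] using k0 by (simp add: field_simps)
  qed
  have "upper_minkowski_dim \<Theta> < 4 * s - 1" using assms(10) by simp
  then obtain r C where r: "0 < r" "r < 4 * s - 1" "C \<ge> (0::real)"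
    and cover: "\<And>k. \<exists>A. finite A \<and> \<Theta> \<subseteq> (\<Union>a\<in>A. {a..a + 1 / 2 ^ k}) \<and> real (card A) \<le> C * 2 powr (r * real k)"
    by (rule dyadic_covers[OF bT]) blast
  have s0: "s > 0" using r by linarith
  obtain D :: "(real \<times> real) set"
    where D: "countable D" "D \<subseteq> {-1..1} \<times> \<Theta>" "{-1..1} \<times> \<Theta> \<subseteq> closure D"
    using separable[of "{-1..1} \<times> \<Theta>"] by blast
  define b where "b = 2 powr (- (4 * s - 1 - r) / 2)"
  define K where "K = (8 + 384 * (9 + 7 / c)\<^sup>2 * C) * 16 powr s"
  have b: "0 < b" "b < 1" unfolding b_def using r by (auto intro!: powr_less_one)
  define \<tau> where "\<tau> = root 4 b"
  have \<tau>: "0 \<le> \<tau>" "\<tau> < 1" using b by (auto simp: \<tau>_def)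
  define T where "T = K / (1 - b)\<^sup>2"
  have "K > 0" unfolding K_def using r(3) by (intro mult_pos_pos add_pos_nonneg) auto
  then have T: "T > 0" using b by (simp add: T_def)
  define \<kappa> where "\<kappa> = 1 / (1 - \<tau>)"
  have \<kappa>: "\<kappa> > 0" using \<tau> by (simp add: \<kappa>_def)
  have Pm[measurable]: "\<Phi> \<in> borel_measurable borel"
    by (intro borel_measurable_continuous_onI DERIV_continuous_on[where D = ?p])
       (use d1 in \<open>auto intro: has_field_derivative_at_within\<close>)
  let ?I = "{-1<..<1::real}"
  have main: "maximal_evol \<Phi> \<Theta> f \<in> borel_measurable (lebesgue_on ?I) \<and>
       Lp_norm (lebesgue_on ?I) q (maximal_evol \<Phi> \<Theta> f) \<le> ennreal (27 * (\<kappa> * root 4 T)) * sobolev_norm s f"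
    if f: "in_sobolev s f" for f
  proof -
    obtain h where fm: "fourier f \<in> borel_measurable lebesgue" and h: "h \<in> borel_measurable borel"
      and ae: "AE \<xi> in lborel. fourier f \<xi> = h \<xi>"
      and iE: "integrable lborel (\<lambda>\<xi>. (1 + \<xi>\<^sup>2) powr s * (norm (h \<xi>))\<^sup>2)"
      and Es: "ennreal (sqrt (LINT \<xi>|lborel. (1 + \<xi>\<^sup>2) powr s * (norm (h \<xi>))\<^sup>2)) \<le> 9 * sobolev_norm s f"
      by (rule sobolev_energy[OF f])
    note [measurable] = h
    define E where "E = (LINT \<xi>|lborel. (1 + \<xi>\<^sup>2) powr s * (norm (h \<xi>))\<^sup>2)"
    have E0: "E \<ge> 0" by (simp add: E_def)
    have ip: "integrable lborel (dyadic_piece h k)" for k by (rule dyadic_piece_facts(1)[OF h s0 iE])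
    have pm[measurable]: "dyadic_piece h k \<in> borel_measurable borel" for k using ip[of k] by auto
    have "\<exists>S \<in> borel_measurable borel.
      (\<integral>\<^sup>+x. S x \<partial>lborel) \<le> ennreal (T * E\<^sup>2) \<and>
      (\<forall>x t \<theta> k. x \<in> {-1..1} \<longrightarrow> S x < top \<longrightarrow> (t, \<theta>) \<in> D \<longrightarrow>
        norm (osc_integral \<Phi> (dyadic_piece h k) t (x + t * \<theta>)) \<le> root 4 (enn2real (S x)) * \<tau> ^ k)"
      unfolding T_def K_def b_def \<tau>_def E_def
      by (rule dyadic_majorant[OF d1 d2 s1 s2 c cv D(1,2) r cover h iE])
    then obtain S where Sm[measurable]: "S \<in> borel_measurable borel"
      and SI: "(\<integral>\<^sup>+x. S x \<partial>lborel) \<le> ennreal (T * E\<^sup>2)"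
      and Sb: "\<And>x t \<theta> k. x \<in> {-1..1} \<Longrightarrow> S x < top \<Longrightarrow> (t, \<theta>) \<in> D \<Longrightarrow>
        norm (osc_integral \<Phi> (dyadic_piece h k) t (x + t * \<theta>)) \<le> root 4 (enn2real (S x)) * \<tau> ^ k"
      by blast
    define N where "N x = (SUP (t, \<theta>)\<in>D. ennreal (norm (lim (evol_partial \<Phi> t f (x + t * \<theta>)))))" for x
    have [measurable]: "(\<lambda>x. evol_partial \<Phi> t f (x + t * \<theta>) n) \<in> borel_measurable borel" for t \<theta> n
      unfolding evol_partial_dyadic[OF Pm h fm ae ip] by measurable
    have Nm: "N \<in> borel_measurable borel"
    proof -
      have "(\<lambda>x. ennreal (norm (lim (evol_partial \<Phi> t f (x + t * \<theta>))))) \<in> borel_measurable borel" for t \<theta>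
        using borel_measurable_lim_metric[of "\<lambda>n x. evol_partial \<Phi> t f (x + t * \<theta>) n" borel] by simp
      then show ?thesis unfolding N_def case_prod_beta using D(1) by (intro borel_measurable_SUP) auto
    qed
    have good: "maximal_evol \<Phi> \<Theta> f x = N x" "maximal_evol \<Phi> \<Theta> f x \<le> ennreal (\<kappa> * root 4 (enn2real (S x)))"
      if x: "x \<in> ?I" and Sx: "S x < top" for x
    proof -
      have x': "x \<in> {-1..1}" using x by simp
      note G = evol_at_good_point[OF Pm h fm ae ip D(2,3) \<tau> _ Sb[OF x' Sx]]
      show "maximal_evol \<Phi> \<Theta> f x = N x" unfolding N_def by (rule G(1)) simp
      have "maximal_evol \<Phi> \<Theta> f x \<le> ennreal (root 4 (enn2real (S x)) / (1 - \<tau>))" by (rule G(2)) simp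
      then show "maximal_evol \<Phi> \<Theta> f x \<le> ennreal (\<kappa> * root 4 (enn2real (S x)))" by (simp add: \<kappa>_def)
    qed
    have "(\<integral>\<^sup>+x. S x \<partial>lborel) < \<infinity>" using SI by (rule le_less_trans) simp
    then have "AE x in lborel. S x \<noteq> \<infinity>" by (intro nn_integral_noteq_infinite) auto
    then have aeS: "AE x in lebesgue. S x \<noteq> \<infinity>" by (rule AE_completion)
    have meas: "maximal_evol \<Phi> \<Theta> f \<in> borel_measurable (lebesgue_on ?I)"
    proof (rule measurable_lebesgue_on_AE_eq)
      show "N \<in> borel_measurable lebesgue" by (rule measurable_completion) (simp add: Nm)
      show "AE x in lebesgue. x \<in> ?I \<longrightarrow> maximal_evol \<Phi> \<Theta> f x = N x"
        using aeS by eventually_elim (use good(1) in \<open>auto simp: less_top\<close>)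
    qed simp
    have bound: "Lp_norm (lebesgue_on ?I) q (maximal_evol \<Phi> \<Theta> f) \<le> ennreal (3 * (\<kappa> * root 4 A))"
      if A: "A > 0" "T * E\<^sup>2 \<le> A" for A
    proof (rule Lp_norm_from_quartic[OF _ _ _ A(1) \<kappa> assms(8,9)])
      have Sl: "S \<in> borel_measurable lebesgue" by (rule measurable_completion) simp
      then show "S \<in> borel_measurable (lebesgue_on ?I)" by (rule measurable_restrict_space1)
      show "emeasure (lebesgue_on ?I) (space (lebesgue_on ?I)) \<le> 2" by (simp add: emeasure_restrict_space)
      have "(\<integral>\<^sup>+x. S x \<partial>lebesgue_on ?I) = (\<integral>\<^sup>+x. S x * indicator ?I x \<partial>lebesgue)"
        by (rule nn_integral_restrict_space) simp
      also have "\<dots> \<le> (\<integral>\<^sup>+x. S x \<partial>lebesgue)" by (intro nn_integral_mono) (auto simp: indicator_def)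
      also have "\<dots> = (\<integral>\<^sup>+x. S x \<partial>lborel)" by (rule nn_integral_completion)
      also have "\<dots> \<le> ennreal A" using SI ennreal_leI[OF A(2)] by (rule order_trans)
      finally show "(\<integral>\<^sup>+x. S x \<partial>lebesgue_on ?I) \<le> ennreal A" .
      show "AE x in lebesgue_on ?I. S x < top \<longrightarrow> maximal_evol \<Phi> \<Theta> f x \<le> ennreal (\<kappa> * root 4 (enn2real (S x)))"
        using good(2) by (intro AE_I2) simp
    qed
    have "Lp_norm (lebesgue_on ?I) q (maximal_evol \<Phi> \<Theta> f) \<le> ennreal (3 * (\<kappa> * root 4 T) * sqrt E)"
    proof (cases "E = 0")
      case True
      \<comment> \<open>The bound needs a positive \<open>A\<close>; for \<open>E = 0\<close> every such \<open>A\<close> is admissible, and this one gives \<open>e\<close>.\<close>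
      show ?thesis
      proof (rule ennreal_le_epsilon)
        fix e :: real assume e: "e > 0"
        define A where "A = (e / (3 * \<kappa>)) ^ 4"
        have "A > 0" using e \<kappa> by (simp add: A_def)
        moreover have "3 * (\<kappa> * root 4 A) = e" using e \<kappa> by (simp add: A_def real_root_power_cancel)
        ultimately show "Lp_norm (lebesgue_on ?I) q (maximal_evol \<Phi> \<Theta> f) \<le> ennreal (3 * (\<kappa> * root 4 T) * sqrt E) + ennreal e"
          using bound[of A] True by simp
      qed
    next
      case False
      have "root 4 (T * E\<^sup>2) = root 4 T * sqrt E"
      proof -
        have "root 4 (E\<^sup>2) = root 2 (root 2 (E\<^sup>2))" by (simp flip: real_root_mult_exp)
        also have "\<dots> = sqrt E" using E0 by (simp add: sqrt_def[symmetric])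
        finally show ?thesis by (simp add: real_root_mult)
      qed
      then show ?thesis using bound[of "T * E\<^sup>2"] T False by (simp add: mult.assoc)
    qed
    also have "\<dots> = ennreal (3 * (\<kappa> * root 4 T)) * ennreal (sqrt E)"
      by (rule ennreal_mult') (use T \<kappa> in simp)
    also have "\<dots> \<le> ennreal (3 * (\<kappa> * root 4 T)) * (9 * sobolev_norm s f)"
      using Es unfolding E_def by (rule mult_left_mono) simp
    also have "\<dots> = ennreal (27 * (\<kappa> * root 4 T)) * sobolev_norm s f"
    proof -
      have "ennreal (3 * (\<kappa> * root 4 T)) * 9 = ennreal (3 * (\<kappa> * root 4 T) * 9)"
        using ennreal_mult'[of "3 * (\<kappa> * root 4 T)" 9] T \<kappa> by simp
      then show ?thesis by (simp add: mult.assoc[symmetric])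
    qed
    finally show ?thesis using meas by blast
  qed
  show ?thesis
    by (rule exI[of _ "27 * (\<kappa> * root 4 T)"]) (use main T \<kappa> in auto)
qed

end
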